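(* Let $\Omega\subset\mathbb{R}^n$ be a bounded domain, $p\in(1,\infty)$, $s\in(0,1)$ and $g\in W^{s,p}_0(\Omega)$. Assume that $v$ is a weak solution of $$\begin{cases}|v_t|^{p-2}v_t+(-\Delta_p)^s v=0, & \Omega\times(0,\infty),\\ v=0, & (\mathbb{R}^n\setminus\Omega)\times[0,\infty),\\ v=g, & \Omega\times\{0\},\end{cases}$$ such that $v(\cdot,t)\ne0\in L^p(\Omega)$ for each $t\ge0$. Then the Rayleigh quotient $$\frac{[v(\cdot,t)]^p_{W^{s,p}(\mathbb{R}^n)}}{\displaystyle\int_\Omega|v(x,t)|^p\,dx}$$ is nonincreasing in $t$.
   Context: Fractional Sobolev spaces: $[u]^p_{W^{s,p}(\mathbb{R}^n)}=\int_{\mathbb{R}^n}\int_{\mathbb{R}^n}\frac{|u(x)-u(y)|^p}{|x-y|^{n+sp}}\,dx\,dy$, $\|u\|^p_{W^{s,p}(\mathbb{R}^n)}=[u]^p_{W^{s,p}(\mathbb{R}^n)}+\|u\|^p_{L^p(\mathbb{R}^n)}$, and $W^{s,p}_0(\Omega)$ is the closure of $C_0^\infty(\Omega)$ in this norm. $(-\Delta_p)^s$ is the fractional $p$-Laplacian. Weak solution: write $\mathcal{J}_p(t)=|t|^{p-2}t$. A function $v$ is a weak solution of the initial value problem above if $v\in L^\infty([0,\infty);W^{s,p}_0(\Omega))$, $v_t\in L^p(\Omega\times[0,\infty))$, $$\int_\Omega\mathcal{J}_p(v_t(x,t))\phi(x)\,dx+\int_{\mathbb{R}^n}\int_{\mathbb{R}^n}\frac{\mathcal{J}_p(v(x,t)-v(y,t))(\phi(x)-\phi(y))}{|x-y|^{n+sp}}\,dx\,dy=0$$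 for each $\phi\in W^{s,p}_0(\Omega)$ and a.e. $t>0$, and $v(x,0)=g(x)$ (meaningful since $t\mapsto v(\cdot,t)$ is absolutely continuous with values in $L^p(\Omega)$). *)

theory Defs
  imports "HOL-Analysis.Analysis"
begin

text \<open>
  Conventions. The space R^n is an arbitrary type of class \<open>euclidean_space\<close>, with n being
  \<open>DIM('a)\<close>, and all integrals are taken with respect to Lebesgue measure \<open>lborel\<close>.
  An element of an Lp-type space is given by a Borel representative; all notions below
  disregard null sets. Nonnegative integrals are \<open>ennreal\<close>-valued, so that a divergent integral
  has the value infinity. Norms enter through their p-th powers.
\<close>

subsection \<open>Test functions\<close>

text \<open>All partial derivatives up to order k exist and are continuous.\<close>

primrec Ck :: "nat \<Rightarrow> ('a::euclidean_space \<Rightarrow> real) \<Rightarrow> bool" where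
  "Ck 0 f \<longleftrightarrow> continuous_on UNIV f"
| "Ck (Suc k) f \<longleftrightarrow>
     (\<forall>x. f differentiable at x) \<and> (\<forall>b\<in>Basis. Ck k (\<lambda>x. frechet_derivative f (at x) b))"

definition Cc_infty :: "'a::euclidean_space set \<Rightarrow> ('a \<Rightarrow> real) set" where
  "Cc_infty \<Omega> = {f. (\<forall>k. Ck k f) \<and> (\<exists>K\<subseteq>\<Omega>. compact K \<and> (\<forall>x. x \<notin> K \<longrightarrow> f x = 0))}"

subsection \<open>Fractional Sobolev spaces\<close>

definition Lp_pow :: "real \<Rightarrow> 'a::euclidean_space set \<Rightarrow> ('a \<Rightarrow> real) \<Rightarrow> ennreal" where
  "Lp_pow p A u = (\<integral>\<^sup>+x\<in>A. ennreal (\<bar>u x\<bar> powr p) \<partial>lborel)"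

definition Lp_space :: "real \<Rightarrow> 'a::euclidean_space set \<Rightarrow> ('a \<Rightarrow> real) set" where
  "Lp_space p A = {u. set_borel_measurable lborel A u \<and> Lp_pow p A u < \<infinity>}"

definition Wsp_semi_pow :: "real \<Rightarrow> real \<Rightarrow> ('a::euclidean_space \<Rightarrow> real) \<Rightarrow> ennreal" where
  "Wsp_semi_pow s p u =
     (\<integral>\<^sup>+(x, y). ennreal (\<bar>u x - u y\<bar> powr p / norm (x - y) powr (real DIM('a) + s * p))
        \<partial>(lborel \<Otimes>\<^sub>M lborel))"

definition Wsp_norm_pow :: "real \<Rightarrow> real \<Rightarrow> ('a::euclidean_space \<Rightarrow> real) \<Rightarrow> ennreal" where
  "Wsp_norm_pow s p u = Wsp_semi_pow s p u + Lp_pow p UNIV u"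

definition Wsp :: "real \<Rightarrow> real \<Rightarrow> ('a::euclidean_space \<Rightarrow> real) set" where
  "Wsp s p = {u \<in> borel_measurable lborel. Wsp_norm_pow s p u < \<infinity>}"

definition Wsp0 :: "real \<Rightarrow> real \<Rightarrow> 'a::euclidean_space set \<Rightarrow> ('a \<Rightarrow> real) set" where
  "Wsp0 s p \<Omega> =
     {u \<in> Wsp s p. \<forall>\<epsilon>>0. \<exists>\<phi>\<in>Cc_infty \<Omega>. Wsp_norm_pow s p (\<lambda>x. u x - \<phi> x) < ennreal \<epsilon>}"

text \<open>
  Membership in the Bochner space of essentially bounded functions from the half line
  \<open>{0..}\<close> to \<open>Wsp0 s p \<Omega>\<close>: strong measurability (almost everywhere limit, in norm, of simple
  functions with values in \<open>Wsp0 s p \<Omega>\<close>) and an almost everywhere bound on the norm.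
\<close>

definition Linfty_Wsp0 ::
    "real \<Rightarrow> real \<Rightarrow> 'a::euclidean_space set \<Rightarrow> (real \<Rightarrow> 'a \<Rightarrow> real) \<Rightarrow> bool" where
  "Linfty_Wsp0 s p \<Omega> v \<longleftrightarrow>
     (\<exists>S :: nat \<Rightarrow> real \<Rightarrow> 'a \<Rightarrow> real.
        (\<forall>k. simple_function (restrict_space lborel {0..}) (S k)) \<and>
        (\<forall>k. \<forall>t\<ge>0. S k t \<in> Wsp0 s p \<Omega>) \<and>
        (AE t in lborel. 0 \<le> t \<longrightarrow>
           (\<lambda>k. Wsp_norm_pow s p (\<lambda>x. v t x - S k t x)) \<longlonglongrightarrow> 0)) \<and>
     (\<exists>M::real. AE t in lborel. 0 \<le> t \<longrightarrow>
        v t \<in> Wsp0 s p \<Omega> \<and> Wsp_norm_pow s p (v t) \<le> ennreal M)"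

subsection \<open>Weak solutions\<close>

definition Jp :: "real \<Rightarrow> real \<Rightarrow> real" where
  "Jp p t = \<bar>t\<bar> powr (p - 2) * t"

text \<open>The function w is the distributional time derivative of v in the cylinder over \<open>\<Omega>\<close>.\<close>

definition weak_time_derivative ::
    "'a::euclidean_space set \<Rightarrow> (real \<Rightarrow> 'a \<Rightarrow> real) \<Rightarrow> (real \<Rightarrow> 'a \<Rightarrow> real) \<Rightarrow> bool" where
  "weak_time_derivative \<Omega> v w \<longleftrightarrow>
     (\<forall>\<psi>\<in>Cc_infty ({0<..} \<times> \<Omega>).
        (LINT z:({0<..} \<times> \<Omega>)|lborel.
           v (fst z) (snd z) * deriv (\<lambda>\<tau>. \<psi> (\<tau>, snd z)) (fst z)) =
        - (LINT z:({0<..} \<times> \<Omega>)|lborel. w (fst z) (snd z) * \<psi> z))"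

text \<open>
  The value \<open>v t x\<close> stands for v(x,t); values at negative times are irrelevant.
  A curve with \<open>v\<close> in Lp and distributional derivative in Lp has exactly one representative that is
  continuous (it is then absolutely continuous) as a map into Lp; it is the one for which the
  initial condition and statements about every single time make sense. The conditions
  \<open>v t \<in> Lp_space p \<Omega>\<close> and continuity in Lp select this representative.
\<close>

definition weak_solution ::
    "real \<Rightarrow> real \<Rightarrow> 'a::euclidean_space set \<Rightarrow> ('a \<Rightarrow> real) \<Rightarrow> (real \<Rightarrow> 'a \<Rightarrow> real) \<Rightarrow> bool" where
  "weak_solution s p \<Omega> g v \<longleftrightarrow>
     set_borel_measurable (lborel :: (real \<times> 'a) measure) ({0..} \<times> UNIV) (\<lambda>z. v (fst z) (snd z)) \<and>
     Linfty_Wsp0 s p \<Omega> v \<and>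
     (\<forall>t\<ge>0. v t \<in> Lp_space p \<Omega> \<and>
        ((\<lambda>\<tau>. Lp_pow p \<Omega> (\<lambda>x. v \<tau> x - v t x)) \<longlongrightarrow> 0) (at t within {0..})) \<and>
     (\<forall>t\<ge>0. AE x in lborel. x \<notin> \<Omega> \<longrightarrow> v t x = 0) \<and>
     (AE x in lborel. x \<in> \<Omega> \<longrightarrow> v 0 x = g x) \<and>
     (\<exists>w :: real \<Rightarrow> 'a \<Rightarrow> real.
        weak_time_derivative \<Omega> v w \<and>
        (\<lambda>z. w (fst z) (snd z)) \<in> Lp_space p ({0..} \<times> \<Omega>) \<and>
        (\<forall>\<phi>\<in>Wsp0 s p \<Omega>. AE t in lborel. 0 < t \<longrightarrow>
           (LINT x:\<Omega>|lborel. Jp p (w t x) * \<phi> x) +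
           (LINT z|(lborel \<Otimes>\<^sub>M lborel).
              Jp p (v t (fst z) - v t (snd z)) * (\<phi> (fst z) - \<phi> (snd z)) /
                norm (fst z - snd z) powr (real DIM('a) + s * p)) = 0))"

end

theory Submission
  imports Defs
begin

text \<open>
  Write E for the p-th power of the seminorm of the solution at a given time, N for that of its Lp
  norm, and w for the time derivative. Formally, testing the equation with the solution and with its
  derivative gives \<open>E = - \<integral> Jp p w * v\<close> and \<open>E' = - p \<integral> \<bar>w\<bar> powr p\<close>, while
  \<open>N' = p \<integral> Jp p v * w\<close>. If E exceeds \<open>l * N\<close>, two applications of Young's inequality yield
  \<open>\<integral> \<bar>w\<bar> powr p + l \<integral> Jp p v * w \<ge> 0\<close> (lemma \<open>rate_nonneg\<close>), so that \<open>E - l * N\<close> does not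
  increase as long as it is positive. Hence the sublevels of the Rayleigh quotient are invariant,
  which is the assertion.

  The derivative of the solution is not an admissible test function and E is not known to be
  differentiable. Instead, convexity of E and the equation at almost every time \<open>\<tau>\<close>, tested with
  the difference of the values at times \<open>\<sigma>\<close> and \<open>\<tau>\<close>, bound \<open>E \<sigma> - E \<tau>\<close> from below by
  \<open>p \<integral> Jp p (w \<tau>) * (v \<tau> - v \<sigma>)\<close>, and \<open>v \<tau> - v \<sigma>\<close> is the time integral of w. Averaging over
  pairs of times at distance \<open>\<delta>\<close> and letting \<open>\<delta>\<close> tend to zero, the time averages of w converge to
  w weakly in Lp, and lower semicontinuity of E at the later time suffices to obtain the energy
  inequality between any two times (lemmas \<open>integrated_decrease\<close> and \<open>energy_dissipation\<close>). The
  same lemma applied backwards in time gives the inequality for N (lemma \<open>mass_increase\<close>).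

  Two points need care. Exceptional times are reached because the equation at almost every
  time \<open>\<tau>\<close> can be tested with the value of the solution at every time: bounded sequences that
  converge almost everywhere converge weakly (lemmas \<open>integral_Jp_tendsto_bounded\<close> and
  \<open>all_times\<close>). That \<open>v \<tau> - v \<sigma>\<close> is the integral of w follows from the distributional definition of w
  by testing with products of smooth steps (lemma \<open>weak_derivative_AE_increment\<close>).
\<close>

section \<open>Pairings between a power of a function and a function in Lp\<close>

text \<open>
  Hoelder's inequality is never needed: \<open>Jp p a * b\<close> is always estimated by Young's inequality,
  with exact constants (which is convexity of the p-th power) or with a small constant on either of
  the two factors.
\<close>

lemma Jp_zero [simp]: "Jp p 0 = 0"
  by (simp add: Jp_def)

lemma Jp_measurable [measurable]:
  assumes [measurable]: "f \<in> borel_measurable M"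
  shows "(\<lambda>x. Jp p (f x)) \<in> borel_measurable M"
  unfolding Jp_def by measurable

lemma abs_Jp: "\<bar>Jp p a\<bar> = \<bar>a\<bar> powr (p - 1)"
proof (cases "a = 0")
  case False
  have "\<bar>a\<bar> powr (p - 1) = \<bar>a\<bar> powr (p - 2) * \<bar>a\<bar>"
    using powr_add[of "\<bar>a\<bar>" "p - 2" 1] by simp
  then show ?thesis using False by (simp add: Jp_def abs_mult)
qed simp

lemma Jp_self: "Jp p a * a = \<bar>a\<bar> powr p"
proof (cases "a = 0")
  case False
  have "\<bar>a\<bar> powr p = \<bar>a\<bar> powr (p - 2) * a\<^sup>2"
    using powr_add[of "\<bar>a\<bar>" "p - 2" 2] False by simp
  then show ?thesis using False by (simp add: Jp_def power2_eq_square powr_numeral)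
qed simp

lemma powr_pred_mult: "(a::real) \<ge> 0 \<Longrightarrow> a powr (p - 1) * a = a powr p"
  using abs_Jp[of p a] Jp_self[of p a] by (cases "a = 0") (simp_all add: powr_diff)

lemma Jp_scale: "0 \<le> c \<Longrightarrow> Jp p (c * a) = c powr (p - 1) * Jp p a"
proof (cases "c = 0")
  case False
  assume "0 \<le> c"
  moreover from this have "c powr (p - 1) = c powr (p - 2) * c"
    using powr_add[of c "p - 2" 1] by simp
  ultimately show ?thesis using False by (simp add: Jp_def abs_mult powr_mult)
qed simp

lemma Jp_young:
  assumes "1 < p"
  shows "p * (Jp p a * b) \<le> (p - 1) * \<bar>a\<bar> powr p + \<bar>b\<bar> powr p"
proof -
  have "Jp p a * b \<le> \<bar>Jp p a\<bar> * \<bar>b\<bar>"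
    by (metis abs_ge_self abs_mult)
  also have "\<dots> \<le> \<bar>Jp p a\<bar> powr (p / (p - 1)) / (p / (p - 1)) + \<bar>b\<bar> powr p / p"
    using assms by (intro Youngs_inequality) (auto simp: field_simps)
  also have "\<bar>Jp p a\<bar> powr (p / (p - 1)) = \<bar>a\<bar> powr p"
    using assms by (simp add: abs_Jp powr_powr)
  finally show ?thesis using assms by (simp add: field_simps)
qed

lemma Jp_convex:
  assumes "1 < p"
  shows "\<bar>a\<bar> powr p + p * (Jp p a * (b - a)) \<le> \<bar>b\<bar> powr p"
  using Jp_young[OF assms, of a b] Jp_self[of p a] by (simp add: algebra_simps)

lemma Jp_young_small_right:
  assumes "1 < p" "0 < \<epsilon>"
  shows "\<bar>Jp p a * b\<bar> \<le> \<epsilon> * \<bar>b\<bar> powr p + \<epsilon> powr (- (1 / (p - 1))) * \<bar>a\<bar> powr p"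
proof (cases "\<bar>a\<bar> powr (p - 1) \<le> \<epsilon> * \<bar>b\<bar> powr (p - 1)")
  case True
  then have "\<bar>Jp p a * b\<bar> \<le> \<epsilon> * \<bar>b\<bar> powr (p - 1) * \<bar>b\<bar>"
    by (simp add: abs_mult abs_Jp mult_right_mono)
  also have "\<dots> = \<epsilon> * \<bar>b\<bar> powr p" by (simp add: powr_pred_mult mult.assoc)
  also have "\<dots> \<le> \<epsilon> * \<bar>b\<bar> powr p + \<epsilon> powr (- (1 / (p - 1))) * \<bar>a\<bar> powr p" by simp
  finally show ?thesis .
next
  case False
  define C where "C = \<epsilon> powr (- (1 / (p - 1)))"
  have "\<bar>b\<bar> \<le> C * \<bar>a\<bar>"
  proof (rule ccontr)
    assume "\<not> ?thesis"
    then have "(C * \<bar>a\<bar>) powr (p - 1) \<le> \<bar>b\<bar> powr (p - 1)"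
      using assms by (intro powr_mono2) (auto simp: C_def)
    moreover have "C powr (p - 1) = 1 / \<epsilon>"
      using assms by (simp add: C_def powr_powr powr_minus_divide powr_divide)
    ultimately show False using False assms by (simp add: powr_mult field_simps)
  qed
  then have "\<bar>Jp p a * b\<bar> \<le> \<bar>a\<bar> powr (p - 1) * (C * \<bar>a\<bar>)"
    by (simp add: abs_mult abs_Jp mult_left_mono)
  also have "\<dots> = C * \<bar>a\<bar> powr p" using powr_pred_mult[of "\<bar>a\<bar>" p] by (simp add: mult.left_commute)
  finally have "\<bar>Jp p a * b\<bar> \<le> C * \<bar>a\<bar> powr p" .
  moreover have "0 \<le> \<epsilon> * \<bar>b\<bar> powr p" using assms by simp
  ultimately show ?thesis unfolding C_def by linarith
qed

lemma Jp_young_small_left: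
  assumes "1 < p" "0 < \<epsilon>"
  shows "\<bar>Jp p a * b\<bar> \<le> \<epsilon> * \<bar>a\<bar> powr p + \<epsilon> powr (1 - p) * \<bar>b\<bar> powr p"
proof (cases "\<bar>b\<bar> \<le> \<epsilon> * \<bar>a\<bar>")
  case True
  then have "\<bar>Jp p a * b\<bar> \<le> \<bar>a\<bar> powr (p - 1) * (\<epsilon> * \<bar>a\<bar>)"
    by (simp add: abs_mult abs_Jp mult_left_mono)
  also have "\<dots> = \<epsilon> * \<bar>a\<bar> powr p" using powr_pred_mult[of "\<bar>a\<bar>" p] by (simp add: mult.left_commute)
  finally show ?thesis using assms by (smt (verit) mult_nonneg_nonneg powr_ge_zero)
next
  case False
  then have "\<bar>a\<bar> \<le> \<bar>b\<bar> / \<epsilon>" using assms by (simp add: field_simps)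
  then have "\<bar>a\<bar> powr (p - 1) \<le> (\<bar>b\<bar> / \<epsilon>) powr (p - 1)"
    using assms by (intro powr_mono2) auto
  also have "\<dots> = \<epsilon> powr (1 - p) * \<bar>b\<bar> powr (p - 1)"
    using assms by (simp add: powr_divide powr_diff field_simps)
  finally have "\<bar>Jp p a * b\<bar> \<le> \<epsilon> powr (1 - p) * \<bar>b\<bar> powr (p - 1) * \<bar>b\<bar>"
    by (simp add: abs_mult abs_Jp mult_right_mono)
  also have "\<dots> = \<epsilon> powr (1 - p) * \<bar>b\<bar> powr p" by (simp add: powr_pred_mult mult.assoc)
  finally show ?thesis using assms by (smt (verit) mult_nonneg_nonneg powr_ge_zero)
qed

lemma powr_diff_le:
  fixes a b :: real
  assumes "1 < p"
  shows "\<bar>a - b\<bar> powr p \<le> 2 powr p * (\<bar>a\<bar> powr p + \<bar>b\<bar> powr p)"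
proof -
  have "\<bar>a - b\<bar> powr p \<le> (2 * max \<bar>a\<bar> \<bar>b\<bar>) powr p"
    using assms by (intro powr_mono2) auto
  also have "\<dots> = 2 powr p * max \<bar>a\<bar> \<bar>b\<bar> powr p" by (simp add: powr_mult)
  also have "max \<bar>a\<bar> \<bar>b\<bar> powr p \<le> \<bar>a\<bar> powr p + \<bar>b\<bar> powr p"
    by (auto simp: max_def)
  finally show ?thesis by (simp add: mult_left_mono)
qed

text \<open>Membership in Lp of a measure space: measurable with integrable p-th power of the modulus.\<close>

definition p_integrable :: "real \<Rightarrow> 'z measure \<Rightarrow> ('z \<Rightarrow> real) \<Rightarrow> bool" where
  "p_integrable p M f \<longleftrightarrow> f \<in> borel_measurable M \<and> integrable M (\<lambda>x. \<bar>f x\<bar> powr p)"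

lemma p_integrableI_nn:
  assumes [measurable]: "f \<in> borel_measurable M" and "(\<integral>\<^sup>+x. ennreal (\<bar>f x\<bar> powr p) \<partial>M) < \<infinity>"
  shows "p_integrable p M f"
  using assms unfolding p_integrable_def by (auto simp: integrable_iff_bounded)

lemma p_integrable_nn:
  assumes "p_integrable p M f"
  shows "(\<integral>\<^sup>+x. ennreal (\<bar>f x\<bar> powr p) \<partial>M) = ennreal (\<integral>x. \<bar>f x\<bar> powr p \<partial>M)"
  using assms unfolding p_integrable_def by (intro nn_integral_eq_integral) auto

lemma p_integrable_measurable: "p_integrable p M f \<Longrightarrow> f \<in> borel_measurable M"
  and p_integrable_powr: "p_integrable p M f \<Longrightarrow> integrable M (\<lambda>x. \<bar>f x\<bar> powr p)"
  by (auto simp: p_integrable_def)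

lemma p_integrable_diff:
  assumes p: "1 < p" and f: "p_integrable p M f" and g: "p_integrable p M g"
  shows "p_integrable p M (\<lambda>x. f x - g x)"
proof -
  note [measurable] = p_integrable_measurable[OF f] p_integrable_measurable[OF g]
  have "integrable M (\<lambda>x. 2 powr p * (\<bar>f x\<bar> powr p + \<bar>g x\<bar> powr p))"
    using f g by (auto simp: p_integrable_def)
  then have "integrable M (\<lambda>x. \<bar>f x - g x\<bar> powr p)"
    by (rule Bochner_Integration.integrable_bound) (auto intro!: AE_I2 powr_diff_le p)
  then show ?thesis by (simp add: p_integrable_def)
qed

lemma p_integrable_cmult:
  assumes f: "p_integrable p M f"
  shows "p_integrable p M (\<lambda>x. c * f x)"
  using assms by (auto simp: p_integrable_def abs_mult powr_mult)

lemma p_integrable_indicator: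
  assumes f: "p_integrable p M f" and A [measurable]: "A \<in> sets M"
  shows "p_integrable p M (\<lambda>x. indicator A x * f x)"
proof -
  note [measurable] = p_integrable_measurable[OF f]
  have "integrable M (\<lambda>x. \<bar>indicator A x * f x\<bar> powr p)"
    by (rule Bochner_Integration.integrable_bound[OF p_integrable_powr[OF f]]) (simp, simp add: indicator_def)
  then show ?thesis by (simp add: p_integrable_def)
qed

lemma integrable_Jp_mult:
  assumes p: "1 < p" and f: "p_integrable p M f" and g: "p_integrable p M g"
  shows "integrable M (\<lambda>x. Jp p (f x) * g x)"
proof -
  note [measurable] = p_integrable_measurable[OF f] p_integrable_measurable[OF g]
  have "integrable M (\<lambda>x. \<bar>f x\<bar> powr p + \<bar>g x\<bar> powr p)"
    using f g by (auto simp: p_integrable_def)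
  then show ?thesis
    using Jp_young_small_left[OF p, of 1]
    by (rule_tac Bochner_Integration.integrable_bound) (auto intro!: AE_I2)
qed

text \<open>The p-th power of the norm lies above its tangents; its gradient is p times \<open>Jp\<close>.\<close>

lemma integral_powr_convex:
  assumes p: "1 < p" and f: "p_integrable p M f" and g: "p_integrable p M g"
  shows "(\<integral>x. \<bar>f x\<bar> powr p \<partial>M) + p * (\<integral>x. Jp p (f x) * (g x - f x) \<partial>M) \<le> (\<integral>x. \<bar>g x\<bar> powr p \<partial>M)"
proof -
  note i = integrable_Jp_mult[OF p f p_integrable_diff[OF p g f]]
    p_integrable_powr[OF f] p_integrable_powr[OF g]
  have "(\<integral>x. \<bar>f x\<bar> powr p \<partial>M) + p * (\<integral>x. Jp p (f x) * (g x - f x) \<partial>M)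
      = (\<integral>x. \<bar>f x\<bar> powr p + p * (Jp p (f x) * (g x - f x)) \<partial>M)"
    using i by simp
  also have "\<dots> \<le> (\<integral>x. \<bar>g x\<bar> powr p \<partial>M)"
    using i by (intro integral_mono) (auto intro!: Jp_convex p)
  finally show ?thesis .
qed

lemma integral_Jp_tendsto_norm:
  assumes p: "1 < p" and g: "p_integrable p M g" and f: "p_integrable p M f"
    and fn: "\<And>n. p_integrable p M (u n)"
    and lim: "(\<lambda>n. \<integral>x. \<bar>u n x - f x\<bar> powr p \<partial>M) \<longlonglongrightarrow> 0"
  shows "(\<lambda>n. \<integral>x. Jp p (g x) * u n x \<partial>M) \<longlonglongrightarrow> (\<integral>x. Jp p (g x) * f x \<partial>M)"
proof (rule LIMSEQ_I)
  fix e :: real assume e: "0 < e"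
  define K where "K = (\<integral>x. \<bar>g x\<bar> powr p \<partial>M)"
  have K: "K \<ge> 0" unfolding K_def by simp
  define \<epsilon> where "\<epsilon> = e / (2 * (K + 1))"
  have \<epsilon>: "\<epsilon> > 0" using e K by (simp add: \<epsilon>_def)
  define C where "C = \<epsilon> powr (1 - p)"
  have C: "C > 0" using \<epsilon> by (simp add: C_def)
  obtain no where no: "\<And>n. n \<ge> no \<Longrightarrow> (\<integral>x. \<bar>u n x - f x\<bar> powr p \<partial>M) < e / (2 * C)"
    using LIMSEQ_D[OF lim, of "e / (2 * C)"] e C by auto
  show "\<exists>no. \<forall>n\<ge>no. norm ((\<integral>x. Jp p (g x) * u n x \<partial>M) - (\<integral>x. Jp p (g x) * f x \<partial>M)) < e"
  proof (intro exI allI impI)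
    fix n assume n: "n \<ge> no"
    note d = p_integrable_diff[OF p fn[of n] f]
    note i = integrable_Jp_mult[OF p g d] p_integrable_powr[OF d] p_integrable_powr[OF g]
      integrable_Jp_mult[OF p g fn[of n]] integrable_Jp_mult[OF p g f]
    have "(\<integral>x. Jp p (g x) * u n x \<partial>M) - (\<integral>x. Jp p (g x) * f x \<partial>M) = (\<integral>x. Jp p (g x) * (u n x - f x) \<partial>M)"
      using i by (subst Bochner_Integration.integral_diff[symmetric]) (auto simp: right_diff_distrib)
    also have "norm \<dots> \<le> (\<integral>x. \<bar>Jp p (g x) * (u n x - f x)\<bar> \<partial>M)"
      using integral_norm_bound[of M "\<lambda>x. Jp p (g x) * (u n x - f x)"] by simp
    also have "\<dots> \<le> (\<integral>x. \<epsilon> * \<bar>g x\<bar> powr p + C * \<bar>u n x - f x\<bar> powr p \<partial>M)"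
      unfolding C_def using i by (intro integral_mono Jp_young_small_left p \<epsilon>) auto
    also have "\<dots> = \<epsilon> * K + C * (\<integral>x. \<bar>u n x - f x\<bar> powr p \<partial>M)"
      using i by (simp add: K_def)
    also have "C * (\<integral>x. \<bar>u n x - f x\<bar> powr p \<partial>M) < e / 2"
      using no[OF n] C by (simp add: field_simps)
    also have "\<epsilon> * K \<le> e / 2"
      using K e by (simp add: \<epsilon>_def field_simps)
    finally show "norm ((\<integral>x. Jp p (g x) * u n x \<partial>M) - (\<integral>x. Jp p (g x) * f x \<partial>M)) < e"
      by simp
  qed
qed

lemma p_integrable_AE_lim:
  assumes fm [measurable]: "f \<in> borel_measurable M" 
    and fn: "\<And>n. p_integrable p M (u n)" and p: "0 < p"
    and lim: "AE x in M. (\<lambda>n. u n x) \<longlonglongrightarrow> f x"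
    and bd: "\<And>n. (\<integral>x. \<bar>u n x\<bar> powr p \<partial>M) \<le> K"
  shows "p_integrable p M f" "(\<integral>x. \<bar>f x\<bar> powr p \<partial>M) \<le> K"
proof -
  note [measurable] = p_integrable_measurable[OF fn]
  have K: "K \<ge> 0" by (rule order_trans[OF _ bd[of 0]]) simp
  have "(\<integral>\<^sup>+x. ennreal (\<bar>f x\<bar> powr p) \<partial>M) = (\<integral>\<^sup>+x. liminf (\<lambda>n. ennreal (\<bar>u n x\<bar> powr p)) \<partial>M)"
  proof (intro nn_integral_cong_AE, use lim in eventually_elim)
    case (elim x)
    have "(\<lambda>n. ennreal (\<bar>u n x\<bar> powr p)) \<longlonglongrightarrow> ennreal (\<bar>f x\<bar> powr p)"
      using elim p by (intro tendsto_ennrealI tendsto_powr2 tendsto_rabs tendsto_const) auto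
    then show ?case by (metis lim_imp_Liminf sequentially_bot)
  qed
  also have "\<dots> \<le> liminf (\<lambda>n. \<integral>\<^sup>+x. ennreal (\<bar>u n x\<bar> powr p) \<partial>M)"
    by (intro nn_integral_liminf) auto
  also have "\<dots> \<le> ennreal K"
    by (intro Liminf_le) (auto simp: p_integrable_nn[OF fn] bd ennreal_leI)
  finally have *: "(\<integral>\<^sup>+x. ennreal (\<bar>f x\<bar> powr p) \<partial>M) \<le> ennreal K" .
  then show "p_integrable p M f"
    by (intro p_integrableI_nn) (auto simp: top.not_eq_extremum intro: le_less_trans)
  with * K show "(\<integral>x. \<bar>f x\<bar> powr p \<partial>M) \<le> K"
    by (simp add: p_integrable_nn)
qed

text \<open>
  A sequence that is bounded in Lp and converges almost everywhere converges weakly. The positive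
  part of \<open>\<bar>Jp p (g x) * (u n x - f x)\<bar> - \<epsilon> * \<bar>u n x - f x\<bar> powr p\<close> is dominated by a multiple of
  \<open>\<bar>g x\<bar> powr p\<close>, so that its integral tends to zero; what it leaves out is of order \<open>\<epsilon>\<close>.
  This replaces reflexivity and weak compactness throughout.
\<close>

lemma integral_Jp_tendsto_bounded:
  assumes p: "1 < p" and g: "p_integrable p M g" and fm [measurable]: "f \<in> borel_measurable M" 
    and fn: "\<And>n. p_integrable p M (u n)"
    and lim: "AE x in M. (\<lambda>n. u n x) \<longlonglongrightarrow> f x"
    and bd: "\<And>n. (\<integral>x. \<bar>u n x\<bar> powr p \<partial>M) \<le> K"
  shows "(\<lambda>n. \<integral>x. Jp p (g x) * u n x \<partial>M) \<longlonglongrightarrow> (\<integral>x. Jp p (g x) * f x \<partial>M)"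
proof (rule LIMSEQ_I)
  fix e :: real assume e: "0 < e"
  have p0: "0 < p" using p by simp
  note f = p_integrable_AE_lim[OF fm fn p0 lim bd]
  note [measurable] = p_integrable_measurable[OF fn] p_integrable_measurable[OF g]
  have K: "K \<ge> 0" by (rule order_trans[OF _ bd[of 0]]) simp
  define L where "L = 2 powr p * (2 * K)"
  have L: "L \<ge> 0" using K by (simp add: L_def)
  define \<epsilon> where "\<epsilon> = e / (2 * (L + 1))"
  have \<epsilon>: "\<epsilon> > 0" using e L by (simp add: \<epsilon>_def)
  define C where "C = \<epsilon> powr (- (1 / (p - 1)))"
  note d = p_integrable_diff[OF p fn f(1)]
  have dL: "(\<integral>x. \<bar>u n x - f x\<bar> powr p \<partial>M) \<le> L" for n
  proof -
    have "(\<integral>x. \<bar>u n x - f x\<bar> powr p \<partial>M) \<le> (\<integral>x. 2 powr p * (\<bar>u n x\<bar> powr p + \<bar>f x\<bar> powr p) \<partial>M)"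
      using d[of n] fn[of n] f(1) by (intro integral_mono powr_diff_le p) (auto simp: p_integrable_def)
    also have "\<dots> = 2 powr p * ((\<integral>x. \<bar>u n x\<bar> powr p \<partial>M) + (\<integral>x. \<bar>f x\<bar> powr p \<partial>M))"
      using fn[of n] f(1) by (simp add: p_integrable_def)
    also have "\<dots> \<le> L" unfolding L_def using bd[of n] f(2) by (intro mult_left_mono) auto
    finally show ?thesis .
  qed
  define \<psi> where "\<psi> n x = max 0 (\<bar>Jp p (g x) * (u n x - f x)\<bar> - \<epsilon> * \<bar>u n x - f x\<bar> powr p)" for n x
  have \<psi>b: "\<bar>\<psi> n x\<bar> \<le> C * \<bar>g x\<bar> powr p" for n x
    using Jp_young_small_right[OF p \<epsilon>, of "g x" "u n x - f x"] by (auto simp: \<psi>_def C_def)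
  have [measurable]: "\<psi> n \<in> borel_measurable M" for n unfolding \<psi>_def by measurable
  have gi: "integrable M (\<lambda>x. C * \<bar>g x\<bar> powr p)" using g by (auto simp: p_integrable_def)
  have "(\<lambda>n. \<integral>x. \<psi> n x \<partial>M) \<longlonglongrightarrow> (\<integral>x. 0 \<partial>M)"
  proof (rule integral_dominated_convergence[where w="\<lambda>x. C * \<bar>g x\<bar> powr p"])
    show "AE x in M. (\<lambda>n. \<psi> n x) \<longlonglongrightarrow> 0"
      using lim
    proof eventually_elim
      case (elim x)
      then have *: "(\<lambda>n. u n x - f x) \<longlonglongrightarrow> 0" by (simp add: LIM_zero)
      have "(\<lambda>n. \<psi> n x) \<longlonglongrightarrow> max 0 (\<bar>Jp p (g x) * 0\<bar> - \<epsilon> * \<bar>0\<bar> powr p)"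
        unfolding \<psi>_def using p by (intro tendsto_intros * tendsto_powr2) auto
      then show ?case by simp
    qed
  qed (use \<psi>b gi in auto)
  then obtain no where no: "\<And>n. n \<ge> no \<Longrightarrow> \<bar>\<integral>x. \<psi> n x \<partial>M\<bar> < e / 2"
    using LIMSEQ_D[of _ _ "e/2"] e by fastforce
  show "\<exists>no. \<forall>n\<ge>no. norm ((\<integral>x. Jp p (g x) * u n x \<partial>M) - (\<integral>x. Jp p (g x) * f x \<partial>M)) < e"
  proof (intro exI allI impI)
    fix n assume n: "n \<ge> no"
    have \<psi>i: "integrable M (\<psi> n)"
    proof (rule Bochner_Integration.integrable_bound[OF gi])
      show "AE x in M. norm (\<psi> n x) \<le> norm (C * \<bar>g x\<bar> powr p)"
        using \<psi>b[of n] by (intro AE_I2) (simp add: order_trans[OF _ abs_ge_self])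
    qed simp
    note i = integrable_Jp_mult[OF p g d[of n]] p_integrable_powr[OF d[of n]]
      integrable_Jp_mult[OF p g fn[of n]] integrable_Jp_mult[OF p g f(1)]
    have "(\<integral>x. Jp p (g x) * u n x \<partial>M) - (\<integral>x. Jp p (g x) * f x \<partial>M) = (\<integral>x. Jp p (g x) * (u n x - f x) \<partial>M)"
      using i by (subst Bochner_Integration.integral_diff[symmetric]) (auto simp: right_diff_distrib)
    also have "norm \<dots> \<le> (\<integral>x. \<bar>Jp p (g x) * (u n x - f x)\<bar> \<partial>M)"
      using integral_norm_bound[of M "\<lambda>x. Jp p (g x) * (u n x - f x)"] by simp
    also have "\<dots> \<le> (\<integral>x. \<psi> n x + \<epsilon> * \<bar>u n x - f x\<bar> powr p \<partial>M)"
      using i \<psi>i by (intro integral_mono) (auto simp: \<psi>_def)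
    also have "\<dots> = (\<integral>x. \<psi> n x \<partial>M) + \<epsilon> * (\<integral>x. \<bar>u n x - f x\<bar> powr p \<partial>M)"
      using i \<psi>i by simp
    also have "\<epsilon> * (\<integral>x. \<bar>u n x - f x\<bar> powr p \<partial>M) \<le> \<epsilon> * L"
      using dL[of n] \<epsilon> by simp
    also have "\<epsilon> * L \<le> e / 2"
      using L e by (simp add: \<epsilon>_def field_simps)
    finally show "norm ((\<integral>x. Jp p (g x) * u n x \<partial>M) - (\<integral>x. Jp p (g x) * f x \<partial>M)) < e"
      using no[OF n] by simp
  qed
qed

section \<open>Steklov averages and functionals decreasing along a curve\<close>

lemma lborel_shift:
  fixes f :: "'b::euclidean_space \<Rightarrow> real"
  assumes [measurable]: "f \<in> borel_measurable borel"
  shows nn_integral_lborel_shift: "(\<integral>\<^sup>+x. ennreal (f (x - h)) \<partial>lborel) = (\<integral>\<^sup>+x. ennreal (f x) \<partial>lborel)"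
    and integral_lborel_shift: "(LBINT x. f (x - h)) = (LBINT x. f x)"
    and integrable_lborel_shift: "integrable lborel (\<lambda>x. f (x - h)) \<longleftrightarrow> integrable lborel f"
proof -
  have *: "lborel = distr lborel borel ((+) (-h))" by (simp add: lborel_distr_plus)
  show "(\<integral>\<^sup>+x. ennreal (f (x - h)) \<partial>lborel) = (\<integral>\<^sup>+x. ennreal (f x) \<partial>lborel)"
    by (subst (2) *, subst nn_integral_distr) auto
  show "(LBINT x. f (x - h)) = (LBINT x. f x)"
    by (subst (2) *, subst integral_distr) auto
  show "integrable lborel (\<lambda>x. f (x - h)) \<longleftrightarrow> integrable lborel f"
    by (subst (2) *, subst integrable_distr_eq) auto
qed

text \<open>Continuity of translations in L1 passes to L1 limits.\<close>

lemma translation_tendsto_L1_approx: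
  fixes f :: "'b::euclidean_space \<Rightarrow> real"
  assumes f: "integrable lborel f"
    and approx: "\<And>e. e > 0 \<Longrightarrow> \<exists>g. integrable lborel g \<and> (LBINT x. \<bar>g x - f x\<bar>) < e \<and>
        (\<lambda>n. LBINT x. \<bar>g (x - h n) - g x\<bar>) \<longlonglongrightarrow> 0"
  shows "(\<lambda>n. LBINT x. \<bar>f (x - h n) - f x\<bar>) \<longlonglongrightarrow> 0"
proof (rule LIMSEQ_I)
  fix e :: real assume e: "e > 0"
  then obtain g where g: "integrable lborel g" and ge: "(LBINT x. \<bar>g x - f x\<bar>) < e / 3"
    and gl: "(\<lambda>n. LBINT x. \<bar>g (x - h n) - g x\<bar>) \<longlonglongrightarrow> 0"
    using approx[of "e/3"] by auto
  have [measurable]: "f \<in> borel_measurable borel" "g \<in> borel_measurable borel"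
    using f g by auto
  obtain N where N: "\<And>n. n \<ge> N \<Longrightarrow> (LBINT x. \<bar>g (x - h n) - g x\<bar>) < e / 3"
    using LIMSEQ_D[OF gl, of "e/3"] e by auto
  show "\<exists>N. \<forall>n\<ge>N. norm ((LBINT x. \<bar>f (x - h n) - f x\<bar>) - 0) < e"
  proof (intro exI allI impI)
    fix n assume n: "n \<ge> N"
    have i: "integrable lborel (\<lambda>x. f (x - h n))" "integrable lborel (\<lambda>x. g (x - h n))"
      using f g by (simp_all add: integrable_lborel_shift)
    have s: "(LBINT x. \<bar>g (x - h n) - f (x - h n)\<bar>) = (LBINT x. \<bar>g x - f x\<bar>)"
      using integral_lborel_shift[of "\<lambda>x. \<bar>g x - f x\<bar>" "h n"] by simp
    have "(LBINT x. \<bar>f (x - h n) - f x\<bar>) \<le> (LBINT x. \<bar>g (x - h n) - f (x - h n)\<bar> + \<bar>g (x - h n) - g x\<bar> + \<bar>g x - f x\<bar>)"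
      using f g i by (intro integral_mono) auto
    also have "\<dots> = (LBINT x. \<bar>g (x - h n) - f (x - h n)\<bar>) + (LBINT x. \<bar>g (x - h n) - g x\<bar>) + (LBINT x. \<bar>g x - f x\<bar>)"
      using f g i by simp
    also have "\<dots> < e" using s ge N[OF n] by simp
    finally show "norm ((LBINT x. \<bar>f (x - h n) - f x\<bar>) - 0) < e" by simp
  qed
qed

text \<open>
  For an open set U, a point of U stays in U under small translations. Hence the positive part of
  the difference of the two indicators tends to zero pointwise, and as the difference has integral
  zero, its L1 norm is twice the integral of its positive part.
\<close>

lemma translation_tendsto_L1_open:
  fixes U :: "'b::euclidean_space set"
  assumes U: "open U" and fin: "emeasure lborel U < \<infinity>" and h: "h \<longlonglongrightarrow> 0"
  shows "(\<lambda>n. LBINT x. \<bar>indicat_real U (x - h n) - indicat_real U x\<bar>) \<longlonglongrightarrow> 0"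
proof -
  have [measurable]: "U \<in> sets borel" using U by auto
  define P where "P n x = max 0 (indicat_real U x - indicat_real U (x - h n))" for n x
  have [measurable]: "P n \<in> borel_measurable borel" for n unfolding P_def by measurable
  have iU: "integrable lborel (indicat_real U)" using fin by (simp add: integrable_indicator_iff)
  have iUn: "integrable lborel (\<lambda>x. indicat_real U (x - h n))" for n
    using iU by (simp add: integrable_lborel_shift)
  have iP: "integrable lborel (P n)" for n
    using iU by (rule Bochner_Integration.integrable_bound) (auto simp: P_def indicator_def)
  have "(\<lambda>n. LBINT x. P n x) \<longlonglongrightarrow> (\<integral>x. 0 \<partial>(lborel :: 'b measure))"
  proof (rule integral_dominated_convergence[where w="indicat_real U"])
    show "AE x in lborel. (\<lambda>n. P n x) \<longlonglongrightarrow> 0"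
    proof (intro AE_I2)
      fix x
      have "eventually (\<lambda>n. P n x = 0) sequentially"
      proof (cases "x \<in> U")
        case True
        have "(\<lambda>n. x - h n) \<longlonglongrightarrow> x - 0" by (intro tendsto_intros h)
        then have "eventually (\<lambda>n. x - h n \<in> U) sequentially"
          using U True by (auto dest: topological_tendstoD)
        then show ?thesis by eventually_elim (simp add: P_def indicator_def)
      qed (simp add: P_def indicator_def)
      then show "(\<lambda>n. P n x) \<longlonglongrightarrow> 0" by (rule tendsto_eventually)
    qed
  qed (use iU in \<open>auto simp: P_def indicator_def\<close>)
  moreover have "(LBINT x. \<bar>indicat_real U (x - h n) - indicat_real U x\<bar>) = 2 * (LBINT x. P n x)" for n
  proof -
    have "(LBINT x. \<bar>indicat_real U (x - h n) - indicat_real U x\<bar>)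
       = (LBINT x. 2 * P n x + (indicat_real U (x - h n) - indicat_real U x))"
      by (intro Bochner_Integration.integral_cong) (auto simp: P_def indicator_def)
    also have "\<dots> = 2 * (LBINT x. P n x) + ((LBINT x. indicat_real U (x - h n)) - (LBINT x. indicat_real U x))"
      using iP iU iUn by simp
    also have "\<dots> = 2 * (LBINT x. P n x)"
      using integral_lborel_shift[of "indicat_real U" "h n"] by simp
    finally show ?thesis .
  qed
  ultimately show ?thesis by (simp add: tendsto_mult_right_zero)
qed

lemma translation_tendsto_L1:
  fixes f :: "'b::euclidean_space \<Rightarrow> real"
  assumes "integrable lborel f" and h: "h \<longlonglongrightarrow> 0"
  shows "(\<lambda>n. LBINT x. \<bar>f (x - h n) - f x\<bar>) \<longlonglongrightarrow> 0"
  using assms(1)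
proof (induction f rule: integrable_induct)
  case (base A c)
  then have A [measurable]: "A \<in> sets borel" by simp
  have iA: "integrable lborel (indicat_real A)" using base by (simp add: integrable_indicator_iff)
  have "(\<lambda>n. LBINT x. \<bar>indicat_real A (x - h n) - indicat_real A x\<bar>) \<longlonglongrightarrow> 0"
  proof (rule translation_tendsto_L1_approx[OF iA])
    fix e :: real assume e: "e > 0"
    obtain U where U: "open U" "A \<subseteq> U" "emeasure lborel (U - A) < e"
      using outer_regular_lborel[OF A e] .
    have [measurable]: "U \<in> sets borel" using U by auto
    have "emeasure lborel U = emeasure lborel (U - A) + emeasure lborel A"
      using U by (subst plus_emeasure) (auto simp: Un_absorb2)
    also have "\<dots> < \<infinity>" using U base by (auto simp: less_top intro: order.strict_trans)
    finally have fin: "emeasure lborel U < \<infinity>" .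
    have "(LBINT x. \<bar>indicat_real U x - indicat_real A x\<bar>) = (LBINT x. indicat_real (U - A) x)"
      using U by (intro Bochner_Integration.integral_cong) (auto simp: indicator_def)
    also have "\<dots> = measure lborel (U - A)" by simp
    also have "\<dots> < e"
      using U(3) e order.strict_trans[OF U(3) ennreal_less_top]
      by (subst (asm) emeasure_eq_ennreal_measure) (auto simp: ennreal_less_iff)
    finally show "\<exists>g. integrable lborel g \<and> (LBINT x. \<bar>g x - indicat_real A x\<bar>) < e \<and>
        (\<lambda>n. LBINT x. \<bar>g (x - h n) - g x\<bar>) \<longlonglongrightarrow> 0"
      using translation_tendsto_L1_open[OF U(1) fin h] fin
      by (intro exI[of _ "indicat_real U"]) (simp add: integrable_indicator_iff)
  qed
  then have "(\<lambda>n. (LBINT x. \<bar>indicat_real A (x - h n) - indicat_real A x\<bar>) * \<bar>c\<bar>) \<longlonglongrightarrow> 0 * \<bar>c\<bar>"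
    by (intro tendsto_intros)
  then show ?case by (simp flip: left_diff_distrib add: abs_mult)
next
  case (add f g)
  note [measurable] = borel_measurable_integrable[OF add(1)] borel_measurable_integrable[OF add(2)]
  have i: "integrable lborel (\<lambda>x. f (x - h n))" "integrable lborel (\<lambda>x. g (x - h n))" for n
    using add(1,2) by (simp_all add: integrable_lborel_shift)
  have "(\<lambda>n. (LBINT x. \<bar>f (x - h n) - f x\<bar>) + (LBINT x. \<bar>g (x - h n) - g x\<bar>)) \<longlonglongrightarrow> 0 + 0"
    by (intro tendsto_intros add)
  then have l: "(\<lambda>n. LBINT x. \<bar>f (x - h n) - f x\<bar> + \<bar>g (x - h n) - g x\<bar>) \<longlonglongrightarrow> 0"
    using i add(1,2) by simp
  have "(LBINT x. \<bar>f (x - h n) + g (x - h n) - (f x + g x)\<bar>)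
      \<le> (LBINT x. \<bar>f (x - h n) - f x\<bar> + \<bar>g (x - h n) - g x\<bar>)" for n
    using i add(1,2) by (intro integral_mono) auto
  then show ?case
    by (intro tendsto_sandwich[OF _ _ tendsto_const l] always_eventually) auto
next
  case (lim f s)
  show ?case
  proof (rule translation_tendsto_L1_approx[OF lim.hyps(4)])
    fix e :: real assume e: "e > 0"
    have [measurable]: "f \<in> borel_measurable lborel" "\<And>i. s i \<in> borel_measurable lborel" using lim by auto
    have "(\<lambda>i. LBINT x. \<bar>s i x - f x\<bar>) \<longlonglongrightarrow> (\<integral>x. 0 \<partial>(lborel :: 'b measure))"
    proof (rule integral_dominated_convergence[where w="\<lambda>x. 3 * \<bar>f x\<bar>"])
      show "AE x in lborel. (\<lambda>i. \<bar>s i x - f x\<bar>) \<longlonglongrightarrow> 0"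
        using lim.hyps(2) by (intro AE_I2 tendsto_rabs_zero LIM_zero) auto
      show "AE x in lborel. norm \<bar>s i x - f x\<bar> \<le> 3 * \<bar>f x\<bar>" for i
      proof (intro AE_I2)
        fix x show "norm \<bar>s i x - f x\<bar> \<le> 3 * \<bar>f x\<bar>" using lim.hyps(3)[of x i] by simp
      qed
    qed (use lim in auto)
    from LIMSEQ_D[OF this e] obtain i where "(LBINT x. \<bar>s i x - f x\<bar>) < e" by auto
    then show "\<exists>g. integrable lborel g \<and> (LBINT x. \<bar>g x - f x\<bar>) < e \<and>
        (\<lambda>n. LBINT x. \<bar>g (x - h n) - g x\<bar>) \<longlonglongrightarrow> 0"
      using lim.hyps(1) lim.IH by blast
  qed
qed

text \<open>The uniform distribution on the unit interval.\<close>

definition unit_unif :: "real measure" where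
  "unit_unif = density lborel (indicator {0..1})"

lemma sets_unit_unif [simp, measurable_cong]: "sets unit_unif = sets borel"
  and space_unit_unif [simp]: "space unit_unif = UNIV"
  by (simp_all add: unit_unif_def)

lemma emeasure_unit_unif [simp]: "emeasure unit_unif UNIV = 1"
  by (simp add: unit_unif_def emeasure_density)

interpretation unit_unif: finite_measure unit_unif
  by standard simp

interpretation lu: pair_sigma_finite "lborel :: 'b::euclidean_space measure" unit_unif ..

lemma measure_unit_unif [simp]: "measure unit_unif UNIV = 1"
  by (simp add: measure_def)

text \<open>The backward Steklov average: the mean of W over the segment from \<open>z - h\<close> to z.\<close>

definition steklov :: "('b::euclidean_space \<Rightarrow> real) \<Rightarrow> 'b \<Rightarrow> 'b \<Rightarrow> real" where
  "steklov W h z = (\<integral>u. W (z - u *\<^sub>R h) \<partial>unit_unif)"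

lemma steklov_measurable [measurable]:
  fixes W :: "'b::euclidean_space \<Rightarrow> real"
  assumes [measurable]: "W \<in> borel_measurable borel"
  shows "steklov W h \<in> borel_measurable borel"
  unfolding steklov_def by measurable

lemma integrable_steklov_pair:
  fixes W :: "'b::euclidean_space \<Rightarrow> real"
  assumes W: "integrable lborel W"
  shows "integrable (lborel \<Otimes>\<^sub>M unit_unif) (\<lambda>(z, u). W (z - u *\<^sub>R h))"
    and "(\<integral>\<^sup>+z. \<integral>\<^sup>+u. ennreal \<bar>W (z - u *\<^sub>R h)\<bar> \<partial>unit_unif \<partial>lborel) = (\<integral>\<^sup>+z. ennreal \<bar>W z\<bar> \<partial>lborel)"
proof -
  have [measurable]: "W \<in> borel_measurable borel" using W by auto
  have "(\<integral>\<^sup>+z. \<integral>\<^sup>+u. ennreal \<bar>W (z - u *\<^sub>R h)\<bar> \<partial>unit_unif \<partial>lborel)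
      = (\<integral>\<^sup>+u. \<integral>\<^sup>+z. ennreal \<bar>W (z - u *\<^sub>R h)\<bar> \<partial>lborel \<partial>unit_unif)"
    by (rule lu.Fubini'[symmetric]) measurable
  also have "\<dots> = (\<integral>\<^sup>+u. \<integral>\<^sup>+z. ennreal \<bar>W z\<bar> \<partial>lborel \<partial>unit_unif)"
    by (rule nn_integral_cong) (rule nn_integral_lborel_shift[of "\<lambda>z. \<bar>W z\<bar>"], measurable)
  also have "\<dots> = (\<integral>\<^sup>+z. ennreal \<bar>W z\<bar> \<partial>lborel)" by simp
  finally show *: "(\<integral>\<^sup>+z. \<integral>\<^sup>+u. ennreal \<bar>W (z - u *\<^sub>R h)\<bar> \<partial>unit_unif \<partial>lborel) = (\<integral>\<^sup>+z. ennreal \<bar>W z\<bar> \<partial>lborel)" .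
  show "integrable (lborel \<Otimes>\<^sub>M unit_unif) (\<lambda>(z, u). W (z - u *\<^sub>R h))"
  proof (rule integrableI_bounded)
    have "(\<integral>\<^sup>+ x. ennreal (norm (case x of (z, u) \<Rightarrow> W (z - u *\<^sub>R h))) \<partial>(lborel \<Otimes>\<^sub>M unit_unif))
       = (\<integral>\<^sup>+z. \<integral>\<^sup>+u. ennreal \<bar>W (z - u *\<^sub>R h)\<bar> \<partial>unit_unif \<partial>lborel)"
      by (subst unit_unif.nn_integral_fst[symmetric]) auto
    also have "\<dots> < \<infinity>" unfolding * using W by (auto simp: integrable_iff_bounded)
    finally show "(\<integral>\<^sup>+ x. ennreal (norm (case x of (z, u) \<Rightarrow> W (z - u *\<^sub>R h))) \<partial>(lborel \<Otimes>\<^sub>M unit_unif)) < \<infinity>" .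
  qed measurable
qed

lemma steklov_Lp_bound:
  fixes W :: "'b::euclidean_space \<Rightarrow> real"
  assumes p: "1 < p" and W: "integrable lborel W" and Wp: "p_integrable p lborel W"
  shows "p_integrable p lborel (steklov W h)"
    and "(LBINT z. \<bar>steklov W h z\<bar> powr p) \<le> (LBINT z. \<bar>W z\<bar> powr p)"
proof -
  have [measurable]: "W \<in> borel_measurable borel" using W by auto
  note Wpp = p_integrable_powr[OF Wp]
  have 1: "AE z in lborel. integrable unit_unif (\<lambda>u. W (z - u *\<^sub>R h))"
    using lu.AE_integrable_fst'[OF integrable_steklov_pair(1)[OF W, of h]] by simp
  have 2: "AE z in lborel. integrable unit_unif (\<lambda>u. \<bar>W (z - u *\<^sub>R h)\<bar> powr p)"
    using lu.AE_integrable_fst'[OF integrable_steklov_pair(1)[OF Wpp, of h]] by simp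
  have "(\<integral>\<^sup>+z. ennreal (\<bar>steklov W h z\<bar> powr p) \<partial>lborel)
      \<le> (\<integral>\<^sup>+z. \<integral>\<^sup>+u. ennreal (\<bar>W (z - u *\<^sub>R h)\<bar> powr p) \<partial>unit_unif \<partial>lborel)"
  proof (intro nn_integral_mono_AE, use 1 2 in eventually_elim)
    case (elim z)
    define A where "A = steklov W h z"
    have pc: "p_integrable p unit_unif (\<lambda>_. A)" by (simp add: p_integrable_def)
    have pw: "p_integrable p unit_unif (\<lambda>u. W (z - u *\<^sub>R h))" using elim by (simp add: p_integrable_def)
    have "(\<integral>u. W (z - u *\<^sub>R h) - A \<partial>unit_unif) = 0"
      using elim(1) by (simp add: A_def steklov_def)
    with integral_powr_convex[OF p pc pw]
    have "\<bar>A\<bar> powr p \<le> (\<integral>u. \<bar>W (z - u *\<^sub>R h)\<bar> powr p \<partial>unit_unif)" by simp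
    then show ?case
      using elim(2) by (subst nn_integral_eq_integral) (auto simp: A_def intro: ennreal_leI)
  qed
  also have "\<dots> = (\<integral>\<^sup>+z. ennreal (\<bar>W z\<bar> powr p) \<partial>lborel)"
    using integrable_steklov_pair(2)[OF Wpp, of h] by simp
  also have "\<dots> = ennreal (LBINT z. \<bar>W z\<bar> powr p)" by (rule p_integrable_nn[OF Wp])
  finally have *: "(\<integral>\<^sup>+z. ennreal (\<bar>steklov W h z\<bar> powr p) \<partial>lborel) \<le> ennreal (LBINT z. \<bar>W z\<bar> powr p)" .
  show pS: "p_integrable p lborel (steklov W h)"
    using * by (intro p_integrableI_nn) (auto intro: le_less_trans)
  show "(LBINT z. \<bar>steklov W h z\<bar> powr p) \<le> (LBINT z. \<bar>W z\<bar> powr p)"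
    using * by (simp add: p_integrable_nn[OF pS])
qed

lemma steklov_tendsto_L1:
  fixes W :: "'b::euclidean_space \<Rightarrow> real"
  assumes W: "integrable lborel W" and h: "h \<longlonglongrightarrow> 0"
  shows "integrable lborel (steklov W h0)"
    and "(\<lambda>n. LBINT z. \<bar>steklov W (h n) z - W z\<bar>) \<longlonglongrightarrow> 0"
proof -
  have [measurable]: "W \<in> borel_measurable borel" using W by auto
  show iS: "integrable lborel (steklov W h0)" for h0
    using lu.integrable_fst'[OF integrable_steklov_pair(1)[OF W, of h0]] by (simp add: steklov_def[abs_def])
  define T where "T h = (LBINT z. \<bar>W (z - h) - W z\<bar>)" for h
  have Tb: "T h \<le> 2 * (LBINT z. \<bar>W z\<bar>)" for h
  proof -
    have i: "integrable lborel (\<lambda>z. W (z - h))" using W by (simp add: integrable_lborel_shift)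
    have "T h \<le> (LBINT z. \<bar>W (z - h)\<bar> + \<bar>W z\<bar>)"
      unfolding T_def using W i by (intro integral_mono) auto
    also have "\<dots> = (LBINT z. \<bar>W (z - h)\<bar>) + (LBINT z. \<bar>W z\<bar>)" using W i by simp
    finally show ?thesis using integral_lborel_shift[of "\<lambda>z. \<bar>W z\<bar>" h] by simp
  qed
  have T0: "T h \<ge> 0" for h by (simp add: T_def)
  have Tm [measurable]: "(\<lambda>u. T (u *\<^sub>R h)) \<in> borel_measurable unit_unif" for h
    unfolding T_def by measurable
  have lim: "(\<lambda>n. \<integral>u. T (u *\<^sub>R h n) \<partial>unit_unif) \<longlonglongrightarrow> (\<integral>u. 0 \<partial>unit_unif)"
  proof (rule integral_dominated_convergence[where w="\<lambda>_. 2 * (LBINT z. \<bar>W z\<bar>)"])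
    show "AE u in unit_unif. (\<lambda>n. T (u *\<^sub>R h n)) \<longlonglongrightarrow> 0"
    proof (intro AE_I2)
      fix u :: real
      have "(\<lambda>n. u *\<^sub>R h n) \<longlonglongrightarrow> u *\<^sub>R 0" by (intro tendsto_intros h)
      then show "(\<lambda>n. T (u *\<^sub>R h n)) \<longlonglongrightarrow> 0"
        unfolding T_def by (intro translation_tendsto_L1 W) simp
    qed
  qed (use Tb T0 in auto)
  have le: "(LBINT z. \<bar>steklov W (h n) z - W z\<bar>) \<le> (\<integral>u. T (u *\<^sub>R h n) \<partial>unit_unif)" for n
  proof -
    have iW: "integrable (lborel \<Otimes>\<^sub>M unit_unif) (\<lambda>(z, u). W z)"
      using integrable_steklov_pair(1)[OF W, of 0] by simp
    have iD: "integrable (lborel \<Otimes>\<^sub>M unit_unif) (\<lambda>(z, u). \<bar>W (z - u *\<^sub>R h n) - W z\<bar>)"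
      using Bochner_Integration.integrable_diff[OF integrable_steklov_pair(1)[OF W, of "h n"] iW]
      by (auto simp: case_prod_beta')
    have 1: "AE z in lborel. integrable unit_unif (\<lambda>u. W (z - u *\<^sub>R h n))"
      using lu.AE_integrable_fst'[OF integrable_steklov_pair(1)[OF W, of "h n"]] by simp
    have "(LBINT z. \<bar>steklov W (h n) z - W z\<bar>) \<le> (\<integral>z. \<integral>u. \<bar>W (z - u *\<^sub>R h n) - W z\<bar> \<partial>unit_unif \<partial>lborel)"
    proof (intro integral_mono_AE)
      show "AE z in lborel. \<bar>steklov W (h n) z - W z\<bar> \<le> (\<integral>u. \<bar>W (z - u *\<^sub>R h n) - W z\<bar> \<partial>unit_unif)"
        using 1
      proof eventually_elim
        case (elim z)
        have "steklov W (h n) z - W z = (\<integral>u. W (z - u *\<^sub>R h n) - W z \<partial>unit_unif)"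
          using elim by (simp add: steklov_def)
        then show ?case
          using integral_norm_bound[of unit_unif "\<lambda>u. W (z - u *\<^sub>R h n) - W z"] by simp
      qed
      show "integrable lborel (\<lambda>z. \<integral>u. \<bar>W (z - u *\<^sub>R h n) - W z\<bar> \<partial>unit_unif)"
        using lu.integrable_fst'[OF iD] by simp
    qed (use iS W in auto)
    also have "\<dots> = (\<integral>u. T (u *\<^sub>R h n) \<partial>unit_unif)"
      unfolding T_def by (rule lu.Fubini_integral[symmetric]) (use iD in simp)
    finally show ?thesis .
  qed
  show "(\<lambda>n. LBINT z. \<bar>steklov W (h n) z - W z\<bar>) \<longlonglongrightarrow> 0"
    by (rule tendsto_sandwich[OF _ _ tendsto_const lim[simplified]])
       (use le in \<open>auto intro!: always_eventually\<close>)
qed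

text \<open>
  Steklov averages converge in L1, hence almost everywhere along a subsequence, and they do not
  increase the Lp norm. Therefore they converge weakly in Lp along that subsequence.
\<close>

lemma steklov_weak_subseq:
  fixes W G :: "'b::euclidean_space \<Rightarrow> real"
  assumes p: "1 < p" and W: "integrable lborel W" and Wp: "p_integrable p lborel W"
    and G: "p_integrable p lborel G" and h: "h \<longlonglongrightarrow> 0"
  obtains r :: "nat \<Rightarrow> nat" where "strict_mono r"
    "(\<lambda>n. LBINT z. Jp p (G z) * steklov W (h (r n)) z) \<longlonglongrightarrow> (LBINT z. Jp p (G z) * W z)"
proof -
  have [measurable]: "W \<in> borel_measurable borel" using W by auto
  have i: "integrable lborel (\<lambda>z. steklov W (h n) z - W z)" for n
    using steklov_tendsto_L1(1)[OF W h] W by auto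
  have "(\<lambda>n. LBINT z. norm (steklov W (h n) z - W z)) \<longlonglongrightarrow> 0"
    using steklov_tendsto_L1(2)[OF W h] by simp
  from tendsto_L1_AE_subseq[OF i this] obtain r where r: "strict_mono r"
    and "AE z in lborel. (\<lambda>n. steklov W (h (r n)) z - W z) \<longlonglongrightarrow> 0" by auto
  then have ae: "AE z in lborel. (\<lambda>n. steklov W (h (r n)) z) \<longlonglongrightarrow> W z"
    by (simp add: LIM_zero_iff)
  have "(\<lambda>n. LBINT z. Jp p (G z) * steklov W (h (r n)) z) \<longlonglongrightarrow> (LBINT z. Jp p (G z) * W z)"
    by (rule integral_Jp_tendsto_bounded[OF p G _ steklov_Lp_bound(1)[OF p W Wp] ae
        steklov_Lp_bound(2)[OF p W Wp]]) auto
  with r show ?thesis by (rule that)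
qed

text \<open>
  Think of W as the velocity of a curve in Lp and of \<open>- k * Jp p (G t)\<close> as a subgradient at
  time t of a functional whose value along the curve is F. The hypothesis \<open>decr\<close> is the subgradient
  inequality between the times \<open>\<sigma>\<close> and \<open>\<tau>\<close>, and the conclusion is the chain rule, as an
  inequality between two given times. Integrating the hypothesis for \<open>\<sigma> = max c (\<tau> - \<delta>)\<close> over
  \<open>\<tau>\<close> and dividing by \<open>\<delta>\<close> gives \<open>F c\<close> minus the mean of F over the last \<open>\<delta>\<close> units of time
  on the right, and a pairing with Steklov averages of W on the left. Hence F need not be continuous
  at c, and at b lower semicontinuity suffices.
\<close>

lemma integrated_decrease:
  fixes W G :: "real \<times> 'a::euclidean_space \<Rightarrow> real" and F :: "real \<Rightarrow> real"
  assumes p: "1 < p" and cb: "c < b"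
    and W: "integrable lborel W" and Wp: "p_integrable p lborel W"
    and G: "p_integrable p lborel G"
    and W0: "\<And>r x. r < c \<Longrightarrow> W (r, x) = 0"
    and G0: "\<And>r x. r \<notin> {c<..<b} \<Longrightarrow> G (r, x) = 0"
    and Fm [measurable]: "F \<in> borel_measurable borel" and FK: "\<And>t. t \<in> {c..b} \<Longrightarrow> \<bar>F t\<bar> \<le> K"
    and lsc: "\<And>e. 0 < e \<Longrightarrow> \<exists>d>0. \<forall>t\<in>{c..b}. b - d \<le> t \<longrightarrow> F b - e \<le> F t"
    and decr: "AE \<tau> in lborel. \<tau> \<in> {c<..<b} \<longrightarrow> (\<forall>\<sigma>\<in>{c..\<tau>}.
        k * (LBINT x. Jp p (G (\<tau>, x)) * (LBINT r. indicator {\<sigma>..\<tau>} r * W (r, x))) \<le> F \<sigma> - F \<tau>)"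
  shows "k * (LBINT z. Jp p (G z) * W z) \<le> F c - F b"
proof -
  have [measurable]: "W \<in> borel_measurable borel" "G \<in> borel_measurable borel"
    using W p_integrable_measurable[OF G] by auto
  define h :: "nat \<Rightarrow> real \<times> 'a" where "h n = (1 / real (Suc n), 0)" for n
  have h0: "h \<longlonglongrightarrow> 0"
    unfolding h_def zero_prod_def by (intro tendsto_Pair tendsto_const LIMSEQ_Suc lim_1_over_n)
  obtain r where r: "strict_mono r"
    and lim: "(\<lambda>n. LBINT z. Jp p (G z) * steklov W (h (r n)) z) \<longlonglongrightarrow> (LBINT z. Jp p (G z) * W z)"
    using steklov_weak_subseq[OF p W Wp G h0] .
  have est: "k * (LBINT z. Jp p (G z) * steklov W (h n) z) \<le> F c - F b + e"
    if d: "\<forall>t\<in>{c..b}. b - d \<le> t \<longrightarrow> F b - e \<le> F t" and small: "1 / real (Suc n) < b - c" "1 / real (Suc n) < d"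
    for n e d
  proof -
    define \<delta> where "\<delta> = 1 / real (Suc n)"
    have \<delta>: "\<delta> > 0" "\<delta> < b - c" "\<delta> < d" using small by (auto simp: \<delta>_def)
    have st: "steklov W (h n) (\<tau>, x) = (LBINT r. indicator {max c (\<tau> - \<delta>)..\<tau>} r * W (r, x)) / \<delta>"
      if "\<tau> \<in> {c<..<b}" for \<tau> x
    proof -
      have "steklov W (h n) (\<tau>, x) = (LBINT u. indicator {0..1} u * W (\<tau> - u * \<delta>, x))"
        unfolding steklov_def unit_unif_def h_def \<delta>_def ennreal_indicator[symmetric]
        by (subst integral_density) auto
      also have "\<dots> = (LBINT u. indicator {\<tau> - \<delta>..\<tau>} (\<tau> + (-\<delta>) * u) * W (\<tau> + (-\<delta>) * u, x))"
        using \<delta> by (intro Bochner_Integration.integral_cong) (auto simp: indicator_def mult.commute zero_le_mult_iff)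
      also have "\<dots> = (LBINT r. indicator {\<tau> - \<delta>..\<tau>} r * W (r, x)) / \<delta>"
        using lborel_integral_real_affine[of "-\<delta>" "\<lambda>r. indicator {\<tau> - \<delta>..\<tau>} r * W (r, x)" \<tau>] \<delta> by simp
      also have "(LBINT r. indicator {\<tau> - \<delta>..\<tau>} r * W (r, x)) = (LBINT r. indicator {max c (\<tau> - \<delta>)..\<tau>} r * W (r, x))"
        by (intro Bochner_Integration.integral_cong) (auto simp: indicator_def W0)
      finally show ?thesis .
    qed
    have iJ: "integrable (lborel \<Otimes>\<^sub>M lborel) (\<lambda>z. Jp p (G z) * steklov W (h n) z)"
      unfolding lborel_prod by (rule integrable_Jp_mult[OF p G steklov_Lp_bound(1)[OF p W Wp]])
    \<comment> \<open>F is frozen before c, so that the integral of F and that of its shift by \<open>\<delta>\<close> telescope.\<close>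
    define H where "H t = F (max c t)" for t
    have [measurable]: "H \<in> borel_measurable borel" unfolding H_def by measurable
    have HK: "\<bar>H t\<bar> \<le> K" if "t \<le> b" for t using FK[of "max c t"] that cb by (auto simp: H_def)
    have iH: "integrable lborel (\<lambda>t. indicat_real S t * H t)" if "\<forall>t\<in>S. c - \<delta> \<le> t \<and> t \<le> b" "S \<in> sets borel" for S
    proof (rule Bochner_Integration.integrable_bound)
      show "integrable lborel (\<lambda>t. indicat_real {c - \<delta>..b} t * K)"
        by (auto simp: integrable_indicator_iff emeasure_lborel_Icc_eq)
      show "AE t in lborel. norm (indicat_real S t * H t) \<le> norm (indicator {c - \<delta>..b} t * K)"
      proof (intro AE_I2)
        fix t show "norm (indicat_real S t * H t) \<le> norm (indicator {c - \<delta>..b} t * K)"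
          using that(1) HK[of t] by (auto simp: indicator_def)
      qed
    qed (use that in auto)
    define D where "D t = indicat_real {c<..<b} t * H (t - \<delta>) - indicat_real {c<..<b} t * H t" for t
    have ish: "integrable lborel (\<lambda>t. indicat_real {c<..<b} t * H (t - \<delta>))"
        "(LBINT t. indicat_real {c<..<b} t * H (t - \<delta>)) = (LBINT t. indicat_real {c - \<delta><..<b - \<delta>} t * H t)"
    proof -
      have e: "indicat_real {c<..<b} t * H (t - \<delta>) = indicat_real {c - \<delta><..<b - \<delta>} (t - \<delta>) * H (t - \<delta>)" for t
        by (auto simp: indicator_def)
      show "integrable lborel (\<lambda>t. indicat_real {c<..<b} t * H (t - \<delta>))"
        unfolding e using iH[of "{c - \<delta><..<b - \<delta>}"] \<delta>
        by (subst integrable_lborel_shift[of "\<lambda>t. indicat_real {c - \<delta><..<b - \<delta>} t * H t"]) auto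
      show "(LBINT t. indicat_real {c<..<b} t * H (t - \<delta>)) = (LBINT t. indicat_real {c - \<delta><..<b - \<delta>} t * H t)"
        unfolding e using integral_lborel_shift[of "\<lambda>t. indicat_real {c - \<delta><..<b - \<delta>} t * H t"] by simp
    qed
    have "k * (LBINT z. Jp p (G z) * steklov W (h n) z)
        = (LBINT \<tau>. k * (LBINT x. Jp p (G (\<tau>, x)) * steklov W (h n) (\<tau>, x)))"
      using lborel_pair.integral_fst'[OF iJ] by (simp add: lborel_prod)
    also have "\<dots> \<le> (LBINT \<tau>. D \<tau> / \<delta>)"
    proof (rule integral_mono_AE)
      show "integrable lborel (\<lambda>\<tau>. k * (LBINT x. Jp p (G (\<tau>, x)) * steklov W (h n) (\<tau>, x)))"
        by (intro integrable_mult_right lborel_pair.integrable_fst'[OF iJ])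
      show "integrable lborel (\<lambda>\<tau>. D \<tau> / \<delta>)"
        unfolding D_def using ish(1) iH[of "{c<..<b}"] \<delta> by auto
      show "AE \<tau> in lborel. k * (LBINT x. Jp p (G (\<tau>, x)) * steklov W (h n) (\<tau>, x)) \<le> D \<tau> / \<delta>"
        using decr
      proof eventually_elim
        case (elim \<tau>)
        show ?case
        proof (cases "\<tau> \<in> {c<..<b}")
          case True
          have "k * (LBINT x. Jp p (G (\<tau>, x)) * steklov W (h n) (\<tau>, x))
              = k * (LBINT x. Jp p (G (\<tau>, x)) * (LBINT r. indicator {max c (\<tau> - \<delta>)..\<tau>} r * W (r, x))) / \<delta>"
            unfolding st[OF True] by simp
          also have "\<dots> \<le> (F (max c (\<tau> - \<delta>)) - F \<tau>) / \<delta>"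
            using elim True \<delta> by (intro divide_right_mono) auto
          also have "\<dots> = D \<tau> / \<delta>" using True by (simp add: D_def H_def)
          finally show ?thesis .
        next
          case False
          then show ?thesis using G0[of \<tau>] by (simp add: D_def)
        qed
      qed
    qed
    also have "\<dots> = (LBINT \<tau>. D \<tau>) / \<delta>" by simp
    also have "(LBINT \<tau>. D \<tau>) \<le> \<delta> * F c - \<delta> * (F b - e)"
    proof -
      have "(LBINT \<tau>. D \<tau>) = (LBINT t. indicat_real {c - \<delta><..<b - \<delta>} t * H t - indicat_real {c<..<b} t * H t)"
        unfolding D_def using ish iH[of "{c<..<b}"] iH[of "{c - \<delta><..<b - \<delta>}"] \<delta> by simp
      also have "\<dots> = (LBINT t. indicat_real {c - \<delta><..c} t * H t - indicat_real {b - \<delta>..<b} t * H t)"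
        using \<delta> by (intro Bochner_Integration.integral_cong) (auto simp: indicator_def)
      also have "\<dots> = (LBINT t. indicat_real {c - \<delta><..c} t * H t) - (LBINT t. indicat_real {b - \<delta>..<b} t * H t)"
        using iH[of "{c - \<delta><..c}"] iH[of "{b - \<delta>..<b}"] \<delta> cb by (subst Bochner_Integration.integral_diff) auto
      also have "(LBINT t. indicat_real {c - \<delta><..c} t * H t) = (LBINT t. indicat_real {c - \<delta><..c} t * F c)"
        by (intro Bochner_Integration.integral_cong) (auto simp: indicator_def H_def max_def)
      also have "\<dots> = \<delta> * F c" using \<delta> by simp
      finally have D: "(LBINT \<tau>. D \<tau>) = \<delta> * F c - (LBINT t. indicat_real {b - \<delta>..<b} t * H t)" .
      have "\<delta> * (F b - e) = (LBINT t. indicat_real {b - \<delta>..<b} t * (F b - e))"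
        using \<delta> by simp
      also have "\<dots> \<le> (LBINT t. indicat_real {b - \<delta>..<b} t * H t)"
      proof (intro integral_mono)
        fix t show "indicat_real {b - \<delta>..<b} t * (F b - e) \<le> indicat_real {b - \<delta>..<b} t * H t"
          using d \<delta> cb by (auto simp: indicator_def H_def)
      qed (use iH[of "{b - \<delta>..<b}"] \<delta> cb in auto)
      finally show ?thesis unfolding D by simp
    qed
    then have "(LBINT \<tau>. D \<tau>) / \<delta> \<le> (\<delta> * F c - \<delta> * (F b - e)) / \<delta>"
      using \<delta> by (intro divide_right_mono) auto
    also have "\<dots> = F c - F b + e" using \<delta> by (simp add: field_simps)
    finally show ?thesis .
  qed
  show ?thesis
  proof (rule field_le_epsilon)
    fix e :: real assume "0 < e"
    then obtain d where d: "d > 0" "\<forall>t\<in>{c..b}. b - d \<le> t \<longrightarrow> F b - e \<le> F t" using lsc by blast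
    have "eventually (\<lambda>n. 1 / real (Suc n) < min d (b - c)) sequentially"
      using d(1) cb by (intro order_tendstoD(2)[OF LIMSEQ_Suc[OF lim_1_over_n]]) auto
    then have "eventually (\<lambda>n. 1 / real (Suc (r n)) < min d (b - c)) sequentially"
      by (rule eventually_compose_filterlim) (rule filterlim_subseq[OF r])
    then have "eventually (\<lambda>n. k * (LBINT z. Jp p (G z) * steklov W (h (r n)) z) \<le> F c - F b + e) sequentially"
      by eventually_elim (use est[OF d(2)] in auto)
    then show "k * (LBINT z. Jp p (G z) * W z) \<le> F c - F b + e"
      by (intro tendsto_upperbound[OF tendsto_mult_left[OF lim]]) auto
  qed
qed

section \<open>Smooth test functions\<close>

lemma Ck_Suc_imp: "Ck (Suc k) f \<Longrightarrow> Ck k f"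
proof (induction k arbitrary: f)
  case 0
  then show ?case
    by (auto intro!: differentiable_imp_continuous_on simp: differentiable_on_def intro: differentiable_at_withinI)
next
  case (Suc k)
  from Suc.prems have "\<forall>x. f differentiable at x" "\<forall>b\<in>Basis. Ck (Suc k) (\<lambda>x. frechet_derivative f (at x) b)"
    unfolding Ck.simps(2)[of "Suc k"] by blast+
  then show ?case using Suc.IH by simp
qed

lemma Ck_const: "Ck k (\<lambda>x. c)"
proof (induction k arbitrary: c)
  case (Suc k)
  then show ?case by (simp add: frechet_derivative_const)
qed simp

lemma Ck_add:
  assumes "Ck k f" "Ck k g" shows "Ck k (\<lambda>x. f x + g x)"
  using assms
proof (induction k arbitrary: f g)
  case 0
  then show ?case by (auto intro: continuous_intros)
next
  case (Suc k)
  have "frechet_derivative (\<lambda>x. f x + g x) (at x) = (\<lambda>b. frechet_derivative f (at x) b + frechet_derivative g (at x) b)" for x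
    using Suc.prems by (intro frechet_derivative_at[symmetric] has_derivative_add) (auto simp: frechet_derivative_works)
  then show ?case using Suc by simp
qed

lemma Ck_mult:
  fixes f g :: "'b::euclidean_space \<Rightarrow> real"
  assumes "Ck k f" "Ck k g" shows "Ck k (\<lambda>x. f x * g x)"
  using assms
proof (induction k arbitrary: f g)
  case 0
  then show ?case by (auto intro: continuous_intros)
next
  case (Suc k)
  have "frechet_derivative (\<lambda>x. f x * g x) (at x)
      = (\<lambda>b. f x * frechet_derivative g (at x) b + frechet_derivative f (at x) b * g x)" for x
    using Suc.prems by (intro frechet_derivative_at[symmetric] has_derivative_mult) (auto simp: frechet_derivative_works)
  moreover have "Ck k f" "Ck k g" using Suc.prems Ck_Suc_imp by blast+
  ultimately show ?case using Suc by (auto intro!: Ck_add)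
qed

lemma Ck_prod:
  fixes f :: "'i \<Rightarrow> 'b::euclidean_space \<Rightarrow> real"
  assumes "finite I" "\<And>i. i \<in> I \<Longrightarrow> Ck k (f i)" shows "Ck k (\<lambda>x. \<Prod>i\<in>I. f i x)"
  using assms
proof (induction I rule: finite_induct)
  case empty
  show ?case using Ck_const[of k 1] by simp
next
  case (insert i I)
  have "Ck k (\<lambda>x. f i x * (\<Prod>i\<in>I. f i x))"
    by (rule Ck_mult) (use insert in simp_all)
  then show ?case using insert by simp
qed

lemma Ck_affine:
  fixes h :: "real \<Rightarrow> real" and c :: "'b::euclidean_space"
  assumes "Ck k h" shows "Ck k (\<lambda>z. h (z \<bullet> c + a))"
  using assms
proof (induction k arbitrary: h)
  case 0
  then have "continuous_on UNIV h" by simp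
  then show ?case
    by (auto intro!: continuous_on_compose2[of UNIV h] continuous_intros)
next
  case (Suc k)
  have "((\<lambda>z. h (z \<bullet> c + a)) has_derivative (\<lambda>v. (v \<bullet> c) * frechet_derivative h (at (z \<bullet> c + a)) 1)) (at z)" for z
  proof -
    have hd: "(h has_derivative frechet_derivative h (at (z \<bullet> c + a))) (at (z \<bullet> c + a))"
      using Suc.prems by (auto simp: frechet_derivative_works)
    have "((\<lambda>z. z \<bullet> c + a) has_derivative (\<lambda>v. v \<bullet> c)) (at z)"
      by (auto intro!: derivative_eq_intros)
    from has_derivative_compose[OF this hd]
    have "((\<lambda>z. h (z \<bullet> c + a)) has_derivative (\<lambda>v. frechet_derivative h (at (z \<bullet> c + a)) (v \<bullet> c))) (at z)" .
    moreover have "frechet_derivative h (at (z \<bullet> c + a)) (v \<bullet> c) = (v \<bullet> c) * frechet_derivative h (at (z \<bullet> c + a)) 1" for v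
      using linear_cmul[OF has_derivative_linear[OF hd], of "v \<bullet> c" 1] by simp
    ultimately show ?thesis by simp
  qed
  note hd = this
  then have "frechet_derivative (\<lambda>z. h (z \<bullet> c + a)) (at z) = (\<lambda>v. (v \<bullet> c) * frechet_derivative h (at (z \<bullet> c + a)) 1)" for z
    by (intro frechet_derivative_at[symmetric])
  moreover have "Ck k (\<lambda>z. frechet_derivative h (at (z \<bullet> c + a)) 1)"
    using Suc.IH[of "\<lambda>t. frechet_derivative h (at t) 1"] Suc.prems by simp
  ultimately show ?case using hd by (auto intro!: Ck_mult Ck_const simp: differentiable_def)
qed

lemma Ck_Suc_real:
  fixes f f' :: "real \<Rightarrow> real"
  assumes "\<And>t. (f has_real_derivative f' t) (at t)" "Ck k f'"
  shows "Ck (Suc k) f"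
proof -
  have "frechet_derivative f (at t) = (\<lambda>h. f' t * h)" for t
    using assms(1)[of t] by (intro frechet_derivative_at[symmetric]) (simp add: has_field_derivative_def)
  then show ?thesis using assms by (auto simp: real_differentiable_def)
qed

text \<open>
  The functions \<open>poly q (1 / t) * exp (- 1 / t)\<close>, extended by zero to \<open>t \<le> 0\<close>. This family is
  closed under differentiation, which makes each member smooth.
\<close>

definition flat_exp :: "real poly \<Rightarrow> real \<Rightarrow> real" where
  "flat_exp q t = (if t \<le> 0 then 0 else poly q (1 / t) * exp (- (1 / t)))"

lemma flat_exp_deriv:
  "(flat_exp q has_real_derivative flat_exp ([:0, 0, 1:] * (q - pderiv q)) t) (at t)"
proof -
  consider "t < 0" | "t > 0" | "t = 0" by linarith
  then show ?thesis
  proof cases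
    case 1
    have "((\<lambda>_. 0) has_real_derivative 0) (at t)" by simp
    then have "(flat_exp q has_real_derivative 0) (at t)"
      by (rule has_field_derivative_transform_within_open[of _ _ _ "{..<0}"]) (use 1 in \<open>auto simp: flat_exp_def\<close>)
    then show ?thesis using 1 by (simp add: flat_exp_def)
  next
    case 2
    have "((\<lambda>t. poly q (1 / t) * exp (- (1 / t))) has_real_derivative
        poly ([:0, 0, 1:] * (q - pderiv q)) (1 / t) * exp (- (1 / t))) (at t)"
      using 2 by (auto intro!: derivative_eq_intros DERIV_chain2[OF poly_DERIV] simp: power2_eq_square algebra_simps divide_simps)
    then have "(flat_exp q has_real_derivative poly ([:0, 0, 1:] * (q - pderiv q)) (1 / t) * exp (- (1 / t))) (at t)"
      by (rule has_field_derivative_transform_within_open[of _ _ _ "{0<..}"]) (use 2 in \<open>auto simp: flat_exp_def\<close>)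
    then show ?thesis using 2 by (simp add: flat_exp_def)
  next
    case 3
    have "((\<lambda>y. poly (pCons 0 q) y / exp y) \<longlongrightarrow> (\<Sum>i\<le>degree (pCons 0 q). coeff (pCons 0 q) i * 0)) at_top"
      unfolding poly_altdef sum_divide_distrib times_divide_eq_right[symmetric]
      by (intro tendsto_sum tendsto_mult tendsto_const tendsto_power_div_exp_0)
    then have *: "((\<lambda>y. poly (pCons 0 q) y / exp y) \<longlongrightarrow> 0) at_top" by simp
    have "((\<lambda>h. poly (pCons 0 q) (inverse h) / exp (inverse h)) \<longlongrightarrow> 0) (at_right 0)"
      by (rule filterlim_compose[OF * filterlim_inverse_at_top_right])
    then have r: "((\<lambda>h. (flat_exp q h - flat_exp q 0) / (h - 0)) \<longlongrightarrow> 0) (at_right 0)"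
      by (rule Lim_transform_eventually)
         (auto simp: eventually_at_right_less flat_exp_def exp_minus field_simps intro!: eventually_mono[OF eventually_at_right_less])
    have l: "((\<lambda>h. (flat_exp q h - flat_exp q 0) / (h - 0)) \<longlongrightarrow> 0) (at_left 0)"
      by (rule Lim_transform_eventually[OF tendsto_const])
         (auto simp: flat_exp_def eventually_at_left_field intro!: exI[of _ "-1"])
    have "((\<lambda>h. (flat_exp q h - flat_exp q 0) / (h - 0)) \<longlongrightarrow> 0) (at 0)"
      using l r by (rule filterlim_split_at)
    then show ?thesis using 3 by (simp add: has_field_derivative_iff flat_exp_def)
  qed
qed

lemma Ck_flat_exp: "Ck k (flat_exp q)"
proof (induction k arbitrary: q)
  case 0
  show ?case
    using flat_exp_deriv by (auto intro!: continuous_at_imp_continuous_on DERIV_isCont)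
next
  case (Suc k)
  then show ?case by (intro Ck_Suc_real[OF flat_exp_deriv])
qed

text \<open>A smooth step from 0 to 1 on the unit interval: the normalised primitive of a bump.\<close>

lemma smooth_step:
  obtains H \<beta> :: "real \<Rightarrow> real" where
    "\<And>k. Ck k H" "\<And>t. (H has_real_derivative \<beta> t) (at t)" "continuous_on UNIV \<beta>"
    "\<And>t. t \<le> 0 \<Longrightarrow> H t = 0" "\<And>t. 1 \<le> t \<Longrightarrow> H t = 1" "\<And>t. 0 \<le> H t \<and> H t \<le> 1"
    "\<And>t. 0 \<le> \<beta> t" "\<And>t. t \<notin> {0<..<1} \<Longrightarrow> \<beta> t = 0"
proof -
  define b where "b t = flat_exp 1 t * flat_exp 1 (1 - t)" for t
  have bC: "Ck k b" for k
    unfolding b_def using Ck_affine[OF Ck_flat_exp, of k 1 "-1 :: real" 1]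
    by (intro Ck_mult Ck_flat_exp) (simp add: inner_real_def)
  have bc: "continuous_on UNIV b" using bC[of 0] by simp
  have b0: "b t \<ge> 0" for t by (simp add: b_def flat_exp_def)
  have bz: "b t = 0" if "t \<notin> {0<..<1}" for t using that by (auto simp: b_def flat_exp_def)
  have bp: "b t > 0" if "t \<in> {0<..<1}" for t using that by (auto simp: b_def flat_exp_def)
  obtain F where F: "\<And>t. (F has_real_derivative b t) (at t)"
    using einterval_antiderivative[of "-\<infinity>" "\<infinity>" b] bc
    by (auto simp: continuous_on_eq_continuous_at has_real_derivative_iff_has_vector_derivative)
  have Fm: "F s \<le> F t" if "s \<le> t" for s t
    by (rule DERIV_nonneg_imp_nondecreasing[of s t F, OF that]) (rule exI, rule conjI[OF F b0])
  have F01: "F 0 < F 1"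
  proof (rule DERIV_pos_imp_increasing_open[of 0 1 F])
    show "continuous_on {0..1} F"
      using F by (auto intro!: continuous_at_imp_continuous_on DERIV_isCont)
    fix x :: real assume "0 < x" "x < 1"
    then show "\<exists>y. (F has_real_derivative y) (at x) \<and> 0 < y"
      using F[of x] bp[of x] by auto
  qed simp
  define I where "I = F 1 - F 0"
  have I: "I > 0" using F01 by (simp add: I_def)
  define H where "H t = (F t - F 0) / I" for t
  have Hd: "(H has_real_derivative b t / I) (at t)" for t
    unfolding H_def using F[of t] I by (auto intro!: derivative_eq_intros)
  have Fl: "F t = F 0" if "t \<le> 0" for t
  proof (cases "t = 0")
    case False
    have "continuous_on {t..0} F" using F by (auto intro!: continuous_at_imp_continuous_on DERIV_isCont)
    moreover have "DERIV F x :> 0" if "t < x" "x < 0" for x using F[of x] bz[of x] that by simp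
    ultimately show ?thesis
      using DERIV_isconst_end[of t 0 F] False that by simp
  qed simp
  have Fr: "F t = F 1" if "t \<ge> 1" for t
  proof (cases "t = 1")
    case False
    have "continuous_on {1..t} F" using F by (auto intro!: continuous_at_imp_continuous_on DERIV_isCont)
    moreover have "DERIV F x :> 0" if "1 < x" "x < t" for x using F[of x] bz[of x] that by simp
    ultimately show ?thesis
      using DERIV_isconst_end[of 1 t F] False that by simp
  qed simp
  show ?thesis
  proof (rule that[of H "\<lambda>t. b t / I"])
    show "Ck k H" for k
    proof -
      have "Ck k (\<lambda>t. b t * (1 / I))" by (intro Ck_mult Ck_const bC)
      then have "Ck (Suc k) H" by (intro Ck_Suc_real[OF Hd]) simp
      then show ?thesis by (rule Ck_Suc_imp)
    qed
    show "0 \<le> H t \<and> H t \<le> 1" for t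
    proof -
      have "F 0 \<le> F t" using Fl[of t] Fm[of 0 t] by (cases "t \<le> 0") auto
      moreover have "F t \<le> F 1" using Fr[of t] Fm[of t 1] by (cases "t \<ge> 1") auto
      ultimately show ?thesis using I by (auto simp: H_def I_def field_simps)
    qed
    show "continuous_on UNIV (\<lambda>t. b t / I)" using bc I by (auto intro!: continuous_intros)
    show "H t = 0" if "t \<le> 0" for t using Fl[OF that] by (simp add: H_def)
    show "H t = 1" if "1 \<le> t" for t using Fr[OF that] I by (simp add: H_def I_def)
  qed (use Hd I b0 bz in simp_all)
qed

section \<open>The distributional time derivative\<close>

lemma integrable_indicator_subset:
  fixes f :: "'z \<Rightarrow> real"
  assumes f: "integrable M (\<lambda>z. indicator A z * f z)" and B: "B \<in> sets M" "B \<subseteq> A"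
  shows "integrable M (\<lambda>z. indicator B z * f z)"
proof -
  have "(\<lambda>z. indicator B z *\<^sub>R (indicator A z * f z)) = (\<lambda>z. indicator B z * f z)"
    using B(2) by (auto simp: indicator_def fun_eq_iff)
  then show ?thesis using integrable_mult_indicator[OF B(1) f] by simp
qed

lemma continuous_bounded_on_interval:
  fixes f :: "real \<Rightarrow> real"
  assumes "continuous_on {a..b} f"
  shows "\<exists>K. \<forall>t\<in>{a..b}. \<bar>f t\<bar> \<le> K"
proof -
  have "bounded (f ` {a..b})" by (intro compact_imp_bounded compact_continuous_image assms) simp
  then show ?thesis by (auto simp: bounded_iff)
qed

lemma AE_zero_if_box_integrals_zero:
  fixes D :: "'a::euclidean_space \<Rightarrow> real"
  assumes op: "open \<Omega>" and D: "integrable lborel (\<lambda>x. indicator \<Omega> x * D x)"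
    and box: "\<And>l u. cbox l u \<subseteq> \<Omega> \<Longrightarrow> (LBINT x. indicator (box l u) x * D x) = 0"
  shows "AE x in lborel. x \<in> \<Omega> \<longrightarrow> D x = 0"
proof -
  have on_box: "AE x in lborel. x \<in> box a b \<longrightarrow> D x = 0" if ab: "cbox a b \<subseteq> \<Omega>" for a b
  proof -
    define f where "f x = indicator (box a b) x * D x" for x
    have sub: "box a b \<subseteq> \<Omega>" using ab box_subset_cbox by blast
    have f: "integrable lborel f"
      unfolding f_def by (rule integrable_indicator_subset[OF D _ sub]) simp
    have fs: "set_integrable lborel A f" if "A \<in> sets borel" for A
      using integrable_mult_indicator[OF _ f, of A] that by (simp add: set_integrable_def)
    have gen: "set_lebesgue_integral lborel A f = 0" if "A \<in> sigma_sets UNIV (range (\<lambda>(a, b). box a b :: 'a set))" for A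
    proof (rule sigma_sets_induct_disjoint[OF _ _ that])
      show "Int_stable (range (\<lambda>(a, b). box a b :: 'a set))"
        by (auto simp: Int_stable_def box_Int_box)
    next
      fix A assume "A \<in> range (\<lambda>(a, b). box a b :: 'a set)"
      then obtain l u where A: "A = box l u" by auto
      obtain l' u' where i: "box l u \<inter> box a b = box l' u'" using box_Int_box by blast
      have e: "set_lebesgue_integral lborel A f = (LBINT x. indicator (box l' u') x * D x)"
        unfolding set_lebesgue_integral_def A i[symmetric] f_def
        by (intro Bochner_Integration.integral_cong) (auto simp: indicator_def)
      show "set_lebesgue_integral lborel A f = 0"
      proof (cases "box l' u' = {}")
        case False
        have "cbox l' u' = closure (box l' u')" using False by simp
        also have "\<dots> \<subseteq> cbox a b" using i box_subset_cbox[of a b] by (intro closure_minimal) auto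
        finally show ?thesis unfolding e using ab by (intro box) auto
      qed (simp add: e)
    next
      fix A assume A: "A \<in> sigma_sets UNIV (range (\<lambda>(a, b). box a b :: 'a set))"
        and z: "set_lebesgue_integral lborel A f = 0"
      have Ab: "A \<in> sets borel" using A by (simp add: borel_eq_box)
      have "(LBINT x. f x) = 0" unfolding f_def by (rule box[OF ab])
      moreover have "(LBINT x. f x) = set_lebesgue_integral lborel (A \<union> (UNIV - A)) f"
        by (simp add: set_lebesgue_integral_def)
      moreover have "\<dots> = set_lebesgue_integral lborel A f + set_lebesgue_integral lborel (UNIV - A) f"
        using Ab by (intro set_integral_Un fs) auto
      ultimately show "set_lebesgue_integral lborel (UNIV - A) f = 0" using z by simp
    next
      fix A :: "nat \<Rightarrow> 'a set"
      assume d: "disjoint_family A" and A: "range A \<subseteq> sigma_sets UNIV (range (\<lambda>(a, b). box a b))"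
        and z: "\<And>i. set_lebesgue_integral lborel (A i) f = 0"
      have Ab: "A i \<in> sets borel" for i using A by (auto simp: borel_eq_box)
      have "set_lebesgue_integral lborel (\<Union>i. A i) f = (\<Sum>i. set_lebesgue_integral lborel (A i) f)"
        using d Ab by (intro lebesgue_integral_countable_add fs) (auto simp: disjoint_family_on_def)
      then show "set_lebesgue_integral lborel (\<Union>i. A i) f = 0" using z by simp
    qed (auto simp: set_lebesgue_integral_def)
    have "AE x in lborel. f x = 0"
      by (rule density_unique_real[OF f]) (use gen in \<open>auto simp: borel_eq_box set_lebesgue_integral_def\<close>)
    then show ?thesis by eventually_elim (auto simp: f_def)
  qed
  define \<F> where "\<F> = {box a b |a b. cbox a b \<subseteq> \<Omega>}"
  obtain \<F>' where F': "\<F>' \<subseteq> \<F>" "countable \<F>'" "\<Union>\<F>' = \<Union>\<F>"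
    using Lindelof[of \<F>] by (auto simp: \<F>_def)
  have "\<Omega> \<subseteq> \<Union>\<F>"
  proof
    fix x assume "x \<in> \<Omega>"
    then obtain e where e: "e > 0" "cball x e \<subseteq> \<Omega>" using op open_contains_cball by blast
    obtain a b where ab: "x \<in> box a b" "box a b \<subseteq> ball x e" using rational_boxes[OF e(1)] by blast
    then have "cbox a b = closure (box a b)" by (subst closure_box) auto
    also have "\<dots> \<subseteq> cball x e" using ab(2) by (intro closure_minimal) (auto simp: subset_eq)
    finally have "box a b \<in> \<F>" using e by (auto simp: \<F>_def)
    then show "x \<in> \<Union>\<F>" using ab by blast
  qed
  moreover have "AE x in lborel. \<forall>B\<in>\<F>'. x \<in> B \<longrightarrow> D x = 0"
    using F' on_box by (intro AE_ball_countable[THEN iffD2]) (auto simp: \<F>_def)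
  ultimately show ?thesis using F'(3) by (auto elim!: eventually_mono dest!: subsetD)
qed

text \<open>The kernels are supported to the right of \<open>\<sigma>\<close>, so continuity on \<open>{0..}\<close> is enough even at 0.\<close>

lemma approximate_identity_right:
  fixes m \<beta> :: "real \<Rightarrow> real"
  assumes m: "continuous_on {0..} m" and [measurable]: "m \<in> borel_measurable borel" and \<sigma>: "0 \<le> \<sigma>"
    and \<beta>c: "continuous_on UNIV \<beta>" and \<beta>: "\<And>t. t \<notin> {0<..<1} \<Longrightarrow> \<beta> t = 0"
  shows "(\<lambda>n. LBINT t. m t * (real (Suc n) * \<beta> (real (Suc n) * (t - \<sigma>)))) \<longlonglongrightarrow> m \<sigma> * (LBINT t. \<beta> t)"
proof -
  have [measurable]: "\<beta> \<in> borel_measurable borel" using \<beta>c by (rule borel_measurable_continuous_onI)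
  have e: "(LBINT t. m t * (real (Suc n) * \<beta> (real (Suc n) * (t - \<sigma>)))) = (LBINT u. m (\<sigma> + u / real (Suc n)) * \<beta> u)" for n
  proof -
    have "(LBINT t. m t * (real (Suc n) * \<beta> (real (Suc n) * (t - \<sigma>))))
      = 1 / real (Suc n) * (LBINT u. m (\<sigma> + (1 / real (Suc n)) * u) * (real (Suc n) * \<beta> (real (Suc n) * ((\<sigma> + (1 / real (Suc n)) * u) - \<sigma>))))"
      by (subst lborel_integral_real_affine[of "1 / real (Suc n)" _ \<sigma>]) auto
    also have "\<dots> = (LBINT u. 1 / real (Suc n) * (m (\<sigma> + (1 / real (Suc n)) * u) * (real (Suc n) * \<beta> (real (Suc n) * ((\<sigma> + (1 / real (Suc n)) * u) - \<sigma>)))))"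
      by (rule Bochner_Integration.integral_mult_right_zero[symmetric])
    also have "\<dots> = (LBINT u. m (\<sigma> + u / real (Suc n)) * \<beta> u)"
      by (intro Bochner_Integration.integral_cong) (auto simp del: of_nat_Suc)
    finally show ?thesis .
  qed
  have "continuous_on {\<sigma>..\<sigma> + 1} m" using \<sigma> by (intro continuous_on_subset[OF m]) auto
  then obtain K where K: "\<And>t. t \<in> {\<sigma>..\<sigma> + 1} \<Longrightarrow> \<bar>m t\<bar> \<le> K"
    using continuous_bounded_on_interval by blast
  obtain L where L: "\<And>t. t \<in> {0..1} \<Longrightarrow> \<bar>\<beta> t\<bar> \<le> L"
    using continuous_bounded_on_interval[OF continuous_on_subset[OF \<beta>c subset_UNIV]] by blast
  have "(\<lambda>n. LBINT u. m (\<sigma> + u / real (Suc n)) * \<beta> u) \<longlonglongrightarrow> (LBINT u. m \<sigma> * \<beta> u)"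
  proof (rule integral_dominated_convergence[where w="\<lambda>u. indicat_real {0..1} u * (K * L)"])
    show "integrable lborel (\<lambda>u::real. indicat_real {0..1} u * (K * L))"
      by (auto simp: integrable_indicator_iff emeasure_lborel_Icc_eq)
    show "AE u in lborel. (\<lambda>n. m (\<sigma> + u / real (Suc n)) * \<beta> u) \<longlonglongrightarrow> m \<sigma> * \<beta> u"
    proof (intro AE_I2)
      fix u :: real
      show "(\<lambda>n. m (\<sigma> + u / real (Suc n)) * \<beta> u) \<longlonglongrightarrow> m \<sigma> * \<beta> u"
      proof (cases "u \<in> {0<..<1}")
        case True
        have "(\<lambda>n. \<sigma> + u * (1 / real (Suc n))) \<longlonglongrightarrow> \<sigma> + u * 0"
          by (intro tendsto_intros LIMSEQ_Suc[OF lim_1_over_n])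
        then have "(\<lambda>n. \<sigma> + u / real (Suc n)) \<longlonglongrightarrow> \<sigma>" by simp
        then have "(\<lambda>n. m (\<sigma> + u / real (Suc n))) \<longlonglongrightarrow> m \<sigma>"
          using True \<sigma> by (intro continuous_on_tendsto_compose[OF m]) (auto intro!: always_eventually add_nonneg_nonneg)
        then show ?thesis by (intro tendsto_intros)
      qed (use \<beta> in simp)
    qed
    show "AE u in lborel. norm (m (\<sigma> + u / real (Suc n)) * \<beta> u) \<le> indicat_real {0..1} u * (K * L)" for n
    proof (intro AE_I2)
      fix u :: real
      show "norm (m (\<sigma> + u / real (Suc n)) * \<beta> u) \<le> indicat_real {0..1} u * (K * L)"
      proof (cases "u \<in> {0<..<1}")
        case True
        then have "u / real (Suc n) \<le> 1" "0 \<le> u / real (Suc n)" by (auto simp: field_simps)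
        then have "\<bar>m (\<sigma> + u / real (Suc n))\<bar> \<le> K" by (intro K) auto
        moreover have "\<bar>\<beta> u\<bar> \<le> L" using True by (intro L) auto
        ultimately show ?thesis using True by (auto simp: abs_mult intro!: mult_mono)
      next
        case False
        have "0 \<le> K * L" using K[of \<sigma>] L[of 0] by auto
        then show ?thesis using \<beta>[OF False] by simp
      qed
    qed
  qed measurable
  then show ?thesis unfolding e by simp
qed

lemma fst_borel [measurable]: "fst \<in> borel_measurable (borel :: ('b::second_countable_topology \<times> 'c::second_countable_topology) measure)"
  and snd_borel [measurable]: "snd \<in> borel_measurable (borel :: ('b \<times> 'c) measure)"
  by (auto intro!: borel_measurable_continuous_onI continuous_intros)

lemma tensor_test_function:
  fixes \<eta> :: "real \<Rightarrow> real" and H :: "real \<Rightarrow> real" and l u :: "'a::euclidean_space"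
  assumes \<eta>: "\<And>k. Ck k \<eta>" and H: "\<And>k. Ck k H" and H0: "\<And>t. t \<le> 0 \<Longrightarrow> H t = 0"
    and supp: "\<And>t. t \<notin> {a..b} \<Longrightarrow> \<eta> t = 0" and a: "0 < a"
    and sub: "cbox l u \<subseteq> \<Omega>" and c: "0 < c"
  shows "(\<lambda>z. \<eta> (fst z) * (\<Prod>i\<in>Basis. H (c * (snd z \<bullet> i - l \<bullet> i)) * H (c * (u \<bullet> i - snd z \<bullet> i))))
      \<in> Cc_infty ({0<..} \<times> \<Omega>)"
proof -
  have 1: "Ck k (\<lambda>z :: real \<times> 'a. \<eta> (fst z))" for k
    using Ck_affine[OF \<eta>, of k "(1, 0) :: real \<times> 'a" 0] by (simp add: inner_Pair_0 inner_prod_def)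
  have 2: "Ck k (\<lambda>z :: real \<times> 'a. H (c * (snd z \<bullet> i - l \<bullet> i)))" for k i
    using Ck_affine[OF H, of k "(0, c *\<^sub>R i) :: real \<times> 'a" "- c * (l \<bullet> i)"]
    by (simp add: inner_prod_def algebra_simps)
  have 3: "Ck k (\<lambda>z :: real \<times> 'a. H (c * (u \<bullet> i - snd z \<bullet> i)))" for k i
    using Ck_affine[OF H, of k "(0, - c *\<^sub>R i) :: real \<times> 'a" "c * (u \<bullet> i)"]
    by (simp add: inner_prod_def algebra_simps)
  show ?thesis
    unfolding Cc_infty_def
  proof (intro CollectI conjI allI exI[of _ "{a..b} \<times> cbox l u"])
    show "Ck k (\<lambda>z. \<eta> (fst z) * (\<Prod>i\<in>Basis. H (c * (snd z \<bullet> i - l \<bullet> i)) * H (c * (u \<bullet> i - snd z \<bullet> i))))" for k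
      by (intro Ck_mult Ck_prod 1 2 3) simp
    show "compact ({a..b} \<times> cbox l u)" by (intro compact_Times) auto
    show "{a..b} \<times> cbox l u \<subseteq> {0<..} \<times> \<Omega>" using sub a by auto
    show "z \<notin> {a..b} \<times> cbox l u \<longrightarrow> \<eta> (fst z) * (\<Prod>i\<in>Basis. H (c * (snd z \<bullet> i - l \<bullet> i)) * H (c * (u \<bullet> i - snd z \<bullet> i))) = 0" for z
    proof
      assume "z \<notin> {a..b} \<times> cbox l u"
      then consider "fst z \<notin> {a..b}" | i where "i \<in> Basis" "snd z \<bullet> i < l \<bullet> i \<or> u \<bullet> i < snd z \<bullet> i"
        by (cases z) (auto simp: mem_box not_le)
      then show "\<eta> (fst z) * (\<Prod>i\<in>Basis. H (c * (snd z \<bullet> i - l \<bullet> i)) * H (c * (u \<bullet> i - snd z \<bullet> i))) = 0"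
      proof cases
        case 2
        then have "H (c * (snd z \<bullet> i - l \<bullet> i)) * H (c * (u \<bullet> i - snd z \<bullet> i)) = 0"
          using c H0 by (auto simp: mult_le_0_iff)
        then show ?thesis using 2(1) by (auto simp: prod_zero_iff)
      qed (use supp in simp)
    qed
  qed
qed

text \<open>
  A curve v with distributional time derivative w in the cylinder over \<open>\<Omega>\<close>. The functions V and W
  represent them at nonnegative times and points of \<open>\<Omega>\<close>.
\<close>

locale time_derivative =
  fixes \<Omega> :: "'a::euclidean_space set" and v w :: "real \<Rightarrow> 'a \<Rightarrow> real" and V W :: "real \<times> 'a \<Rightarrow> real"
  assumes wk: "weak_time_derivative \<Omega> v w"
    and V: "\<And>t x. 0 \<le> t \<Longrightarrow> x \<in> \<Omega> \<Longrightarrow> V (t, x) = v t x"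
    and W: "\<And>t x. 0 \<le> t \<Longrightarrow> x \<in> \<Omega> \<Longrightarrow> W (t, x) = w t x"
    and Vi: "\<And>T. integrable lborel (\<lambda>z. indicator ({0..T} \<times> \<Omega>) z * V z)"
    and Wi: "\<And>T. integrable lborel (\<lambda>z. indicator ({0..T} \<times> \<Omega>) z * W z)"
    and Vm [measurable]: "V \<in> borel_measurable borel"

text \<open>Testing with tensor products whose spatial factors exhaust the indicator of a box.\<close>

lemma (in time_derivative) weak_derivative_box:
  fixes H \<eta> \<eta>' :: "real \<Rightarrow> real"
  assumes H: "\<And>k. Ck k H" "\<And>t. t \<le> 0 \<Longrightarrow> H t = 0" "\<And>t. 1 \<le> t \<Longrightarrow> H t = 1" "\<And>t. 0 \<le> H t \<and> H t \<le> 1"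
    and \<eta>: "\<And>k. Ck k \<eta>" "\<And>t. t \<notin> {a..b} \<Longrightarrow> \<eta> t = 0" "\<And>t. (\<eta> has_real_derivative \<eta>' t) (at t)" "continuous_on UNIV \<eta>'"
    and a: "0 < a" and sub: "cbox l u \<subseteq> \<Omega>"
  shows "(LBINT z. indicator ({a..b} \<times> box l u) z * V z * \<eta>' (fst z)) =
    - (LBINT z. indicator ({a..b} \<times> box l u) z * W z * \<eta> (fst z))"
proof -
  \<comment> \<open>The spatial factors vanish off the open box and tend to 1 on it.\<close>
  define \<phi> where "\<phi> n x = (\<Prod>i\<in>Basis. H (real (Suc n) * (x \<bullet> i - l \<bullet> i)) * H (real (Suc n) * (u \<bullet> i - x \<bullet> i)))" for n and x :: 'a
  have Hm: "H \<in> borel_measurable borel" using H(1)[of 0] by (auto intro: borel_measurable_continuous_onI)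
  have \<eta>m [measurable]: "\<eta> \<in> borel_measurable borel" "\<eta>' \<in> borel_measurable borel"
    using \<eta>(1)[of 0] \<eta>(4) by (auto intro: borel_measurable_continuous_onI)
  note [measurable] = Hm
  have \<phi>m [measurable]: "\<phi> n \<in> borel_measurable borel" for n unfolding \<phi>_def by measurable
  have \<phi>01: "0 \<le> \<phi> n x \<and> \<phi> n x \<le> 1" for n x
    unfolding \<phi>_def using H(4) by (auto intro!: prod_nonneg prod_le_1 mult_le_one)
  have \<phi>out: "\<phi> n x = 0" if "x \<notin> box l u" for n x
  proof -
    from that obtain i where i: "i \<in> Basis" "x \<bullet> i \<le> l \<bullet> i \<or> u \<bullet> i \<le> x \<bullet> i"
      by (auto simp: mem_box not_less)
    then have "H (real (Suc n) * (x \<bullet> i - l \<bullet> i)) * H (real (Suc n) * (u \<bullet> i - x \<bullet> i)) = 0"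
      using H(2)[of "real (Suc n) * (x \<bullet> i - l \<bullet> i)"] H(2)[of "real (Suc n) * (u \<bullet> i - x \<bullet> i)"]
      by (auto simp: mult_le_0_iff)
    then show ?thesis using i(1) by (auto simp: \<phi>_def prod_zero_iff)
  qed
  have Hlim: "(\<lambda>n. H (real (Suc n) * d)) \<longlonglongrightarrow> 1" if "d > 0" for d
  proof (rule tendsto_eventually)
    obtain N :: nat where N: "1 / d \<le> real N" using real_arch_simple by blast
    have "eventually (\<lambda>n. 1 / d \<le> real n) sequentially"
      using eventually_ge_at_top[of N] by eventually_elim (use N in linarith)
    then show "eventually (\<lambda>n. H (real (Suc n) * d) = 1) sequentially"
      by eventually_elim (use that in \<open>auto intro!: H(3) simp: field_simps\<close>)
  qed
  have \<phi>lim: "(\<lambda>n. \<phi> n x) \<longlonglongrightarrow> indicator (box l u) x" for x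
  proof (cases "x \<in> box l u")
    case True
    then have "(\<lambda>n. \<phi> n x) \<longlonglongrightarrow> (\<Prod>i\<in>(Basis::'a set). 1 * 1)"
      unfolding \<phi>_def by (intro tendsto_prod tendsto_mult Hlim) (auto simp: mem_box)
    then show ?thesis using True by simp
  qed (simp add: \<phi>out)
  have \<eta>'0: "\<eta>' t = 0" if "t \<notin> {a..b}" for t
  proof -
    have "open (- {a..b})" by auto
    then have "((\<lambda>_. 0) has_real_derivative \<eta>' t) (at t)"
      using that \<eta>(2) by (intro has_field_derivative_transform_within_open[OF \<eta>(3)[of t]]) auto
    then show ?thesis using DERIV_unique[OF _ DERIV_const] by blast
  qed
  have bs: "x \<in> \<Omega>" if "x \<in> box l u" for x
    using sub box_subset_cbox[of l u] that by blast
  have supp: "a \<le> t" "t \<le> b" if "\<eta> t \<noteq> 0 \<or> \<eta>' t \<noteq> 0" for t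
    using \<eta>(2)[of t] \<eta>'0[of t] that by auto
  have eq: "(LBINT z. indicator ({a..b} \<times> \<Omega>) z * V z * (\<eta>' (fst z) * \<phi> n (snd z))) =
      - (LBINT z. indicator ({a..b} \<times> \<Omega>) z * W z * (\<eta> (fst z) * \<phi> n (snd z)))" for n
  proof -
    define \<psi> where "\<psi> z = \<eta> (fst z) * \<phi> n (snd z)" for z
    have "\<psi> \<in> Cc_infty ({0<..} \<times> \<Omega>)"
      using tensor_test_function[of \<eta> H a b l u \<Omega> "real (Suc n)", OF \<eta>(1) H(1) H(2) \<eta>(2) a sub]
      by (simp add: \<psi>_def[abs_def] \<phi>_def)
    then have *: "(LINT z:({0<..} \<times> \<Omega>)|lborel. v (fst z) (snd z) * deriv (\<lambda>\<tau>. \<psi> (\<tau>, snd z)) (fst z)) =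
        - (LINT z:({0<..} \<times> \<Omega>)|lborel. w (fst z) (snd z) * \<psi> z)"
      using wk unfolding weak_time_derivative_def by blast
    have d: "deriv (\<lambda>\<tau>. \<psi> (\<tau>, x)) t = \<eta>' t * \<phi> n x" for t x
      unfolding \<psi>_def using \<eta>(3)[of t] by (intro DERIV_imp_deriv) (auto intro!: derivative_eq_intros)
    have "(LINT z:({0<..} \<times> \<Omega>)|lborel. v (fst z) (snd z) * deriv (\<lambda>\<tau>. \<psi> (\<tau>, snd z)) (fst z))
       = (LBINT z. indicator ({a..b} \<times> \<Omega>) z * V z * (\<eta>' (fst z) * \<phi> n (snd z)))"
      unfolding set_lebesgue_integral_def d using a
      by (intro Bochner_Integration.integral_cong) (auto simp: indicator_def V intro!: supp)
    moreover have "(LINT z:({0<..} \<times> \<Omega>)|lborel. w (fst z) (snd z) * \<psi> z)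
       = (LBINT z. indicator ({a..b} \<times> \<Omega>) z * W z * (\<eta> (fst z) * \<phi> n (snd z)))"
      unfolding set_lebesgue_integral_def \<psi>_def using a
      by (intro Bochner_Integration.integral_cong) (auto simp: indicator_def W intro!: supp)
    ultimately show ?thesis using * by simp
  qed
  have lim: "(\<lambda>n. LBINT z. indicator ({a..b} \<times> \<Omega>) z * U z * (\<theta> (fst z) * \<phi> n (snd z)))
      \<longlonglongrightarrow> (LBINT z. indicator ({a..b} \<times> box l u) z * U z * \<theta> (fst z))"
    if \<theta>c: "continuous_on UNIV \<theta>" and Ui: "\<And>T. integrable lborel (\<lambda>z. indicator ({0..T} \<times> \<Omega>) z * U z)"
    for \<theta> :: "real \<Rightarrow> real" and U :: "real \<times> 'a \<Rightarrow> real"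
  proof -
    have [measurable]: "\<theta> \<in> borel_measurable borel" using \<theta>c by (rule borel_measurable_continuous_onI)
    obtain K where K: "\<And>t. t \<in> {a..b} \<Longrightarrow> \<bar>\<theta> t\<bar> \<le> K"
      using continuous_bounded_on_interval[OF continuous_on_subset[OF \<theta>c subset_UNIV]] by blast
    have iU: "integrable lborel (\<lambda>z. indicator ({a..b} \<times> \<Omega>) z * U z)"
    proof -
      have "integrable lborel (\<lambda>z. indicator ({a..b} \<times> UNIV) z * (indicator ({0..b} \<times> \<Omega>) z * U z))"
        using integrable_mult_indicator[OF _ Ui[of b], of "{a..b} \<times> UNIV"]
        by (simp add: borel_prod[symmetric])
      moreover have "(\<lambda>z. indicator ({a..b} \<times> UNIV) z * (indicator ({0..b} \<times> \<Omega>) z * U z))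
          = (\<lambda>z. indicator ({a..b} \<times> \<Omega>) z * U z)"
        using a by (auto simp: indicator_def fun_eq_iff)
      ultimately show ?thesis by simp
    qed
    define UU where "UU z = indicator ({a..b} \<times> \<Omega>) z * U z" for z
    have UUi: "integrable lborel UU" using iU by (simp add: UU_def[abs_def])
    then have [measurable]: "UU \<in> borel_measurable borel" by auto
    have "(\<lambda>n. LBINT z. UU z * (\<theta> (fst z) * \<phi> n (snd z)))
        \<longlonglongrightarrow> (LBINT z. UU z * (\<theta> (fst z) * indicator (box l u) (snd z)))"
    proof (rule integral_dominated_convergence[where w="\<lambda>z. \<bar>UU z\<bar> * K"])
      show "AE z in lborel. norm (UU z * (\<theta> (fst z) * \<phi> n (snd z)))
          \<le> \<bar>UU z\<bar> * K" for n
      proof (intro AE_I2)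
        fix z :: "real \<times> 'a"
        show "norm (UU z * (\<theta> (fst z) * \<phi> n (snd z)))
          \<le> \<bar>UU z\<bar> * K"
        proof (cases "fst z \<in> {a..b}")
          case True
          have "\<bar>\<theta> (fst z)\<bar> * \<bar>\<phi> n (snd z)\<bar> \<le> K * 1"
            using K[OF True] \<phi>01[of n "snd z"] by (intro mult_mono) auto
          then show ?thesis by (simp add: abs_mult mult_left_mono)
        qed (auto simp: UU_def indicator_def)
      qed
      show "AE z in lborel. (\<lambda>n. UU z * (\<theta> (fst z) * \<phi> n (snd z)))
         \<longlonglongrightarrow> UU z * (\<theta> (fst z) * indicator (box l u) (snd z))"
        by (intro AE_I2 tendsto_intros \<phi>lim)
    qed (use UUi in auto)
    also have "(LBINT z. UU z * (\<theta> (fst z) * indicator (box l u) (snd z)))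
        = (LBINT z. indicator ({a..b} \<times> box l u) z * U z * \<theta> (fst z))"
    proof (rule Bochner_Integration.integral_cong[OF refl])
      fix z :: "real \<times> 'a"
      show "UU z * (\<theta> (fst z) * indicator (box l u) (snd z)) = indicator ({a..b} \<times> box l u) z * U z * \<theta> (fst z)"
        using bs[of "snd z"] by (cases z, cases "snd z \<in> box l u") (simp_all add: UU_def indicator_def)
    qed
    finally show ?thesis unfolding UU_def .
  qed
  have "(\<lambda>n. - (LBINT z. indicator ({a..b} \<times> \<Omega>) z * W z * (\<eta> (fst z) * \<phi> n (snd z))))
      \<longlonglongrightarrow> - (LBINT z. indicator ({a..b} \<times> box l u) z * W z * \<eta> (fst z))"
    using \<eta>(1)[of 0] by (intro tendsto_minus lim Wi) simp
  with lim[OF \<eta>(4) Vi] show ?thesis unfolding eq by (rule LIMSEQ_unique)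
qed

lemma integral_smooth_step_deriv:
  fixes H \<beta> :: "real \<Rightarrow> real"
  assumes "\<And>t. (H has_real_derivative \<beta> t) (at t)" "continuous_on UNIV \<beta>"
    and "H 0 = 0" "H 1 = 1" "\<And>t. t \<notin> {0<..<1} \<Longrightarrow> \<beta> t = 0"
  shows "(LBINT t. \<beta> t) = 1"
proof -
  have "(LBINT t. indicator {0..1} t *\<^sub>R \<beta> t) = H 1 - H 0"
  proof (rule integral_FTC_Icc)
    show "(H has_vector_derivative \<beta> t) (at t within {0..1})" for t
      using assms(1)[of t] has_vector_derivative_at_within
      by (auto simp: has_real_derivative_iff_has_vector_derivative)
  qed (auto intro: continuous_on_subset[OF assms(2)])
  moreover have "(\<lambda>t. indicator {0..1} t *\<^sub>R \<beta> t) = \<beta>"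
  proof
    fix t show "indicator {0..1} t *\<^sub>R \<beta> t = \<beta> t"
      using assms(5)[of t] by (cases "t \<in> {0<..<1}") (auto simp: indicator_def)
  qed
  ultimately show ?thesis using assms by simp
qed

text \<open>
  The temporal factor is now let tend to the indicator of \<open>{\<sigma><..\<tau>}\<close>. Its derivative then tends to
  the difference of the Dirac measures at \<open>\<sigma>\<close> and \<open>\<tau>\<close>.
\<close>

lemma (in time_derivative) weak_derivative_box_increment:
  assumes cont: "continuous_on {0..} (\<lambda>t. LBINT x. indicator (box l u) x * V (t, x))"
    and \<sigma>\<tau>: "0 < \<sigma>" "\<sigma> < \<tau>" and sub: "cbox l u \<subseteq> \<Omega>"
  shows "(LBINT x. indicator (box l u) x * V (\<tau>, x)) - (LBINT x. indicator (box l u) x * V (\<sigma>, x))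
    = (LBINT z. indicator ({\<sigma>..\<tau>} \<times> box l u) z * W z)"
proof -
  obtain H \<beta> :: "real \<Rightarrow> real" where H: 
    "\<And>k. Ck k H" "\<And>t. (H has_real_derivative \<beta> t) (at t)" "continuous_on UNIV \<beta>"
    "\<And>t. t \<le> 0 \<Longrightarrow> H t = 0" "\<And>t. 1 \<le> t \<Longrightarrow> H t = 1" "\<And>t. 0 \<le> H t \<and> H t \<le> 1"
    "\<And>t. 0 \<le> \<beta> t" "\<And>t. t \<notin> {0<..<1} \<Longrightarrow> \<beta> t = 0"
    using smooth_step by blast
  have \<beta>1: "(LBINT t. \<beta> t) = 1"
    using integral_smooth_step_deriv[OF H(2,3) H(4)[of 0] H(5)[of 1] H(8)] by simp
  have [measurable]: "\<beta> \<in> borel_measurable borel" "H \<in> borel_measurable borel"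
    using H(3) H(1)[of 0] by (auto intro: borel_measurable_continuous_onI)
  define B where "B = \<tau> + 1"
  define m where "m t = (LBINT x. indicator (box l u) x * V (t, x))" for t
  have [measurable]: "m \<in> borel_measurable borel" unfolding m_def by measurable
  define \<eta> where "\<eta> n t = H (real (Suc n) * (t - \<sigma>)) - H (real (Suc n) * (t - \<tau>))" for n t
  \<comment> \<open>These kernels tend to the Dirac measure at s, from the right.\<close>
  define \<kappa> where "\<kappa> n s t = real (Suc n) * \<beta> (real (Suc n) * (t - s))" for n s t
  define \<eta>' where "\<eta>' n t = \<kappa> n \<sigma> t - \<kappa> n \<tau> t" for n t
  have \<eta>C: "Ck k (\<eta> n)" for k n
  proof -
    have 1: "Ck k (\<lambda>t. H (real (Suc n) * (t - a)))" for a
      using Ck_affine[OF H(1), of k "real (Suc n)" "- real (Suc n) * a"]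
      by (simp add: inner_real_def algebra_simps)
    have "Ck k (\<lambda>t. H (real (Suc n) * (t - \<sigma>)) + (-1) * H (real (Suc n) * (t - \<tau>)))"
      by (intro Ck_add Ck_mult Ck_const 1)
    then show ?thesis by (simp add: \<eta>_def[abs_def])
  qed
  have \<eta>d: "(\<eta> n has_real_derivative \<eta>' n t) (at t)" for n t
    unfolding \<eta>_def \<eta>'_def \<kappa>_def by (auto intro!: derivative_eq_intros DERIV_chain2[OF H(2)])
  have \<eta>'c: "continuous_on UNIV (\<eta>' n)" for n
    unfolding \<eta>'_def \<kappa>_def by (auto intro!: continuous_intros continuous_on_compose2[OF H(3)])
  have big: "1 \<le> real (Suc n) * (t - s)" if "t \<ge> s + 1" for n t s
  proof -
    have "1 * 1 \<le> real (Suc n) * (t - s)" using that by (intro mult_mono) auto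
    then show ?thesis by simp
  qed
  have \<eta>s: "\<eta> n t = 0" if "t \<notin> {\<sigma>..B}" for n t
  proof -
    from that have "t < \<sigma> \<or> t > B" by auto
    then consider "t < \<sigma>" | "t > B" by blast
    then show ?thesis
    proof cases
      case 1
      then have "real (Suc n) * (t - \<sigma>) \<le> 0" "real (Suc n) * (t - \<tau>) \<le> 0"
        using \<sigma>\<tau> by (auto simp: mult_le_0_iff)
      then show ?thesis unfolding \<eta>_def by (simp only: H(4))
    next
      case 2
      then have "\<sigma> + 1 \<le> t" "\<tau> + 1 \<le> t" using \<sigma>\<tau> by (auto simp: B_def)
      then have "H (real (Suc n) * (t - \<sigma>)) = 1" "H (real (Suc n) * (t - \<tau>)) = 1"
        by (auto intro!: H(5) big simp del: of_nat_Suc)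
      then show ?thesis unfolding \<eta>_def by simp
    qed
  qed
  have eq: "(LBINT z. indicator ({\<sigma>..B} \<times> box l u) z * V z * \<eta>' n (fst z)) =
    - (LBINT z. indicator ({\<sigma>..B} \<times> box l u) z * W z * \<eta> n (fst z))" for n
    by (rule weak_derivative_box[where H = H and \<eta> = "\<eta> n" and \<eta>' = "\<eta>' n" and a = \<sigma> and b = B and l = l and u = u])
       (fact H \<eta>C \<eta>s \<eta>d \<eta>'c \<sigma>\<tau> sub)+
  have bs: "x \<in> \<Omega>" if "x \<in> box l u" for x
    using sub box_subset_cbox[of l u] that by blast
  have ibox: "integrable lborel (\<lambda>z. indicator ({\<sigma>..B} \<times> box l u) z * U z)"
    if Ui: "\<And>T. integrable lborel (\<lambda>z. indicator ({0..T} \<times> \<Omega>) z * U z)" for U :: "real \<times> 'a \<Rightarrow> real"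
    by (rule integrable_indicator_subset[OF Ui[of B]]) (use \<sigma>\<tau> bs in \<open>auto simp: borel_prod[symmetric]\<close>)
  have \<eta>'s: "\<eta>' n t = 0" if "t \<notin> {\<sigma>..B}" for n t
  proof -
    have "open (- {\<sigma>..B})" by auto
    then have "((\<lambda>_. 0) has_real_derivative \<eta>' n t) (at t)"
      using that \<eta>s by (intro has_field_derivative_transform_within_open[OF \<eta>d[of n t]]) auto
    then show ?thesis using DERIV_unique[OF _ DERIV_const] by blast
  qed
  have lhs: "(LBINT z. indicator ({\<sigma>..B} \<times> box l u) z * V z * \<eta>' n (fst z))
      = (LBINT t. m t * \<eta>' n t)" for n
  proof -
    obtain K where K: "\<And>t. t \<in> {\<sigma>..B} \<Longrightarrow> \<bar>\<eta>' n t\<bar> \<le> K"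
      using continuous_bounded_on_interval[OF continuous_on_subset[OF \<eta>'c subset_UNIV]] by blast
    have [measurable]: "\<eta>' n \<in> borel_measurable borel" using \<eta>'c by (rule borel_measurable_continuous_onI)
    have i: "integrable lborel (\<lambda>z. indicator ({\<sigma>..B} \<times> box l u) z * V z * \<eta>' n (fst z))"
    proof (rule Bochner_Integration.integrable_bound)
      show "integrable lborel (\<lambda>z. indicator ({\<sigma>..B} \<times> box l u) z * V z * K)"
        using ibox[OF Vi] by auto
      show "AE z in lborel. norm (indicator ({\<sigma>..B} \<times> box l u) z * V z * \<eta>' n (fst z)) \<le> norm (indicator ({\<sigma>..B} \<times> box l u) z * V z * K)"
      proof (intro AE_I2)
        fix z :: "real \<times> 'a"
        show "norm (indicator ({\<sigma>..B} \<times> box l u) z * V z * \<eta>' n (fst z)) \<le> norm (indicator ({\<sigma>..B} \<times> box l u) z * V z * K)"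
          using K[of "fst z"] by (auto simp: indicator_def abs_mult intro!: mult_left_mono)
      qed
      show "(\<lambda>z. indicator ({\<sigma>..B} \<times> box l u) z * V z * \<eta>' n (fst z)) \<in> borel_measurable lborel"
        using borel_measurable_integrable[OF ibox[OF Vi]] by measurable
    qed
    then have i': "integrable (lborel \<Otimes>\<^sub>M lborel) (\<lambda>z. indicator ({\<sigma>..B} \<times> box l u) z * V z * \<eta>' n (fst z))"
      by (simp add: lborel_prod)
    have "(LBINT z. indicator ({\<sigma>..B} \<times> box l u) z * V z * \<eta>' n (fst z))
      = (\<integral>t. \<integral>x. indicator ({\<sigma>..B} \<times> box l u) (t, x) * V (t, x) * \<eta>' n t \<partial>lborel \<partial>lborel)"
      using lborel_pair.integral_fst'[OF i'] by (simp add: lborel_prod)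
    also have "\<dots> = (LBINT t. m t * \<eta>' n t)"
    proof (rule Bochner_Integration.integral_cong[OF refl])
      fix t
      show "(LBINT x. indicator ({\<sigma>..B} \<times> box l u) (t, x) * V (t, x) * \<eta>' n t) = m t * \<eta>' n t"
        by (cases "t \<in> {\<sigma>..B}") (auto simp: indicator_times m_def \<eta>'s)
    qed
    finally show ?thesis .
  qed
  have mK: "integrable lborel (\<lambda>t. m t * \<kappa> n s t)" if s: "0 \<le> s" for s n
  proof -
    have "continuous_on {s..s+1} (\<lambda>t. m t * \<kappa> n s t)"
      unfolding m_def \<kappa>_def using s
      by (intro continuous_intros continuous_on_subset[OF cont] continuous_on_compose2[OF H(3)]) auto
    from borel_integrable_atLeastAtMost'[OF this]
    have "integrable lborel (\<lambda>t. indicator {s..s+1} t *\<^sub>R (m t * \<kappa> n s t))"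
      by (simp add: set_integrable_def)
    moreover have "(\<lambda>t. indicator {s..s+1} t *\<^sub>R (m t * \<kappa> n s t)) = (\<lambda>t. m t * \<kappa> n s t)"
    proof
      fix t
      have "\<kappa> n s t = 0" if "t \<notin> {s..s+1}"
      proof -
        have "t < s \<or> t \<ge> s + 1" using that by auto
        then have "real (Suc n) * (t - s) \<notin> {0<..<1}"
          using big[of s t n] by (auto simp: mult_less_0_iff zero_less_mult_iff)
        then have "\<beta> (real (Suc n) * (t - s)) = 0" by (rule H(8))
        then show ?thesis by (simp add: \<kappa>_def)
      qed
      then show "indicator {s..s+1} t *\<^sub>R (m t * \<kappa> n s t) = m t * \<kappa> n s t"
        by (auto simp: indicator_def)
    qed
    ultimately show ?thesis by simp
  qed
  have mlim: "(\<lambda>n. LBINT t. m t * \<kappa> n s t) \<longlonglongrightarrow> m s" if "0 \<le> s" for s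
    using approximate_identity_right[of m s \<beta>, OF _ _ that H(3) H(8)] cont \<beta>1 by (simp add: m_def[abs_def] \<kappa>_def)
  have "(\<lambda>n. (LBINT t. m t * \<kappa> n \<sigma> t)
      - (LBINT t. m t * \<kappa> n \<tau> t)) \<longlonglongrightarrow> m \<sigma> - m \<tau>"
    using \<sigma>\<tau> by (intro tendsto_diff mlim) auto
  moreover have "(LBINT t. m t * \<kappa> n \<sigma> t)
      - (LBINT t. m t * \<kappa> n \<tau> t) = (LBINT t. m t * \<eta>' n t)" for n
    using mK[of \<sigma> n] mK[of \<tau> n] \<sigma>\<tau>
    by (subst Bochner_Integration.integral_diff[symmetric]) (auto simp: \<eta>'_def right_diff_distrib)
  ultimately have l1: "(\<lambda>n. LBINT t. m t * \<eta>' n t) \<longlonglongrightarrow> m \<sigma> - m \<tau>" by simp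
  define WW where "WW z = indicator ({\<sigma>..B} \<times> box l u) z * W z" for z
  have WWi: "integrable lborel WW" using ibox[OF Wi] by (simp add: WW_def[abs_def])
  then have [measurable]: "WW \<in> borel_measurable borel" by auto
  have \<eta>lim: "(\<lambda>n. \<eta> n t) \<longlonglongrightarrow> indicator {\<sigma><..\<tau>} t" for t
  proof (rule tendsto_eventually)
    have ev: "eventually (\<lambda>n. 1 \<le> real (Suc n) * d) sequentially" if "d > 0" for d
    proof -
      obtain N :: nat where N: "1 / d \<le> real N" using real_arch_simple by blast
      show ?thesis
        using eventually_ge_at_top[of N]
      proof eventually_elim
        case (elim n)
        then have "1 / d \<le> real (Suc n)" using N by linarith
        then show ?case using that by (simp add: field_simps)
      qed
    qed
    consider "t \<le> \<sigma>" | "\<sigma> < t" "t \<le> \<tau>" | "\<tau> < t" by linarith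
    then show "eventually (\<lambda>n. \<eta> n t = indicator {\<sigma><..\<tau>} t) sequentially"
    proof cases
      case 1
      then have "\<eta> n t = 0" for n
        using H(4)[of "real (Suc n) * (t - \<sigma>)"] H(4)[of "real (Suc n) * (t - \<tau>)"] \<sigma>\<tau> by (simp add: \<eta>_def mult_le_0_iff)
      then show ?thesis using 1 by simp
    next
      case 2
      then have "0 < t - \<sigma>" by simp
      from ev[OF this] show ?thesis
        by eventually_elim (use 2 H(4) H(5) in \<open>simp add: \<eta>_def mult_le_0_iff del: of_nat_Suc\<close>)
    next
      case 3
      then have "0 < t - \<sigma>" "0 < t - \<tau>" using \<sigma>\<tau> by auto
      from ev[OF this(1)] ev[OF this(2)] show ?thesis
        by eventually_elim (use 3 H(5) in \<open>simp add: \<eta>_def del: of_nat_Suc\<close>)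
    qed
  qed
  have "(\<lambda>n. LBINT z. WW z * \<eta> n (fst z)) \<longlonglongrightarrow> (LBINT z. WW z * indicator {\<sigma><..\<tau>} (fst z))"
  proof (rule integral_dominated_convergence[where w="\<lambda>z. \<bar>WW z\<bar>"])
    show "AE z in lborel. norm (WW z * \<eta> n (fst z)) \<le> \<bar>WW z\<bar>" for n
    proof (intro AE_I2)
      fix z :: "real \<times> 'a"
      have "\<bar>\<eta> n (fst z)\<bar> \<le> 1"
        unfolding \<eta>_def using H(6)[of "real (Suc n) * (fst z - \<sigma>)"] H(6)[of "real (Suc n) * (fst z - \<tau>)"] by linarith
      then show "norm (WW z * \<eta> n (fst z)) \<le> \<bar>WW z\<bar>" by (simp add: abs_mult mult_left_le)
    qed
    show "AE z in lborel. (\<lambda>n. WW z * \<eta> n (fst z)) \<longlonglongrightarrow> WW z * indicator {\<sigma><..\<tau>} (fst z)"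
      by (intro AE_I2 tendsto_intros \<eta>lim)
    show "(\<lambda>z. WW z * \<eta> n (fst z)) \<in> borel_measurable lborel" for n
      unfolding \<eta>_def by measurable
  qed (use WWi in auto)
  then have l2: "(\<lambda>n. - (LBINT z. WW z * \<eta> n (fst z))) \<longlonglongrightarrow> - (LBINT z. WW z * indicator {\<sigma><..\<tau>} (fst z))"
    by (rule tendsto_minus)
  have "m \<sigma> - m \<tau> = - (LBINT z. WW z * indicator {\<sigma><..\<tau>} (fst z))"
    using l1 l2 eq lhs by (simp add: WW_def LIMSEQ_unique)
  also have "(LBINT z. WW z * indicator {\<sigma><..\<tau>} (fst z)) = (LBINT z. indicator ({\<sigma>..\<tau>} \<times> box l u) z * W z)"
  proof (rule integral_cong_AE)
    have "AE z in lborel \<Otimes>\<^sub>M lborel. fst (z :: real \<times> 'a) \<noteq> \<sigma>"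
    proof (rule lborel_pair.AE_pair_measure)
      have "{z \<in> space (lborel \<Otimes>\<^sub>M lborel). fst (z :: real \<times> 'a) \<noteq> \<sigma>} = (UNIV - {\<sigma>}) \<times> UNIV"
        by (auto simp: space_pair_measure)
      then show "{z \<in> space (lborel \<Otimes>\<^sub>M lborel). fst (z :: real \<times> 'a) \<noteq> \<sigma>} \<in> sets (lborel \<Otimes>\<^sub>M lborel)"
        by simp
      show "AE t in lborel. AE x in lborel. fst (t, x :: 'a) \<noteq> \<sigma>"
        using AE_lborel_singleton[of \<sigma>] by eventually_elim simp
    qed
    then have "AE z in lborel. fst (z :: real \<times> 'a) \<noteq> \<sigma>" unfolding lborel_prod .
    then show "AE z in lborel. WW z * indicator {\<sigma><..\<tau>} (fst z) = indicator ({\<sigma>..\<tau>} \<times> box l u) z * W z"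
      by eventually_elim (use \<sigma>\<tau> in \<open>auto simp: WW_def indicator_def B_def\<close>)
    have "(\<lambda>z. WW z * indicator {\<sigma>..\<tau>} (fst z)) \<in> borel_measurable lborel" by measurable
    also have "(\<lambda>z. WW z * indicator {\<sigma>..\<tau>} (fst z)) = (\<lambda>z. indicator ({\<sigma>..\<tau>} \<times> box l u) z * W z)"
      using \<sigma>\<tau> by (auto simp: WW_def indicator_def B_def fun_eq_iff)
    finally show "(\<lambda>z. indicator ({\<sigma>..\<tau>} \<times> box l u) z * W z) \<in> borel_measurable lborel" .
  qed measurable
  finally show ?thesis by (simp add: m_def)
qed

text \<open>The fundamental theorem of calculus in time, at almost every point of the domain.\<close>

lemma (in time_derivative) weak_derivative_AE_increment:
  assumes op: "open \<Omega>"
    and Vs: "\<And>t. 0 \<le> t \<Longrightarrow> integrable lborel (\<lambda>x. indicator \<Omega> x * V (t, x))"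
    and cont: "\<And>l u. cbox l u \<subseteq> \<Omega> \<Longrightarrow> continuous_on {0..} (\<lambda>t. LBINT x. indicator (box l u) x * V (t, x))"
    and \<sigma>\<tau>: "0 < \<sigma>" "\<sigma> < \<tau>"
  shows "AE x in lborel. x \<in> \<Omega> \<longrightarrow> V (\<tau>, x) - V (\<sigma>, x) = (LBINT r. indicator {\<sigma>..\<tau>} r * W (r, x))"
proof -
  have [measurable]: "\<Omega> \<in> sets borel" using op by auto
  define I where "I x = (LBINT r. indicator {\<sigma>..\<tau>} r * W (r, x))" for x
  have sub_int: "integrable lborel (\<lambda>z. indicator ({\<sigma>..\<tau>} \<times> S) z * W z)" if [measurable]: "S \<in> sets borel" and "S \<subseteq> \<Omega>" for S
    using \<sigma>\<tau> that(2) by (intro integrable_indicator_subset[OF Wi[of \<tau>]]) (auto simp: borel_prod[symmetric])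
  have fub: "integrable lborel (\<lambda>x. indicator S x * I x)"
    "(LBINT x. indicator S x * I x) = (LBINT z. indicator ({\<sigma>..\<tau>} \<times> S) z * W z)"
    if S: "S \<in> sets borel" "S \<subseteq> \<Omega>" for S
  proof -
    have i: "integrable (lborel \<Otimes>\<^sub>M lborel) (case_prod (\<lambda>r x. indicator ({\<sigma>..\<tau>} \<times> S) (r, x) * W (r, x)))"
      using sub_int[OF S] by (simp add: lborel_prod case_prod_beta')
    have e: "(LBINT r. indicator ({\<sigma>..\<tau>} \<times> S) (r, x) * W (r, x)) = indicator S x * I x" for x
      by (cases "x \<in> S") (auto simp: I_def indicator_times)
    show "integrable lborel (\<lambda>x. indicator S x * I x)"
      using lborel_pair.integrable_snd[OF i] by (simp add: e)
    show "(LBINT x. indicator S x * I x) = (LBINT z. indicator ({\<sigma>..\<tau>} \<times> S) z * W z)"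
      using lborel_pair.integral_snd[OF i] by (simp add: e lborel_prod case_prod_beta')
  qed
  define D where "D x = V (\<tau>, x) - V (\<sigma>, x) - I x" for x
  have iD: "integrable lborel (\<lambda>x. indicator \<Omega> x * D x)"
    using Vs[of \<tau>] Vs[of \<sigma>] fub(1)[of \<Omega>] \<sigma>\<tau> by (auto simp: D_def right_diff_distrib)
  have "AE x in lborel. x \<in> \<Omega> \<longrightarrow> D x = 0"
  proof (rule AE_zero_if_box_integrals_zero[OF op iD])
    fix l u assume sub: "cbox l u \<subseteq> \<Omega>"
    then have bs: "box l u \<subseteq> \<Omega>" using box_subset_cbox by blast
    have Vb: "integrable lborel (\<lambda>x. indicator (box l u) x * V (t, x))" if "0 \<le> t" for t
      by (rule integrable_indicator_subset[OF Vs[OF that] _ bs]) simp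
    have "(LBINT x. indicator (box l u) x * D x) =
      (LBINT x. indicator (box l u) x * V (\<tau>, x)) - (LBINT x. indicator (box l u) x * V (\<sigma>, x))
      - (LBINT x. indicator (box l u) x * I x)"
      using Vb[of \<tau>] Vb[of \<sigma>] fub(1)[OF _ bs] \<sigma>\<tau> by (simp add: D_def right_diff_distrib)
    also have "\<dots> = 0"
      using weak_derivative_box_increment[OF cont[OF sub] \<sigma>\<tau> sub] fub(2)[OF _ bs] by simp
    finally show "(LBINT x. indicator (box l u) x * D x) = 0" .
  qed
  then show ?thesis by eventually_elim (auto simp: D_def I_def)
qed

section \<open>Energy and mass along the flow\<close>

lemma nn_integral_lborel_pair:
  fixes f :: "'a::euclidean_space \<times> 'b::euclidean_space \<Rightarrow> ennreal"
  assumes "f \<in> borel_measurable borel"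
  shows "(\<integral>\<^sup>+z. f z \<partial>lborel) = (\<integral>\<^sup>+x. \<integral>\<^sup>+y. f (x, y) \<partial>lborel \<partial>lborel)"
  using lborel.nn_integral_fst[of f lborel] assms by (simp add: lborel_prod)

text \<open>
  What the argument uses of a weak solution. The curve is \<open>V (t, \<cdot>)\<close>, its velocity is \<open>W (t, \<cdot>)\<close>,
  and \<open>\<mu>\<close> is the measure on pairs of points that defines the seminorm. The good times G form a set
  of full measure on which the solution is bounded in the Sobolev space and the equation may be
  tested with the values of the solution at all good times.
\<close>

locale energy_flow =
  fixes p M :: real and V W :: "real \<times> 'a::euclidean_space \<Rightarrow> real"
    and \<mu> :: "('a \<times> 'a) measure" and G :: "real set"
  assumes p: "1 < p"
    and V_meas [measurable]: "V \<in> borel_measurable borel"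
    and W_meas [measurable]: "W \<in> borel_measurable borel"
    and sets_\<mu> [simp, measurable_cong]: "sets \<mu> = sets borel"
    and sigma_finite_\<mu>: "sigma_finite_measure \<mu>"
    and AE_\<mu>: "\<And>P. AE z in lborel \<Otimes>\<^sub>M lborel. P z \<Longrightarrow> AE z in \<mu>. P z"
    and V_Lp: "\<And>t. 0 \<le> t \<Longrightarrow> p_integrable p lborel (\<lambda>x. V (t, x))"
    and V_cont: "\<And>t u. 0 \<le> t \<Longrightarrow> (\<And>n. 0 \<le> u n) \<Longrightarrow> u \<longlonglongrightarrow> t \<Longrightarrow>
        (\<lambda>n. LBINT x. \<bar>V (u n, x) - V (t, x)\<bar> powr p) \<longlonglongrightarrow> 0"
    and W_Lp: "p_integrable p lborel W"
    and W_int: "\<And>T. integrable lborel (\<lambda>z. indicator ({0..T} \<times> UNIV) z * W z)"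
    and increment_pos: "\<And>\<sigma> \<tau>. 0 < \<sigma> \<Longrightarrow> \<sigma> < \<tau> \<Longrightarrow>
        AE x in lborel. V (\<tau>, x) - V (\<sigma>, x) = (LBINT r. indicator {\<sigma>..\<tau>} r * W (r, x))"
    and good_AE: "AE t in lborel. 0 \<le> t \<longrightarrow> t \<in> G"
    and good_nonneg: "\<And>t. t \<in> G \<Longrightarrow> 0 \<le> t"
    and good_energy: "\<And>t. t \<in> G \<Longrightarrow> p_integrable p \<mu> (\<lambda>z. V (t, fst z) - V (t, snd z))"
      "\<And>t. t \<in> G \<Longrightarrow> (\<integral>z. \<bar>V (t, fst z) - V (t, snd z)\<bar> powr p \<partial>\<mu>) \<le> M"
    and good_norm: "\<And>t. t \<in> G \<Longrightarrow> (LBINT x. \<bar>V (t, x)\<bar> powr p) \<le> M"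
    and good_W: "\<And>t. t \<in> G \<Longrightarrow> p_integrable p lborel (\<lambda>x. W (t, x))"
    and good_eq: "\<And>\<tau> \<sigma>. \<tau> \<in> G \<Longrightarrow> \<sigma> \<in> G \<Longrightarrow>
        (LBINT x. Jp p (W (\<tau>, x)) * V (\<sigma>, x)) +
        (\<integral>z. Jp p (V (\<tau>, fst z) - V (\<tau>, snd z)) * (V (\<sigma>, fst z) - V (\<sigma>, snd z)) \<partial>\<mu>) = 0"
begin

text \<open>The increments of the curve over pairs of points.\<close>

definition dV :: "real \<Rightarrow> 'a \<times> 'a \<Rightarrow> real" where
  "dV t z = V (t, fst z) - V (t, snd z)"

text \<open>The p-th power of the seminorm.\<close>

definition energy :: "real \<Rightarrow> real" where
  "energy t = (\<integral>z. \<bar>dV t z\<bar> powr p \<partial>\<mu>)"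

text \<open>The p-th power of the Lp norm.\<close>

definition mass :: "real \<Rightarrow> real" where
  "mass t = (LBINT x. \<bar>V (t, x)\<bar> powr p)"

text \<open>The p-th power of the Lp norm of the velocity.\<close>

definition dissipation :: "real \<Rightarrow> real" where
  "dissipation t = (LBINT x. \<bar>W (t, x)\<bar> powr p)"

text \<open>Formally, the derivative of the mass divided by p.\<close>

definition mass_rate :: "real \<Rightarrow> real" where
  "mass_rate t = (LBINT x. Jp p (V (t, x)) * W (t, x))"

lemma dV_measurable [measurable]: "dV t \<in> borel_measurable borel"
  unfolding dV_def by measurable

lemma energy_nonneg: "0 \<le> energy t" and mass_nonneg: "0 \<le> mass t" and dissipation_nonneg: "0 \<le> dissipation t"
  by (simp_all add: energy_def mass_def dissipation_def)

text \<open>Continuity in Lp gives, along subsequences of times, convergence almost everywhere.\<close>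

lemma AE_subsequence:
  assumes "0 \<le> t" "\<And>n. 0 \<le> u n" "u \<longlonglongrightarrow> t"
  obtains r :: "nat \<Rightarrow> nat" where "strict_mono r" "AE x in lborel. (\<lambda>n. V (u (r n), x)) \<longlonglongrightarrow> V (t, x)"
    "AE z in \<mu>. (\<lambda>n. dV (u (r n)) z) \<longlonglongrightarrow> dV t z"
proof -
  have i: "integrable lborel (\<lambda>x. \<bar>V (u n, x) - V (t, x)\<bar> powr p)" for n
    using p_integrable_diff[OF p V_Lp[OF assms(2)] V_Lp[OF assms(1)]] by (simp add: p_integrable_def)
  have "(\<lambda>n. LBINT x. norm (\<bar>V (u n, x) - V (t, x)\<bar> powr p)) \<longlonglongrightarrow> 0"
    using V_cont[OF assms] by simp
  from tendsto_L1_AE_subseq[OF i this]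
  obtain r where r: "strict_mono r" and ae: "AE x in lborel. (\<lambda>n. \<bar>V (u (r n), x) - V (t, x)\<bar> powr p) \<longlonglongrightarrow> 0"
    by auto
  have lim: "AE x in lborel. (\<lambda>n. V (u (r n), x)) \<longlonglongrightarrow> V (t, x)"
    using ae
  proof eventually_elim
    case (elim x)
    have "(\<lambda>n. (\<bar>V (u (r n), x) - V (t, x)\<bar> powr p) powr (1 / p)) \<longlonglongrightarrow> 0 powr (1 / p)"
      using p by (intro tendsto_powr2 elim tendsto_const) auto
    then have "(\<lambda>n. \<bar>V (u (r n), x) - V (t, x)\<bar>) \<longlonglongrightarrow> 0"
      using p by (simp add: powr_powr)
    then show ?case by (simp add: tendsto_rabs_zero_iff LIM_zero_iff)
  qed
  define P where "P x \<longleftrightarrow> (\<lambda>n. V (u (r n), x)) \<longlonglongrightarrow> V (t, x)" for x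
  have [measurable]: "Measurable.pred borel P" unfolding P_def by measurable
  have "AE z in lborel \<Otimes>\<^sub>M lborel. P (fst z) \<and> P (snd z)"
  proof (rule lborel_pair.AE_pair_measure)
    have "AE x in lborel. P x" using lim by (simp add: P_def)
    then show "AE x in lborel. AE y in lborel. P (fst (x, y)) \<and> P (snd (x, y))"
    proof eventually_elim
      case (elim x)
      show ?case using \<open>AE x in lborel. P x\<close> elim by simp
    qed
  qed measurable
  then have "AE z in \<mu>. P (fst z) \<and> P (snd z)" by (rule AE_\<mu>)
  then have "AE z in \<mu>. (\<lambda>n. dV (u (r n)) z) \<longlonglongrightarrow> dV t z"
    by eventually_elim (auto simp: dV_def P_def intro: tendsto_diff)
  with r lim show ?thesis by (rule that)
qed

lemma good_dense:
  assumes "0 \<le> t"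
  obtains u where "\<And>n. u n \<in> G" "u \<longlonglongrightarrow> t"
proof -
  have "\<exists>s. s \<in> G \<and> t < s \<and> s < t + 1 / real (Suc n)" for n
  proof (rule ccontr)
    assume *: "\<not> ?thesis"
    have ae: "AE s in lborel. s \<notin> {t<..<t + 1 / real (Suc n)}"
      using good_AE by eventually_elim (use * assms in auto)
    have "{s \<in> space lborel. \<not> s \<notin> {t<..<t + 1 / real (Suc n)}} = {t<..<t + 1 / real (Suc n)}"
      by auto
    from AE_iff_measurable[OF _ this] ae have "emeasure lborel {t<..<t + 1 / real (Suc n)} = 0"
      by simp
    then show False by simp
  qed
  then have "\<forall>n. \<exists>s. s \<in> G \<and> t < s \<and> s < t + 1 / real (Suc n)" ..
  then obtain u where u: "\<And>n. u n \<in> G \<and> t < u n \<and> u n < t + 1 / real (Suc n)"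
    by (auto simp only: choice_iff)
  have "u \<longlonglongrightarrow> t"
  proof (rule tendsto_sandwich[of "\<lambda>_. t" u _ "\<lambda>n. t + 1 / real (Suc n)"])
    have "(\<lambda>n. t + 1 / real (Suc n)) \<longlonglongrightarrow> t + 0"
      by (intro tendsto_intros LIMSEQ_Suc[OF lim_1_over_n])
    then show "(\<lambda>n. t + 1 / real (Suc n)) \<longlonglongrightarrow> t" by simp
  qed (use u in \<open>auto intro!: always_eventually less_imp_le\<close>)
  then show ?thesis using u that by blast
qed

text \<open>
  Regularity and the equation extend from good test times to every test time t, by approximating t
  with good times and passing to weak limits. Membership of the value at t in the closure of the
  test functions is not needed for this.
\<close>

lemma all_times:
  assumes t: "0 \<le> t"
  shows dV_Lp: "p_integrable p \<mu> (dV t)" and energy_le: "energy t \<le> M" and mass_le: "mass t \<le> M"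
    and tested_all: "\<And>\<tau>. \<tau> \<in> G \<Longrightarrow> (LBINT x. Jp p (W (\<tau>, x)) * V (t, x)) + (\<integral>z. Jp p (dV \<tau> z) * dV t z \<partial>\<mu>) = 0"
proof -
  obtain u where u: "\<And>n. u n \<in> G" "u \<longlonglongrightarrow> t" using good_dense[OF t] by metis
  obtain r where r: "strict_mono r" and l1: "AE x in lborel. (\<lambda>n. V (u (r n), x)) \<longlonglongrightarrow> V (t, x)"
    and l2: "AE z in \<mu>. (\<lambda>n. dV (u (r n)) z) \<longlonglongrightarrow> dV t z"
    using AE_subsequence[OF t good_nonneg[OF u(1)] u(2)] by blast
  have p0: "0 < p" using p by simp
  have g: "p_integrable p \<mu> (dV s)" "(\<integral>z. \<bar>dV s z\<bar> powr p \<partial>\<mu>) \<le> M" if "s \<in> G" for s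
    using good_energy[OF that] by (simp_all add: dV_def[abs_def])
  have [measurable]: "dV t \<in> borel_measurable \<mu>" by simp
  note * = p_integrable_AE_lim[OF this g(1)[OF u(1)] p0 l2 g(2)[OF u(1)]]
  show "p_integrable p \<mu> (dV t)" "energy t \<le> M" using * by (simp_all add: energy_def)
  have Vt: "(\<lambda>x. V (t, x)) \<in> borel_measurable lborel" by measurable
  show "mass t \<le> M"
    unfolding mass_def
    by (rule p_integrable_AE_lim(2)[OF Vt V_Lp[OF good_nonneg[OF u(1)]] p0 l1 good_norm[OF u(1)]])
  fix \<tau> assume \<tau>: "\<tau> \<in> G"
  have "(\<lambda>n. (LBINT x. Jp p (W (\<tau>, x)) * V (u (r n), x)) + (\<integral>z. Jp p (dV \<tau> z) * dV (u (r n)) z \<partial>\<mu>))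
    \<longlonglongrightarrow> (LBINT x. Jp p (W (\<tau>, x)) * V (t, x)) + (\<integral>z. Jp p (dV \<tau> z) * dV t z \<partial>\<mu>)"
    by (intro tendsto_add integral_Jp_tendsto_bounded[OF p good_W[OF \<tau>] Vt V_Lp[OF good_nonneg[OF u(1)]] l1 good_norm[OF u(1)]]
        integral_Jp_tendsto_bounded[OF p g(1)[OF \<tau>] _ g(1)[OF u(1)] l2 g(2)[OF u(1)]]) simp
  moreover have "(LBINT x. Jp p (W (\<tau>, x)) * V (u (r n), x)) + (\<integral>z. Jp p (dV \<tau> z) * dV (u (r n)) z \<partial>\<mu>) = 0" for n
    unfolding dV_def by (rule good_eq[OF \<tau> u(1)])
  ultimately show "(LBINT x. Jp p (W (\<tau>, x)) * V (t, x)) + (\<integral>z. Jp p (dV \<tau> z) * dV t z \<partial>\<mu>) = 0"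
    by (simp add: LIMSEQ_const_iff)
qed

lemma lower_semicontinuous:
  assumes b: "0 \<le> b" and e: "0 < e"
  shows "\<exists>d>0. \<forall>t\<ge>0. \<bar>t - b\<bar> \<le> d \<longrightarrow> energy b - e \<le> energy t"
    and "\<exists>d>0. \<forall>t\<ge>0. \<bar>t - b\<bar> \<le> d \<longrightarrow> mass b - e \<le> mass t"
proof -
  have p0: "0 < p" using p by simp
  have lsc: "\<exists>d>0. \<forall>t\<ge>0. \<bar>t - b\<bar> \<le> d \<longrightarrow> f b - e \<le> f t"
    if closed: "\<And>u K. (\<And>n. 0 \<le> u n) \<Longrightarrow> u \<longlonglongrightarrow> b \<Longrightarrow> (\<And>n. f (u n) \<le> K) \<Longrightarrow> f b \<le> K" for f :: "real \<Rightarrow> real"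
  proof (rule ccontr)
    assume *: "\<not> ?thesis"
    have "\<forall>n. \<exists>t\<ge>0. \<bar>t - b\<bar> \<le> 1 / real (Suc n) \<and> f t \<le> f b - e"
    proof
      fix n
      have "0 < 1 / real (Suc n)" by simp
      then show "\<exists>t\<ge>0. \<bar>t - b\<bar> \<le> 1 / real (Suc n) \<and> f t \<le> f b - e" using * linear by blast
    qed
    then obtain u where u: "\<And>n. u n \<ge> 0 \<and> \<bar>u n - b\<bar> \<le> 1 / real (Suc n) \<and> f (u n) \<le> f b - e" by metis
    have "(\<lambda>n. u n - b) \<longlonglongrightarrow> 0"
      by (rule Lim_null_comparison[OF _ LIMSEQ_Suc[OF lim_1_over_n]]) (use u in \<open>auto intro!: always_eventually\<close>)
    then have "f b \<le> f b - e" using u by (intro closed) (auto simp: LIM_zero_iff)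
    then show False using e by simp
  qed
  show "\<exists>d>0. \<forall>t\<ge>0. \<bar>t - b\<bar> \<le> d \<longrightarrow> energy b - e \<le> energy t"
  proof (rule lsc)
    fix u K assume u: "\<And>n. 0 \<le> u n" "u \<longlonglongrightarrow> b" "\<And>n. energy (u n) \<le> K"
    obtain r where "AE z in \<mu>. (\<lambda>n. dV (u (r n)) z) \<longlonglongrightarrow> dV b z"
      using AE_subsequence[OF b u(1,2)] by blast
    from p_integrable_AE_lim(2)[OF _ dV_Lp[OF u(1)] p0 this u(3)[unfolded energy_def]]
    show "energy b \<le> K" by (simp add: energy_def)
  qed
  show "\<exists>d>0. \<forall>t\<ge>0. \<bar>t - b\<bar> \<le> d \<longrightarrow> mass b - e \<le> mass t"
  proof (rule lsc)
    fix u K assume u: "\<And>n. 0 \<le> u n" "u \<longlonglongrightarrow> b" "\<And>n. mass (u n) \<le> K"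
    obtain r where "AE x in lborel. (\<lambda>n. V (u (r n), x)) \<longlonglongrightarrow> V (b, x)"
      using AE_subsequence[OF b u(1,2)] by blast
    from p_integrable_AE_lim(2)[OF _ V_Lp[OF u(1)] p0 this u(3)[unfolded mass_def]]
    show "mass b \<le> K" by (simp add: mass_def)
  qed
qed

lemma energy_measurable: "(\<lambda>t. indicator {0..} t * energy t) \<in> borel_measurable borel"
proof -
  interpret sigma_finite_measure \<mu> by (rule sigma_finite_\<mu>)
  have [measurable]: "(\<lambda>(t, z). dV t z) \<in> borel_measurable (borel \<Otimes>\<^sub>M \<mu>)"
    unfolding dV_def by measurable
  show ?thesis unfolding energy_def by measurable
qed

lemma mass_measurable: "(\<lambda>t. indicator {0..} t * mass t) \<in> borel_measurable borel"
  unfolding mass_def by measurable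

lemma increment:
  assumes "0 \<le> \<sigma>" "\<sigma> \<le> \<tau>"
  shows "AE x in lborel. V (\<tau>, x) - V (\<sigma>, x) = (LBINT r. indicator {\<sigma>..\<tau>} r * W (r, x))"
proof -
  consider "\<sigma> = \<tau>" | "0 < \<sigma>" "\<sigma> < \<tau>" | "\<sigma> = 0" "0 < \<tau>" using assms by fastforce
  then show ?thesis
  proof cases
    case 1
    have "(LBINT r. indicator {\<sigma>..\<tau>} r * W (r, x)) = (\<integral>r. 0 \<partial>(lborel :: real measure))" for x
    proof (rule integral_cong_AE)
      show "AE r in lborel. indicator {\<sigma>..\<tau>} r * W (r, x) = 0"
        using AE_lborel_singleton[of \<tau>] by eventually_elim (use 1 in \<open>auto simp: indicator_def\<close>)
    qed measurable
    then show ?thesis using 1 by simp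
  next
    case 2
    then show ?thesis by (rule increment_pos)
  next
    case 3
    define u where "u n = \<tau> * (1 / real (Suc (Suc n)))" for n
    have u: "0 < u n" "u n < \<tau>" for n using 3 by (auto simp: u_def field_simps intro: add_pos_nonneg)
    have "(\<lambda>n. \<tau> * (1 / real (Suc (Suc n)))) \<longlonglongrightarrow> \<tau> * 0"
      by (intro tendsto_intros LIMSEQ_Suc[OF LIMSEQ_Suc[OF lim_1_over_n]])
    then have ul: "u \<longlonglongrightarrow> 0" by (simp add: u_def[abs_def])
    obtain r where r: "strict_mono r" and l: "AE x in lborel. (\<lambda>n. V (u (r n), x)) \<longlonglongrightarrow> V (0, x)"
      using AE_subsequence[OF _ less_imp_le[OF u(1)] ul] by auto
    have inc: "AE x in lborel. \<forall>n. V (\<tau>, x) - V (u (r n), x) = (LBINT s. indicator {u (r n)..\<tau>} s * W (s, x))"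
      unfolding AE_all_countable using increment_pos[OF u] by blast
    have "integrable (lborel \<Otimes>\<^sub>M lborel) (case_prod (\<lambda>s x. indicator ({0..\<tau>} \<times> UNIV) (s, x) * W (s, x)))"
      using W_int[of \<tau>] by (simp add: lborel_prod case_prod_beta')
    from lborel_pair.AE_integrable_snd[OF this]
    have "AE x in lborel. integrable lborel (\<lambda>s. indicator {0..\<tau>} s * W (s, x))"
      by (simp add: indicator_times)
    with l inc show ?thesis
    proof eventually_elim
      case (elim x)
      have ru: "(\<lambda>n. u (r n)) \<longlonglongrightarrow> 0" using LIMSEQ_subseq_LIMSEQ[OF ul r] by (simp add: o_def)
      have "(\<lambda>n. LBINT s. indicator {u (r n)..\<tau>} s * W (s, x)) \<longlonglongrightarrow> (LBINT s. indicator {0..\<tau>} s * W (s, x))"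
      proof (rule integral_dominated_convergence[where w="\<lambda>s. \<bar>indicator {0..\<tau>} s * W (s, x)\<bar>"])
        show "AE s in lborel. (\<lambda>n. indicator {u (r n)..\<tau>} s * W (s, x)) \<longlonglongrightarrow> indicator {0..\<tau>} s * W (s, x)"
          using AE_lborel_singleton[of 0]
        proof eventually_elim
          case (elim s)
          show ?case
          proof (cases "0 < s")
            case True
            then have "eventually (\<lambda>n. u (r n) < s) sequentially" using ru by (intro order_tendstoD(2))
            then have "eventually (\<lambda>n. indicator {u (r n)..\<tau>} s * W (s, x) = indicator {0..\<tau>} s * W (s, x)) sequentially"
              by eventually_elim (use True in \<open>auto simp: indicator_def\<close>)
            then show ?thesis by (rule tendsto_eventually)
          next
            case False
            then have "indicator {u (r n)..\<tau>} s = (0::real)" "indicator {0..\<tau>} s = (0::real)" for n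
              using u(1)[of "r n"] elim by (auto simp: indicator_def)
            then show ?thesis by simp
          qed
        qed
        show "AE s in lborel. norm (indicator {u (r n)..\<tau>} s * W (s, x)) \<le> \<bar>indicator {0..\<tau>} s * W (s, x)\<bar>" for n
          using u(1)[of "r n"] by (auto simp: indicator_def)
      qed (use elim in auto)
      moreover have "(\<lambda>n. V (\<tau>, x) - V (u (r n), x)) \<longlonglongrightarrow> V (\<tau>, x) - V (0, x)"
        using elim by (intro tendsto_intros) auto
      moreover have "V (\<tau>, x) - V (u (r n), x) = (LBINT s. indicator {u (r n)..\<tau>} s * W (s, x))" for n
        using elim by blast
      ultimately show ?case unfolding 3 by (simp add: LIMSEQ_unique)
    qed
  qed
qed

text \<open>Testing the equation with increments and using convexity of the energy.\<close>

lemma energy_convex: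
  assumes \<tau>: "\<tau> \<in> G" and c: "0 \<le> c" "c \<le> \<tau>"
  shows "p * (LBINT x. Jp p (W (\<tau>, x)) * (LBINT r. indicator {c..\<tau>} r * W (r, x))) \<le> energy c - energy \<tau>"
proof -
  note t0 = good_nonneg[OF \<tau>]
  note d = dV_Lp[OF t0] dV_Lp[OF c(1)]
  note i = integrable_Jp_mult[OF p good_W[OF \<tau>] V_Lp[OF t0]] integrable_Jp_mult[OF p good_W[OF \<tau>] V_Lp[OF c(1)]]
    integrable_Jp_mult[OF p d(1) d(2)] integrable_Jp_mult[OF p d(1) d(1)]
  have "(LBINT x. Jp p (W (\<tau>, x)) * (LBINT r. indicator {c..\<tau>} r * W (r, x)))
      = (LBINT x. Jp p (W (\<tau>, x)) * (V (\<tau>, x) - V (c, x)))"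
  proof (rule integral_cong_AE)
    show "AE x in lborel. Jp p (W (\<tau>, x)) * (LBINT r. indicator {c..\<tau>} r * W (r, x)) = Jp p (W (\<tau>, x)) * (V (\<tau>, x) - V (c, x))"
      using increment[OF c] by eventually_elim simp
  qed measurable
  also have "\<dots> = (LBINT x. Jp p (W (\<tau>, x)) * V (\<tau>, x)) - (LBINT x. Jp p (W (\<tau>, x)) * V (c, x))"
    using i by (simp add: right_diff_distrib)
  also have "\<dots> = (\<integral>z. Jp p (dV \<tau> z) * dV c z \<partial>\<mu>) - (\<integral>z. Jp p (dV \<tau> z) * dV \<tau> z \<partial>\<mu>)"
    using tested_all[OF t0 \<tau>] tested_all[OF c(1) \<tau>] by simp
  also have "\<dots> = (\<integral>z. Jp p (dV \<tau> z) * (dV c z - dV \<tau> z) \<partial>\<mu>)"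
    using i by (simp add: right_diff_distrib)
  finally show ?thesis
    using integral_powr_convex[OF p d] by (simp add: energy_def)
qed

lemma dissipation_integrable: "integrable lborel dissipation"
proof -
  have i: "integrable (lborel \<Otimes>\<^sub>M lborel) (\<lambda>z. \<bar>W z\<bar> powr p)"
    using p_integrable_powr[OF W_Lp] by (simp add: lborel_prod)
  show "integrable lborel dissipation"
    using lborel_pair.integrable_fst'[OF i] by (simp add: dissipation_def[abs_def])
qed

lemma W_cut:
  assumes "0 \<le> c"
  shows "integrable lborel (\<lambda>z. indicator ({c..b} \<times> UNIV) z * W z)"
    and "p_integrable p lborel (\<lambda>z. indicator ({c..b} \<times> UNIV) z * W z)"
    and "p_integrable p lborel (\<lambda>z. indicator ({c<..<b} \<times> UNIV) z * W z)"
proof -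
  show "integrable lborel (\<lambda>z. indicator ({c..b} \<times> UNIV) z * W z)"
    using assms by (intro integrable_indicator_subset[OF W_int[of b]]) (auto simp: borel_prod[symmetric])
qed (auto intro!: p_integrable_indicator W_Lp simp: borel_prod[symmetric])

lemma V_cut:
  assumes "0 \<le> c"
  shows "p_integrable p lborel (\<lambda>z. indicator ({c<..<b} \<times> UNIV) z * V z)"
proof (rule p_integrableI_nn)
  have m [measurable]: "indicat_real ({c<..<b} \<times> (UNIV :: 'a set)) \<in> borel_measurable borel"
    by (auto simp: borel_prod[symmetric])
  show "(\<lambda>z. indicator ({c<..<b} \<times> UNIV) z * V z) \<in> borel_measurable lborel"
    by simp
  have "(\<integral>\<^sup>+z. ennreal (\<bar>indicator ({c<..<b} \<times> UNIV) z * V z\<bar> powr p) \<partial>lborel)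
     = (\<integral>\<^sup>+t. \<integral>\<^sup>+x. ennreal (\<bar>indicator ({c<..<b} \<times> UNIV) (t, x) * V (t, x)\<bar> powr p) \<partial>lborel \<partial>lborel)"
    by (subst nn_integral_lborel_pair) auto
  also have "\<dots> \<le> (\<integral>\<^sup>+t. ennreal M * indicator {c<..<b} t \<partial>lborel)"
  proof (rule nn_integral_mono)
    fix t
    show "(\<integral>\<^sup>+x. ennreal (\<bar>indicator ({c<..<b} \<times> UNIV) (t, x) * V (t, x)\<bar> powr p) \<partial>lborel) \<le> ennreal M * indicator {c<..<b} t"
    proof (cases "t \<in> {c<..<b}")
      case True
      then show ?thesis
        using assms p_integrable_nn[OF V_Lp[of t]] mass_le[of t] by (simp add: mass_def ennreal_leI)
    next
      case False
      then have "ennreal (\<bar>indicator ({c<..<b} \<times> UNIV) (t, x) * V (t, x)\<bar> powr p) = 0" for x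
        by (auto simp: indicator_def)
      then show ?thesis by (simp only: nn_integral_const) simp
    qed
  qed
  also have "\<dots> < \<infinity>"
    by (cases "c \<le> b") (auto simp: nn_integral_cmult ennreal_mult_less_top)
  finally show "(\<integral>\<^sup>+z. ennreal (\<bar>indicator ({c<..<b} \<times> UNIV) z * V z\<bar> powr p) \<partial>lborel) < \<infinity>" .
qed

text \<open>The energy inequality, between any two times.\<close>

lemma energy_dissipation:
  assumes c: "0 \<le> c" and cb: "c < b"
  shows "p * (LBINT t. indicator {c<..<b} t * dissipation t) \<le> energy c - energy b"
proof -
  define W1 where "W1 z = indicator ({c..b} \<times> UNIV) z * W z" for z
  define G1 where "G1 z = indicator ({c<..<b} \<times> UNIV) z * W z" for z
  have W1: "integrable lborel W1" "p_integrable p lborel W1" and G1: "p_integrable p lborel G1"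
    using W_cut[OF c, of b] by (simp_all add: W1_def[abs_def] G1_def[abs_def])
  define F where "F t = indicator {0..} t * energy t" for t
  have "p * (LBINT z. Jp p (G1 z) * W1 z) \<le> F c - F b"
  proof (rule integrated_decrease[OF p cb W1 G1])
    show "W1 (r, x) = 0" if "r < c" for r x using that by (simp add: W1_def)
    show "G1 (r, x) = 0" if "r \<notin> {c<..<b}" for r x using that by (auto simp: G1_def indicator_def)
    show "F \<in> borel_measurable borel" unfolding F_def by (rule energy_measurable)
    show "\<bar>F t\<bar> \<le> M" if "t \<in> {c..b}" for t
      using that c energy_le[of t] energy_nonneg[of t] by (simp add: F_def)
    show "\<exists>d>0. \<forall>t\<in>{c..b}. b - d \<le> t \<longrightarrow> F b - e \<le> F t" if e: "0 < e" for e
    proof -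
      obtain d where d: "d > 0" "\<forall>t\<ge>0. \<bar>t - b\<bar> \<le> d \<longrightarrow> energy b - e \<le> energy t"
        using lower_semicontinuous(1)[OF _ e, of b] c cb by auto
      show ?thesis
        by (rule exI[of _ d]) (use d c cb in \<open>auto simp: F_def\<close>)
    qed
    show "AE \<tau> in lborel. \<tau> \<in> {c<..<b} \<longrightarrow> (\<forall>\<sigma>\<in>{c..\<tau>}.
        p * (LBINT x. Jp p (G1 (\<tau>, x)) * (LBINT r. indicator {\<sigma>..\<tau>} r * W1 (r, x))) \<le> F \<sigma> - F \<tau>)"
      using good_AE
    proof eventually_elim
      case (elim \<tau>)
      show ?case
      proof (intro impI ballI)
        fix \<sigma> assume \<tau>: "\<tau> \<in> {c<..<b}" and \<sigma>: "\<sigma> \<in> {c..\<tau>}"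
        have e1: "(LBINT r. indicator {\<sigma>..\<tau>} r * W1 (r, x)) = (LBINT r. indicator {\<sigma>..\<tau>} r * W (r, x))" for x
          using \<tau> \<sigma> by (intro Bochner_Integration.integral_cong) (auto simp: W1_def indicator_def)
        have e2: "G1 (\<tau>, x) = W (\<tau>, x)" for x using \<tau> by (simp add: G1_def indicator_def)
        have "p * (LBINT x. Jp p (W (\<tau>, x)) * (LBINT r. indicator {\<sigma>..\<tau>} r * W (r, x))) \<le> energy \<sigma> - energy \<tau>"
          using elim \<tau> \<sigma> c by (intro energy_convex) auto
        then show "p * (LBINT x. Jp p (G1 (\<tau>, x)) * (LBINT r. indicator {\<sigma>..\<tau>} r * W1 (r, x))) \<le> F \<sigma> - F \<tau>"
          unfolding e1 e2 using \<tau> \<sigma> c by (simp add: F_def)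
      qed
    qed
  qed
  moreover have "(LBINT z. Jp p (G1 z) * W1 z) = (LBINT t. indicator {c<..<b} t * dissipation t)"
  proof -
    have i: "integrable (lborel \<Otimes>\<^sub>M lborel) (\<lambda>z. Jp p (G1 z) * W1 z)"
      unfolding lborel_prod by (rule integrable_Jp_mult[OF p G1 W1(2)])
    have "(LBINT z. Jp p (G1 z) * W1 z) = (\<integral>t. \<integral>x. Jp p (G1 (t, x)) * W1 (t, x) \<partial>lborel \<partial>lborel)"
      using lborel_pair.integral_fst'[OF i] by (simp add: lborel_prod)
    also have "\<dots> = (LBINT t. indicator {c<..<b} t * dissipation t)"
    proof (rule Bochner_Integration.integral_cong[OF refl])
      fix t
      show "(LBINT x. Jp p (G1 (t, x)) * W1 (t, x)) = indicator {c<..<b} t * dissipation t"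
        by (cases "t \<in> {c<..<b}") (auto simp: G1_def W1_def indicator_times dissipation_def Jp_self)
    qed
    finally show ?thesis .
  qed
  ultimately show ?thesis using c cb by (simp add: F_def)
qed

lemma mass_rate_integrable:
  assumes "0 \<le> c"
  shows "integrable lborel (\<lambda>t. indicator {c<..<b} t * mass_rate t)"
proof -
  have i: "integrable (lborel \<Otimes>\<^sub>M lborel) (\<lambda>z. Jp p (indicator ({c<..<b} \<times> UNIV) z * V z) * (indicator ({c..b} \<times> UNIV) z * W z))"
    unfolding lborel_prod by (rule integrable_Jp_mult[OF p V_cut[OF assms] W_cut(2)[OF assms]])
  have "(LBINT x. Jp p (indicator ({c<..<b} \<times> (UNIV :: 'a set)) (t, x) * V (t, x)) * (indicator ({c..b} \<times> (UNIV :: 'a set)) (t, x) * W (t, x))) = indicator {c<..<b} t * mass_rate t" for t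
    using assms by (cases "t \<in> {c<..<b}") (auto simp: indicator_times mass_rate_def)
  then show ?thesis using lborel_pair.integrable_fst'[OF i] by simp
qed

text \<open>
  The companion inequality for the mass. Convexity of the mass gives subgradient inequalities in the
  opposite direction of time, so \<open>integrated_decrease\<close> is applied after the reflection R of time.
\<close>

lemma mass_increase:
  assumes c: "0 \<le> c" and cb: "c < b"
  shows "p * (LBINT t. indicator {c<..<b} t * mass_rate t) \<le> mass b - mass c"
proof -
  define R where "R z = (- fst z, snd z)" for z :: "real \<times> 'a"
  have [measurable]: "R \<in> borel_measurable borel" unfolding R_def by measurable
  have refl_nn: "(\<integral>\<^sup>+z. ennreal (f (R z)) \<partial>lborel) = (\<integral>\<^sup>+z. ennreal (f z) \<partial>lborel)"
    if [measurable]: "f \<in> borel_measurable borel" for f :: "real \<times> 'a \<Rightarrow> real"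
  proof -
    have "(\<integral>\<^sup>+z. ennreal (f (R z)) \<partial>lborel) = (\<integral>\<^sup>+t. \<integral>\<^sup>+x. ennreal (f (- t, x)) \<partial>lborel \<partial>lborel)"
      by (subst nn_integral_lborel_pair) (auto simp: R_def)
    also have "\<dots> = (\<integral>\<^sup>+t. \<integral>\<^sup>+x. ennreal (f (t, x)) \<partial>lborel \<partial>lborel)"
      using nn_integral_real_affine[of "\<lambda>t. \<integral>\<^sup>+x. ennreal (f (t, x)) \<partial>lborel" "-1" 0] by simp
    also have "\<dots> = (\<integral>\<^sup>+z. ennreal (f z) \<partial>lborel)"
      by (subst nn_integral_lborel_pair) auto
    finally show ?thesis .
  qed
  have refl_i: "integrable lborel (\<lambda>z. f (R z))" if f: "integrable lborel f" for f :: "real \<times> 'a \<Rightarrow> real"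
  proof -
    have [measurable]: "f \<in> borel_measurable borel" using f by auto
    show ?thesis using f refl_nn[of "\<lambda>z. norm (f z)"] by (simp add: integrable_iff_bounded)
  qed
  have refl_p: "p_integrable p lborel (\<lambda>z. f (R z))" if "p_integrable p lborel f" for f :: "real \<times> 'a \<Rightarrow> real"
    using that refl_i[of "\<lambda>z. \<bar>f z\<bar> powr p"] by (auto simp: p_integrable_def)
  define W1 where "W1 z = indicator ({c..b} \<times> UNIV) z * W z" for z
  define G1 where "G1 z = indicator ({c<..<b} \<times> UNIV) z * V z" for z
  have W1: "integrable lborel W1" "p_integrable p lborel W1" and G1: "p_integrable p lborel G1"
    using W_cut[OF c, of b] V_cut[OF c, of b] by (simp_all add: W1_def[abs_def] G1_def[abs_def])
  define F where "F t = indicator {0..} (-t) * mass (-t)" for t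
  have "p * (LBINT z. Jp p (G1 (R z)) * W1 (R z)) \<le> F (-b) - F (-c)"
  proof (rule integrated_decrease[where F = F and c = "- b" and b = "- c", OF p _ refl_i[OF W1(1)] refl_p[OF W1(2)] refl_p[OF G1]])
    show "- b < - c" using cb by simp
    show "W1 (R (r, x)) = 0" if "r < - b" for r x using that by (simp add: W1_def R_def)
    show "G1 (R (r, x)) = 0" if "r \<notin> {-b<..<-c}" for r x using that by (auto simp: G1_def R_def indicator_def)
    show "F \<in> borel_measurable borel"
      unfolding F_def using measurable_compose[OF borel_measurable_uminus[OF measurable_ident] mass_measurable] by simp
    show "\<bar>F t\<bar> \<le> M" if "t \<in> {-b..-c}" for t
      using that c mass_le[of "-t"] mass_nonneg[of "-t"] by (simp add: F_def)
    show "\<exists>d>0. \<forall>t\<in>{-b..-c}. - c - d \<le> t \<longrightarrow> F (-c) - e \<le> F t" if e: "0 < e" for e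
    proof -
      obtain d where d: "d > 0" "\<forall>t\<ge>0. \<bar>t - c\<bar> \<le> d \<longrightarrow> mass c - e \<le> mass t"
        using lower_semicontinuous(2)[OF c e] by blast
      show ?thesis
        by (rule exI[of _ d]) (use d c in \<open>auto simp: F_def\<close>)
    qed
    show "AE \<tau> in lborel. \<tau> \<in> {-b<..<-c} \<longrightarrow> (\<forall>\<sigma>\<in>{-b..\<tau>}.
        p * (LBINT x. Jp p (G1 (R (\<tau>, x))) * (LBINT r. indicator {\<sigma>..\<tau>} r * W1 (R (r, x)))) \<le> F \<sigma> - F \<tau>)"
    proof (intro AE_I2 impI ballI)
      fix \<tau> \<sigma> assume \<tau>: "\<tau> \<in> {-b<..<-c}" and \<sigma>: "\<sigma> \<in> {-b..\<tau>}"
      have t: "0 \<le> -\<tau>" "-\<tau> \<le> -\<sigma>" "0 \<le> -\<sigma>" using \<tau> \<sigma> c by auto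
      have e1: "(LBINT r. indicator {\<sigma>..\<tau>} r * W1 (R (r, x))) = (LBINT r. indicator {-\<tau>..-\<sigma>} r * W (r, x))" for x
      proof -
        have "(LBINT r. indicator {\<sigma>..\<tau>} r * W1 (R (r, x))) = (LBINT r. indicator {-\<tau>..-\<sigma>} (0 + (-1) * r) * W (0 + (-1) * r, x))"
          using \<tau> \<sigma> by (intro Bochner_Integration.integral_cong) (auto simp: W1_def R_def indicator_def)
        also have "\<dots> = (LBINT r. indicator {-\<tau>..-\<sigma>} r * W (r, x))"
          using lborel_integral_real_affine[of "-1" "\<lambda>r. indicator {-\<tau>..-\<sigma>} r * W (r, x)" 0] by simp
        finally show ?thesis .
      qed
      have e2: "G1 (R (\<tau>, x)) = V (-\<tau>, x)" for x using \<tau> c by (simp add: G1_def R_def indicator_def)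
      have "(LBINT x. Jp p (V (-\<tau>, x)) * (LBINT r. indicator {-\<tau>..-\<sigma>} r * W (r, x)))
          = (LBINT x. Jp p (V (-\<tau>, x)) * (V (-\<sigma>, x) - V (-\<tau>, x)))"
      proof (rule integral_cong_AE)
        show "AE x in lborel. Jp p (V (-\<tau>, x)) * (LBINT r. indicator {-\<tau>..-\<sigma>} r * W (r, x)) = Jp p (V (-\<tau>, x)) * (V (-\<sigma>, x) - V (-\<tau>, x))"
          using increment[OF t(1,2)] by eventually_elim simp
      qed measurable
      moreover have "mass (-\<tau>) + p * (LBINT x. Jp p (V (-\<tau>, x)) * (V (-\<sigma>, x) - V (-\<tau>, x))) \<le> mass (-\<sigma>)"
        unfolding mass_def by (rule integral_powr_convex[OF p V_Lp[OF t(1)] V_Lp[OF t(3)]])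
      ultimately show "p * (LBINT x. Jp p (G1 (R (\<tau>, x))) * (LBINT r. indicator {\<sigma>..\<tau>} r * W1 (R (r, x)))) \<le> F \<sigma> - F \<tau>"
        unfolding e1 e2 using t by (simp add: F_def)
    qed
  qed
  moreover have "(LBINT z. Jp p (G1 (R z)) * W1 (R z)) = (LBINT t. indicator {c<..<b} t * mass_rate t)"
  proof -
    have i: "integrable (lborel \<Otimes>\<^sub>M lborel) (\<lambda>z. Jp p (G1 (R z)) * W1 (R z))"
      unfolding lborel_prod by (rule integrable_Jp_mult[OF p refl_p[OF G1] refl_p[OF W1(2)]])
    have "(LBINT z. Jp p (G1 (R z)) * W1 (R z)) = (\<integral>t. \<integral>x. Jp p (G1 (R (t, x))) * W1 (R (t, x)) \<partial>lborel \<partial>lborel)"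
      using lborel_pair.integral_fst'[OF i] by (simp add: lborel_prod)
    also have "\<dots> = (LBINT t. indicator {c<..<b} (0 + (-1) * t) * mass_rate (0 + (-1) * t))"
    proof (rule Bochner_Integration.integral_cong[OF refl])
      fix t
      show "(LBINT x. Jp p (G1 (R (t, x))) * W1 (R (t, x))) = indicator {c<..<b} (0 + (-1) * t) * mass_rate (0 + (-1) * t)"
        using c by (cases "- t \<in> {c<..<b}") (auto simp: G1_def W1_def R_def indicator_times mass_rate_def)
    qed
    also have "\<dots> = (LBINT t. indicator {c<..<b} t * mass_rate t)"
      using lborel_integral_real_affine[of "-1" "\<lambda>t. indicator {c<..<b} t * mass_rate t" 0] by simp
    finally show ?thesis .
  qed
  ultimately show ?thesis using c cb by (simp add: F_def)
qed

lemma energy_antimono: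
  assumes "0 \<le> c" "c \<le> b" shows "energy b \<le> energy c"
proof (cases "c = b")
  case False
  have "0 \<le> (LBINT t. indicator {c<..<b} t * dissipation t)"
    by (simp add: dissipation_nonneg)
  then have "0 \<le> p * (LBINT t. indicator {c<..<b} t * dissipation t)" using p by simp
  with energy_dissipation[of c b] show ?thesis using assms False by simp
qed simp

text \<open>
  If the Rayleigh quotient exceeds l, then energy minus l times mass does not increase at that
  time. With \<open>l = \<theta> powr (p - 1)\<close>, the hypothesis says that \<open>- \<integral> Jp p W * V\<close> exceeds
  \<open>\<theta> powr (p - 1)\<close> times the mass of V. Young's inequality for W and \<open>- \<theta> V\<close> turns this
  into a bound of the mass of \<open>\<theta> V\<close> by that of W, and Young's inequality for \<open>\<theta> V\<close> and
  \<open>- W\<close> then gives the claim.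
\<close>

lemma rate_nonneg:
  assumes \<tau>: "\<tau> \<in> G" and l: "0 \<le> l" and above: "l * mass \<tau> < energy \<tau>"
  shows "0 \<le> dissipation \<tau> + l * mass_rate \<tau>"
proof -
  define \<theta> where "\<theta> = l powr (1 / (p - 1))"
  have \<theta>: "0 \<le> \<theta>" "\<theta> powr (p - 1) = l"
    using p l by (simp_all add: \<theta>_def powr_powr)
  have \<theta>p: "\<theta> powr p = \<theta> * l" using powr_pred_mult[OF \<theta>(1), of p] \<theta>(2) by (simp add: mult.commute)
  note t0 = good_nonneg[OF \<tau>]
  note Vp = V_Lp[OF t0] and Wp = good_W[OF \<tau>]
  have energy: "energy \<tau> = - (LBINT x. Jp p (W (\<tau>, x)) * V (\<tau>, x))"
    using tested_all[OF t0 \<tau>] by (simp add: energy_def Jp_self)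
  have "dissipation \<tau> + p * (LBINT x. Jp p (W (\<tau>, x)) * (- \<theta> * V (\<tau>, x) - W (\<tau>, x)))
      \<le> (LBINT x. \<bar>- \<theta> * V (\<tau>, x)\<bar> powr p)"
    unfolding dissipation_def by (rule integral_powr_convex[OF p Wp p_integrable_cmult[OF Vp]])
  also have "\<dots> = \<theta> * l * mass \<tau>"
    using \<theta>(1) by (simp add: abs_mult powr_mult \<theta>p mass_def)
  also have "(LBINT x. Jp p (W (\<tau>, x)) * (- \<theta> * V (\<tau>, x) - W (\<tau>, x)))
      = (LBINT x. - \<theta> * (Jp p (W (\<tau>, x)) * V (\<tau>, x)) - Jp p (W (\<tau>, x)) * W (\<tau>, x))"
    by (intro Bochner_Integration.integral_cong) (auto simp: algebra_simps)
  also have "\<dots> = \<theta> * energy \<tau> - dissipation \<tau>"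
    using integrable_Jp_mult[OF p Wp Vp] integrable_Jp_mult[OF p Wp Wp]
    by (simp add: energy dissipation_def Jp_self)
  finally have 1: "dissipation \<tau> + p * (\<theta> * energy \<tau> - dissipation \<tau>) \<le> \<theta> * l * mass \<tau>" .
  have "\<theta> * (l * mass \<tau>) \<le> \<theta> * energy \<tau>" using above \<theta>(1) by (intro mult_left_mono) auto
  then have "p * (\<theta> * (l * mass \<tau>)) \<le> p * (\<theta> * energy \<tau>)"
    by (rule mult_left_mono) (use p in simp)
  with 1 have "(p - 1) * (\<theta> * l * mass \<tau>) \<le> (p - 1) * dissipation \<tau>"
    by (simp add: algebra_simps)
  then have 2: "\<theta> * l * mass \<tau> \<le> dissipation \<tau>" using p by simp
  have "(LBINT x. \<bar>\<theta> * V (\<tau>, x)\<bar> powr p) + p * (LBINT x. Jp p (\<theta> * V (\<tau>, x)) * ((-1) * W (\<tau>, x) - \<theta> * V (\<tau>, x)))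
      \<le> (LBINT x. \<bar>(-1) * W (\<tau>, x)\<bar> powr p)"
    by (rule integral_powr_convex[OF p p_integrable_cmult[OF Vp] p_integrable_cmult[OF Wp]])
  moreover have "(LBINT x. \<bar>\<theta> * V (\<tau>, x)\<bar> powr p) = \<theta> * l * mass \<tau>"
    using \<theta>(1) by (simp add: abs_mult powr_mult \<theta>p mass_def)
  moreover have "(LBINT x. Jp p (\<theta> * V (\<tau>, x)) * ((-1) * W (\<tau>, x) - \<theta> * V (\<tau>, x)))
      = (LBINT x. - l * (Jp p (V (\<tau>, x)) * W (\<tau>, x)) - \<theta> * l * (Jp p (V (\<tau>, x)) * V (\<tau>, x)))"
    by (intro Bochner_Integration.integral_cong) (auto simp: Jp_scale \<theta> algebra_simps)
  moreover have "\<dots> = - l * mass_rate \<tau> - \<theta> * l * mass \<tau>"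
    using integrable_Jp_mult[OF p Vp Wp] integrable_Jp_mult[OF p Vp Vp]
    by (simp add: mass_rate_def mass_def Jp_self)
  ultimately have "\<theta> * l * mass \<tau> + p * (- l * mass_rate \<tau> - \<theta> * l * mass \<tau>) \<le> dissipation \<tau>"
    by (simp add: dissipation_def)
  moreover have "(p - 1) * (\<theta> * l * mass \<tau>) \<le> (p - 1) * dissipation \<tau>"
    using 2 p by (intro mult_left_mono) auto
  ultimately have "0 \<le> p * (dissipation \<tau> + l * mass_rate \<tau>)" by (simp add: algebra_simps)
  then show ?thesis using p by (simp add: zero_le_mult_iff)
qed

lemma excess_decreasing:
  assumes c: "0 \<le> c" "c < b" and l: "0 \<le> l" and above: "\<And>t. c < t \<Longrightarrow> t < b \<Longrightarrow> l * mass t < energy t"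
  shows "energy b - l * mass b \<le> energy c - l * mass c"
proof -
  have i: "integrable lborel (\<lambda>t. indicator {c<..<b} t * dissipation t)"
    using integrable_mult_indicator[OF _ dissipation_integrable, of "{c<..<b}"] by simp
  have "0 \<le> (LBINT t. indicator {c<..<b} t * dissipation t + l * (indicator {c<..<b} t * mass_rate t))"
  proof (rule integral_nonneg_AE)
    show "AE t in lborel. 0 \<le> indicator {c<..<b} t * dissipation t + l * (indicator {c<..<b} t * mass_rate t)"
      using good_AE
    proof eventually_elim
      case (elim t)
      show ?case
      proof (cases "t \<in> {c<..<b}")
        case True
        then have "0 \<le> dissipation t + l * mass_rate t"
          using elim c by (intro rate_nonneg l above) auto
        then show ?thesis using True by simp
      qed simp
    qed
  qed
  also have "\<dots> = (LBINT t. indicator {c<..<b} t * dissipation t) + l * (LBINT t. indicator {c<..<b} t * mass_rate t)"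
    using i mass_rate_integrable[OF c(1), of b] by simp
  finally have "0 \<le> p * ((LBINT t. indicator {c<..<b} t * dissipation t) + l * (LBINT t. indicator {c<..<b} t * mass_rate t))"
    using p by simp
  also have "\<dots> = p * (LBINT t. indicator {c<..<b} t * dissipation t) + l * (p * (LBINT t. indicator {c<..<b} t * mass_rate t))"
    by (simp add: algebra_simps)
  also have "\<dots> \<le> (energy c - energy b) + l * (mass b - mass c)"
    using energy_dissipation[OF c] mass_increase[OF c] l by (intro add_mono mult_left_mono)
  finally show ?thesis by (simp add: algebra_simps)
qed

text \<open>The mass cannot drop much in a short time, uniformly in the times near a.\<close>

lemma mass_drop_small:
  assumes a: "0 \<le> a" and e: "0 < e"
  shows "\<exists>d>0. \<forall>s t. 0 \<le> s \<longrightarrow> a - d < s \<longrightarrow> s < t \<longrightarrow> t < a + d \<longrightarrow> mass s - mass t \<le> e"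
proof -
  define h where "h n = 1 / real (Suc n)" for n
  have h: "0 < h n" "h n \<le> 1" "h \<longlonglongrightarrow> 0" for n
    using LIMSEQ_Suc[OF lim_1_over_n] by (simp_all add: h_def[abs_def])
  define f where "f n t = indicator {max 0 (a - h n)<..<a + h n} t * \<bar>mass_rate t\<bar>" for n t
  define g where "g t = indicator {0<..<a + 1} t * \<bar>mass_rate t\<bar>" for t
  have [measurable]: "mass_rate \<in> borel_measurable borel" unfolding mass_rate_def by measurable
  have gi: "integrable lborel g"
    using integrable_abs[OF mass_rate_integrable[of 0 "a + 1"]] by (simp add: g_def[abs_def] abs_mult)
  have "(\<lambda>n. LBINT t. f n t) \<longlonglongrightarrow> (\<integral>t. 0 \<partial>(lborel :: real measure))"
  proof (rule integral_dominated_convergence[where w=g])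
    show "AE t in lborel. (\<lambda>n. f n t) \<longlonglongrightarrow> 0"
      using AE_lborel_singleton[of a]
    proof eventually_elim
      case (elim t)
      have "eventually (\<lambda>n. h n < \<bar>t - a\<bar>) sequentially"
        using elim by (intro order_tendstoD(2)[OF h(3)]) auto
      then have "eventually (\<lambda>n. f n t = 0) sequentially"
        by eventually_elim (auto simp: f_def indicator_def abs_if split: if_splits)
      then show ?case by (rule tendsto_eventually)
    qed
    show "AE t in lborel. norm (f n t) \<le> g t" for n
    proof (intro AE_I2)
      fix t
      show "norm (f n t) \<le> g t" using h(2)[of n] by (auto simp: f_def g_def indicator_def)
    qed
  qed (use gi in \<open>auto simp: f_def\<close>)
  then have "eventually (\<lambda>n. (LBINT t. f n t) < e / p) sequentially"
    using e p by (intro order_tendstoD(2)[where y = "\<integral>t. 0 \<partial>(lborel :: real measure)"]) auto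
  then obtain n where n: "(LBINT t. f n t) < e / p" by (auto simp: eventually_sequentially)
  show ?thesis
  proof (intro exI[of _ "h n"] conjI allI impI)
    fix s t assume st: "0 \<le> s" "a - h n < s" "s < t" "t < a + h n"
    have fi: "integrable lborel (f n)"
    proof (rule Bochner_Integration.integrable_bound[OF gi])
      show "AE t in lborel. norm (f n t) \<le> norm (g t)"
      proof (intro AE_I2)
        fix t
        show "norm (f n t) \<le> norm (g t)" using h(2)[of n] by (auto simp: f_def g_def indicator_def)
      qed
    qed (simp add: f_def[abs_def])
    have "- (LBINT r. indicator {s<..<t} r * mass_rate r) \<le> (LBINT r. f n r)"
      using mass_rate_integrable[OF st(1), of t] fi st
      by (subst Bochner_Integration.integral_minus[symmetric], intro integral_mono)
         (auto simp: f_def indicator_def)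
    then have "- (LBINT r. indicator {s<..<t} r * mass_rate r) \<le> e / p" using n by simp
    then have "- (p * (LBINT r. indicator {s<..<t} r * mass_rate r)) \<le> e"
      using p by (simp add: field_simps)
    then show "mass s - mass t \<le> e" using mass_increase[OF st(1,3)] by simp
  qed (rule h(1))
qed

text \<open>
  A sublevel of the Rayleigh quotient is never left. Otherwise let \<open>t0\<close> be the supremum of the
  times before b at which the quotient is at most l. After \<open>t0\<close> the excess energy does not
  increase, and at \<open>t0\<close> it cannot jump up, because the energy is nonincreasing and the mass cannot
  drop abruptly.
\<close>

lemma sublevel_invariant:
  assumes a: "0 \<le> a" and l: "0 \<le> l" and start: "energy a \<le> l * mass a" and ab: "a \<le> b"
  shows "energy b \<le> l * mass b"
proof (rule ccontr)
  assume nb: "\<not> ?thesis"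
  define S where "S = {t \<in> {a..b}. energy t \<le> l * mass t}"
  have S: "a \<in> S" "bdd_above S" using start ab by (auto simp: S_def bdd_above_def)
  define t0 where "t0 = Sup S"
  have "a \<le> t0" unfolding t0_def by (rule cSup_upper[OF S])
  moreover have "t0 \<le> b" unfolding t0_def by (rule cSup_least) (use S(1) in \<open>auto simp: S_def\<close>)
  ultimately have t0: "a \<le> t0" "t0 \<le> b" .
  have above: "l * mass t < energy t" if "t0 < t" "t \<le> b" for t
  proof (rule ccontr)
    assume "\<not> ?thesis"
    then have "t \<in> S" using that t0 by (simp add: S_def)
    from cSup_upper[OF this S(2)] that(1) show False by (simp add: t0_def)
  qed
  define \<delta> where "\<delta> = energy b - l * mass b"
  have \<delta>: "\<delta> > 0" using nb by (simp add: \<delta>_def)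
  \<comment> \<open>The mass may drop by e without l times the drop making up for the excess \<open>\<delta>\<close>.\<close>
  define e where "e = \<delta> / (2 * (l + 1))"
  have e: "e > 0" using \<delta> l by (simp add: e_def)
  have le: "l * e < \<delta>"
  proof -
    have "l * e = \<delta> * (l / (2 * (l + 1)))" by (simp add: e_def)
    also have "\<dots> < \<delta> * 1" using l \<delta> by (intro mult_strict_left_mono) auto
    finally show ?thesis by simp
  qed
  obtain d where d: "d > 0" and small: "\<And>s t. 0 \<le> s \<Longrightarrow> t0 - d < s \<Longrightarrow> s < t \<Longrightarrow> t < t0 + d \<Longrightarrow> mass s - mass t \<le> e"
    using mass_drop_small[OF _ e, of t0] a t0 by auto
  obtain s where s: "s \<in> S" "t0 - d < s" using less_cSupD[of S "t0 - d"] S d by (auto simp: t0_def)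
  have st0: "s \<le> t0" using cSup_upper[OF s(1) S(2)] by (simp add: t0_def)
  have s0: "0 \<le> s" using s(1) a by (auto simp: S_def)
  have "s \<noteq> b" using s(1) nb by (auto simp: S_def)
  show False
  proof (cases "t0 = b")
    case True
    then have "s < b" using st0 \<open>s \<noteq> b\<close> by simp
    have "energy b \<le> energy s" using energy_antimono[OF s0] \<open>s < b\<close> by simp
    also have "\<dots> \<le> l * mass s" using s(1) by (simp add: S_def)
    also have "\<dots> \<le> l * (mass b + e)"
      using small[OF s0 s(2) \<open>s < b\<close>] True d l by (intro mult_left_mono) auto
    finally show False using le by (simp add: \<delta>_def algebra_simps)
  next
    case False
    then have t0b: "t0 < b" using t0 by simp
    define c where "c = min ((t0 + b) / 2) (t0 + d / 2)"
    have c: "t0 < c" "c < b" "c < t0 + d" using t0b d by (auto simp: c_def min_def field_simps)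
    have "energy b - l * mass b \<le> energy c - l * mass c"
      using c st0 s0 by (intro excess_decreasing l above) auto
    also have "energy c \<le> energy s" using energy_antimono[OF s0, of c] c st0 by simp
    also have "\<dots> \<le> l * mass s" using s(1) by (simp add: S_def)
    also have "l * mass s - l * mass c = l * (mass s - mass c)" by (simp add: algebra_simps)
    also have "\<dots> \<le> l * e" using small[OF s0 s(2), of c] c st0 l by (intro mult_left_mono) auto
    finally show False using le by (simp add: \<delta>_def)
  qed
qed

end

section \<open>Weak solutions\<close>

text \<open>
  The measure on pairs of points for which the Gagliardo seminorm of u is the Lp norm of
  \<open>u (fst z) - u (snd z)\<close>. On the diagonal the density is zero, by the convention for division.
\<close>

definition gagliardo :: "real \<Rightarrow> real \<Rightarrow> ('a::euclidean_space \<times> 'a) measure" where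
  "gagliardo s p = density lborel (\<lambda>z. ennreal (1 / norm (fst z - snd z) powr (real DIM('a) + s * p)))"

lemma sets_gagliardo [simp, measurable_cong]: "sets (gagliardo s p) = sets borel"
  by (simp add: gagliardo_def)

lemma gagliardo_density_measurable [measurable]:
  "(\<lambda>z :: 'a::euclidean_space \<times> 'a. 1 / norm (fst z - snd z) powr q) \<in> borel_measurable borel"
  by measurable

lemma sigma_finite_gagliardo: "sigma_finite_measure (gagliardo s p)"
  unfolding gagliardo_def by (subst sigma_finite_measure.sigma_finite_iff_density_finite[OF sigma_finite_lborel]) auto

lemma AE_gagliardo: "AE z in lborel \<Otimes>\<^sub>M lborel. P z \<Longrightarrow> AE z in gagliardo s p. P z"
  unfolding gagliardo_def lborel_prod by (subst AE_density) auto

lemma Wsp_semi_pow_gagliardo: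
  fixes u :: "'a::euclidean_space \<Rightarrow> real"
  assumes [measurable]: "u \<in> borel_measurable borel"
  shows "Wsp_semi_pow s p u = (\<integral>\<^sup>+z. ennreal (\<bar>u (fst z) - u (snd z)\<bar> powr p) \<partial>gagliardo s p)"
proof -
  have "(\<integral>\<^sup>+z. ennreal (\<bar>u (fst z) - u (snd z)\<bar> powr p) \<partial>gagliardo s p)
    = (\<integral>\<^sup>+z. ennreal (1 / norm (fst z - snd z) powr (real DIM('a) + s * p)) * ennreal (\<bar>u (fst z) - u (snd z)\<bar> powr p) \<partial>lborel)"
    unfolding gagliardo_def by (rule nn_integral_density) measurable
  also have "\<dots> = Wsp_semi_pow s p u"
    unfolding Wsp_semi_pow_def lborel_prod
    by (intro nn_integral_cong) (auto simp: ennreal_mult[symmetric] split: prod.split)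
  finally show ?thesis by simp
qed

lemma Wsp_p_integrable:
  assumes u: "u \<in> borel_measurable borel" and fin: "Wsp_norm_pow s p u < \<infinity>"
  shows "p_integrable p lborel u" "p_integrable p (gagliardo s p) (\<lambda>z. u (fst z) - u (snd z))"
proof -
  note [measurable] = u
  show "p_integrable p lborel u"
    using fin by (intro p_integrableI_nn) (auto simp: Wsp_norm_pow_def Lp_pow_def)
  show "p_integrable p (gagliardo s p) (\<lambda>z. u (fst z) - u (snd z))"
    using fin by (intro p_integrableI_nn) (auto simp: Wsp_norm_pow_def Wsp_semi_pow_gagliardo[OF u, symmetric])
qed

lemma Wsp_norm_tendsto_zero:
  assumes u: "\<And>n. u n \<in> borel_measurable borel" and fin: "\<And>n. Wsp_norm_pow s p (u n) < \<infinity>"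
    and lim: "(\<lambda>n. Wsp_norm_pow s p (u n)) \<longlonglongrightarrow> 0"
  shows "(\<lambda>n. LBINT x. \<bar>u n x\<bar> powr p) \<longlonglongrightarrow> 0"
    and "(\<lambda>n. \<integral>z. \<bar>u n (fst z) - u n (snd z)\<bar> powr p \<partial>gagliardo s p) \<longlonglongrightarrow> 0"
proof -
  note pint = Wsp_p_integrable[OF u fin]
  have "(\<lambda>n. Lp_pow p UNIV (u n)) \<longlonglongrightarrow> 0"
    by (rule tendsto_sandwich[OF _ _ tendsto_const lim]) (auto simp: Wsp_norm_pow_def)
  then have "(\<lambda>n. ennreal (LBINT x. \<bar>u n x\<bar> powr p)) \<longlonglongrightarrow> ennreal 0"
    by (simp add: Lp_pow_def p_integrable_nn[OF pint(1)])
  then show "(\<lambda>n. LBINT x. \<bar>u n x\<bar> powr p) \<longlonglongrightarrow> 0"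
    by (rule tendsto_ennrealD) auto
  have "(\<lambda>n. Wsp_semi_pow s p (u n)) \<longlonglongrightarrow> 0"
    by (rule tendsto_sandwich[OF _ _ tendsto_const lim]) (auto simp: Wsp_norm_pow_def)
  then have "(\<lambda>n. ennreal (\<integral>z. \<bar>u n (fst z) - u n (snd z)\<bar> powr p \<partial>gagliardo s p)) \<longlonglongrightarrow> ennreal 0"
    by (simp add: Wsp_semi_pow_gagliardo[OF u] p_integrable_nn[OF pint(2)])
  then show "(\<lambda>n. \<integral>z. \<bar>u n (fst z) - u n (snd z)\<bar> powr p \<partial>gagliardo s p) \<longlonglongrightarrow> 0"
    by (rule tendsto_ennrealD) auto
qed

lemma abs_le_one_plus_powr: "1 < p \<Longrightarrow> \<bar>a\<bar> \<le> 1 + \<bar>a\<bar> powr p" for a :: real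
proof (cases "\<bar>a\<bar> \<le> 1")
  case False
  assume "1 < p"
  then have "\<bar>a\<bar> powr 1 \<le> \<bar>a\<bar> powr p" using False by (intro powr_mono) auto
  then show ?thesis using False by simp
qed (simp add: add_increasing2)

lemma p_integrable_imp_integrable_on_finite:
  assumes p: "1 < p" and f: "p_integrable p M f" and A: "A \<in> sets M" "emeasure M A < \<infinity>"
  shows "integrable M (\<lambda>x. indicator A x * f x)"
proof -
  note [measurable] = p_integrable_measurable[OF f] A(1)
  have "integrable M (\<lambda>x. indicator A x + \<bar>f x\<bar> powr p)"
    using p_integrable_powr[OF f] A by (auto simp: integrable_indicator_iff)
  then show ?thesis
  proof (rule Bochner_Integration.integrable_bound)
    show "AE x in M. norm (indicator A x * f x) \<le> norm (indicator A x + \<bar>f x\<bar> powr p)"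
      using abs_le_one_plus_powr[OF p] by (intro AE_I2) (auto simp: indicator_def)
  qed measurable
qed

text \<open>
  The null set of times outside which the equation holds may depend on the test function. The values
  of the simple functions that approximate the solution in the Sobolev space form a countable set,
  so they may be used as test functions simultaneously outside one null set; passing to the limit, the
  values of the solution at all good times become admissible.
\<close>

lemma weak_solution_energy_flow:
  fixes \<Omega> :: "'a::euclidean_space set"
  assumes op: "open \<Omega>" and bd: "bounded \<Omega>" and p: "1 < p" and ws: "weak_solution s p \<Omega> g v"
  defines "V \<equiv> \<lambda>z. indicator ({0..} \<times> UNIV) z *\<^sub>R v (fst z) (snd z)"
  obtains M W G where "energy_flow p M V W (gagliardo s p) G"
proof -
  from ws have vm: "set_borel_measurable (lborel :: (real \<times> 'a) measure) ({0..} \<times> UNIV) (\<lambda>z. v (fst z) (snd z))"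
    and vL: "Linfty_Wsp0 s p \<Omega> v"
    and vLp: "\<And>t. 0 \<le> t \<Longrightarrow> v t \<in> Lp_space p \<Omega>"
    and vc: "\<And>t. 0 \<le> t \<Longrightarrow> ((\<lambda>\<tau>. Lp_pow p \<Omega> (\<lambda>x. v \<tau> x - v t x)) \<longlongrightarrow> 0) (at t within {0..})"
    and v0: "\<And>t. 0 \<le> t \<Longrightarrow> AE x in lborel. x \<notin> \<Omega> \<longrightarrow> v t x = 0"
    unfolding weak_solution_def by blast+
  from ws obtain w :: "real \<Rightarrow> 'a \<Rightarrow> real" where wk: "weak_time_derivative \<Omega> v w"
    and wLp: "(\<lambda>z. w (fst z) (snd z)) \<in> Lp_space p ({0..} \<times> \<Omega>)"
    and weq: "\<And>\<phi>. \<phi> \<in> Wsp0 s p \<Omega> \<Longrightarrow> AE t in lborel. 0 < t \<longrightarrow>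
           (LINT x:\<Omega>|lborel. Jp p (w t x) * \<phi> x) +
           (LINT z|(lborel \<Otimes>\<^sub>M lborel).
              Jp p (v t (fst z) - v t (snd z)) * (\<phi> (fst z) - \<phi> (snd z)) /
                norm (fst z - snd z) powr (real DIM('a) + s * p)) = 0"
    unfolding weak_solution_def by blast
  from vL obtain S :: "nat \<Rightarrow> real \<Rightarrow> 'a \<Rightarrow> real" and M :: real
    where Ss: "\<And>k. simple_function (restrict_space lborel {0..}) (S k)"
    and SW: "\<And>k t. 0 \<le> t \<Longrightarrow> S k t \<in> Wsp0 s p \<Omega>"
    and Sl: "AE t in lborel. 0 \<le> t \<longrightarrow> (\<lambda>k. Wsp_norm_pow s p (\<lambda>x. v t x - S k t x)) \<longlonglongrightarrow> 0"
    and vM: "AE t in lborel. 0 \<le> t \<longrightarrow> v t \<in> Wsp0 s p \<Omega> \<and> Wsp_norm_pow s p (v t) \<le> ennreal M"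
    unfolding Linfty_Wsp0_def by blast
  have Om [measurable]: "\<Omega> \<in> sets borel" using op by auto
  have "emeasure lborel \<Omega> < \<infinity>" using bd by (rule emeasure_bounded_finite)
  have cyl: "{0..T} \<times> \<Omega> \<in> sets borel" "emeasure lborel ({0..T} \<times> \<Omega>) < \<infinity>" for T :: real
  proof -
    show "{0..T} \<times> \<Omega> \<in> sets borel" by (simp add: borel_prod[symmetric])
    show "emeasure lborel ({0..T} \<times> \<Omega>) < \<infinity>" using bd by (intro emeasure_bounded_finite bounded_Times) auto
  qed
  have Vm [measurable]: "V \<in> borel_measurable borel"
    using vm by (simp add: V_def set_borel_measurable_def)
  have Vv: "V (t, x) = v t x" if "0 \<le> t" for t x using that by (simp add: V_def)
  define W where "W z = indicator ({0..} \<times> \<Omega>) z *\<^sub>R w (fst z) (snd z)" for z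
  have Wm [measurable]: "W \<in> borel_measurable borel"
    using wLp by (simp add: W_def[abs_def] Lp_space_def set_borel_measurable_def)
  have W_Lp: "p_integrable p lborel W"
  proof (rule p_integrableI_nn)
    have "(\<integral>\<^sup>+z. ennreal (\<bar>W z\<bar> powr p) \<partial>lborel) = Lp_pow p ({0..} \<times> \<Omega>) (\<lambda>z. w (fst z) (snd z))"
      unfolding Lp_pow_def by (intro nn_integral_cong) (auto simp: W_def indicator_def)
    then show "(\<integral>\<^sup>+z. ennreal (\<bar>W z\<bar> powr p) \<partial>lborel) < \<infinity>" using wLp by (simp add: Lp_space_def)
  qed simp
  have sec [measurable]: "v t \<in> borel_measurable borel" if "0 \<le> t" for t
  proof -
    have "(\<lambda>x. V (t, x)) \<in> borel_measurable borel" by measurable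
    then show ?thesis using that by (simp add: Vv)
  qed
  have nn: "(\<integral>\<^sup>+x. ennreal (\<bar>v t x - v t' x\<bar> powr p) \<partial>lborel) = Lp_pow p \<Omega> (\<lambda>x. v t x - v t' x)" if "0 \<le> t" "0 \<le> t'" for t t'
    unfolding Lp_pow_def
  proof (rule nn_integral_cong_AE)
    show "AE x in lborel. ennreal (\<bar>v t x - v t' x\<bar> powr p) = ennreal (\<bar>v t x - v t' x\<bar> powr p) * indicator \<Omega> x"
      using v0[OF that(1)] v0[OF that(2)] by eventually_elim (auto simp: indicator_def)
  qed
  have nn1: "(\<integral>\<^sup>+x. ennreal (\<bar>v t x\<bar> powr p) \<partial>lborel) = Lp_pow p \<Omega> (v t)" if "0 \<le> t" for t
    unfolding Lp_pow_def
  proof (rule nn_integral_cong_AE)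
    show "AE x in lborel. ennreal (\<bar>v t x\<bar> powr p) = ennreal (\<bar>v t x\<bar> powr p) * indicator \<Omega> x"
      using v0[OF that] by eventually_elim (auto simp: indicator_def)
  qed
  have V_Lp: "p_integrable p lborel (\<lambda>x. V (t, x))" if t: "0 \<le> t" for t
  proof (rule p_integrableI_nn)
    show "(\<integral>\<^sup>+x. ennreal (\<bar>V (t, x)\<bar> powr p) \<partial>lborel) < \<infinity>"
      using vLp[OF t] t by (simp add: Vv nn1 Lp_space_def)
  qed measurable
  have V_cont: "(\<lambda>n. LBINT x. \<bar>V (u n, x) - V (t, x)\<bar> powr p) \<longlonglongrightarrow> 0"
    if t: "0 \<le> t" and u: "\<And>n. 0 \<le> u n" "u \<longlonglongrightarrow> t" for t u
  proof -
    have z: "Lp_pow p \<Omega> (\<lambda>x. 0) = 0" by (simp add: Lp_pow_def)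
    have "continuous (at t within {0..}) (\<lambda>\<tau>. Lp_pow p \<Omega> (\<lambda>x. v \<tau> x - v t x))"
      using vc[OF t] by (simp add: continuous_within z)
    from continuous_within_tendsto_compose'[of t "{0..}" _ u sequentially, OF this _ u(2)] u(1)
    have "(\<lambda>n. Lp_pow p \<Omega> (\<lambda>x. v (u n) x - v t x)) \<longlonglongrightarrow> 0" by (simp add: z)
    then have "(\<lambda>n. ennreal (LBINT x. \<bar>V (u n, x) - V (t, x)\<bar> powr p)) \<longlonglongrightarrow> ennreal 0"
      using p_integrable_nn[OF p_integrable_diff[OF p V_Lp[OF u(1)] V_Lp[OF t]]] u(1) t
      by (simp add: Vv nn[symmetric])
    then show ?thesis by (rule tendsto_ennrealD) auto
  qed
  have Wi: "integrable lborel (\<lambda>z. indicator ({0..T} \<times> \<Omega>) z * W z)" for T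
    using p_integrable_imp_integrable_on_finite[OF p W_Lp _ cyl(2)] cyl(1) by simp
  have W_int: "integrable lborel (\<lambda>z. indicator ({0..T} \<times> UNIV) z * W z)" for T
  proof -
    have "(\<lambda>z. indicator ({0..T} \<times> UNIV) z * W z) = (\<lambda>z. indicator ({0..T} \<times> \<Omega>) z * W z)"
      by (auto simp: W_def indicator_def fun_eq_iff)
    then show ?thesis using Wi[of T] by simp
  qed
  have Vi: "integrable lborel (\<lambda>z. indicator ({0..T} \<times> \<Omega>) z * V z)" for T
  proof -
    define V' where "V' z = indicator ({0..T} \<times> \<Omega>) z * V z" for z
    have V'm: "V' \<in> borel_measurable borel" using cyl(1)[of T] unfolding V'_def by measurable
    have "(\<integral>\<^sup>+z. ennreal (\<bar>V' z\<bar> powr p) \<partial>lborel) = (\<integral>\<^sup>+t. \<integral>\<^sup>+x. ennreal (\<bar>V' (t, x)\<bar> powr p) \<partial>lborel \<partial>lborel)"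
      using V'm by (intro nn_integral_lborel_pair) measurable
    also have "\<dots> \<le> (\<integral>\<^sup>+t. ennreal M * indicator {0..T} t \<partial>lborel)"
    proof (rule nn_integral_mono_AE)
      show "AE t in lborel. (\<integral>\<^sup>+x. ennreal (\<bar>V' (t, x)\<bar> powr p) \<partial>lborel) \<le> ennreal M * indicator {0..T} t"
        using vM
      proof eventually_elim
        case (elim t)
        show ?case
        proof (cases "t \<in> {0..T}")
          case True
          have "(\<integral>\<^sup>+x. ennreal (\<bar>V' (t, x)\<bar> powr p) \<partial>lborel) \<le> (\<integral>\<^sup>+x. ennreal (\<bar>v t x\<bar> powr p) \<partial>lborel)"
            using True by (intro nn_integral_mono) (auto simp: V'_def Vv indicator_def)
          also have "\<dots> \<le> Wsp_norm_pow s p (v t)" by (simp add: Wsp_norm_pow_def Lp_pow_def)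
          also have "\<dots> \<le> ennreal M" using elim True by auto
          finally show ?thesis using True by simp
        next
          case False
          then have "ennreal (\<bar>V' (t, x)\<bar> powr p) = 0" for x by (auto simp: V'_def indicator_def)
          then show ?thesis by (simp only: nn_integral_const) simp
        qed
      qed
    qed
    also have "\<dots> < \<infinity>"
      by (cases "0 \<le> T") (auto simp: nn_integral_cmult ennreal_mult_less_top)
    finally have "p_integrable p lborel V'" using V'm by (intro p_integrableI_nn) auto
    from p_integrable_imp_integrable_on_finite[OF p this _ cyl(2)[of T]] cyl(1)[of T]
    have "integrable lborel (\<lambda>z. indicator ({0..T} \<times> \<Omega>) z * V' z)" by simp
    moreover have "(\<lambda>z. indicator ({0..T} \<times> \<Omega>) z * V' z) = (\<lambda>z. indicator ({0..T} \<times> \<Omega>) z * V z)"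
      by (auto simp: V'_def indicator_def fun_eq_iff)
    ultimately show ?thesis by simp
  qed
  have Vs: "integrable lborel (\<lambda>x. indicator \<Omega> x * V (t, x))" if "0 \<le> t" for t
    using p_integrable_imp_integrable_on_finite[OF p V_Lp[OF that]] Om \<open>emeasure lborel \<Omega> < \<infinity>\<close> by simp
  have cont: "continuous_on {0..} (\<lambda>t. LBINT x. indicator (box l u) x * V (t, x))" for l u
    unfolding continuous_on_sequentially
  proof (intro allI ballI impI, elim conjE)
    fix ts :: "nat \<Rightarrow> real" and t assume t: "t \<in> {0..}" "\<forall>n. ts n \<in> {0..}" "ts \<longlonglongrightarrow> t"
    \<comment> \<open>\<open>Jp\<close> leaves indicators unchanged, so integration over a box is a pairing of the required form.\<close>
    have J: "Jp p (indicator (box l u) x) = indicator (box l u) x" for x :: 'a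
      by (simp add: indicator_def Jp_def)
    have "p_integrable p lborel (indicator (box l u) :: 'a \<Rightarrow> real)"
    proof -
      have "\<bar>indicator (box l u) x :: real\<bar> powr p = indicator (box l u) x" for x :: 'a
        by (simp add: indicator_def)
      then show ?thesis
        using emeasure_bounded_finite[of "box l u"] by (simp add: p_integrable_def integrable_indicator_iff)
    qed
    from integral_Jp_tendsto_norm[OF p this V_Lp[of t] V_Lp V_cont[of t ts]] t
    show "((\<lambda>t. LBINT x. indicator (box l u) x * V (t, x)) \<circ> ts) \<longlonglongrightarrow> (LBINT x. indicator (box l u) x * V (t, x))"
      by (simp add: o_def J)
  qed
  have increment: "AE x in lborel. V (\<tau>, x) - V (\<sigma>, x) = (LBINT r. indicator {\<sigma>..\<tau>} r * W (r, x))"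
    if \<sigma>\<tau>: "0 < \<sigma>" "\<sigma> < \<tau>" for \<sigma> \<tau>
  proof -
    have "time_derivative \<Omega> v w V W"
      by (rule time_derivative.intro) (use wk Vv Vi Wi Vm in \<open>simp_all add: W_def\<close>)
    then have "AE x in lborel. x \<in> \<Omega> \<longrightarrow> V (\<tau>, x) - V (\<sigma>, x) = (LBINT r. indicator {\<sigma>..\<tau>} r * W (r, x))"
      by (rule time_derivative.weak_derivative_AE_increment[OF _ op Vs cont \<sigma>\<tau>])
    moreover have "AE x in lborel. x \<notin> \<Omega> \<longrightarrow> v \<tau> x = 0" "AE x in lborel. x \<notin> \<Omega> \<longrightarrow> v \<sigma> x = 0"
      using \<sigma>\<tau> by (auto intro!: v0)
    ultimately show ?thesis
    proof eventually_elim
      case (elim x)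
      show ?case
      proof (cases "x \<in> \<Omega>")
        case False
        then have "W (r, x) = 0" for r by (simp add: W_def)
        then show ?thesis using elim False \<sigma>\<tau> by (simp add: Vv)
      qed (use elim in simp)
    qed
  qed
  define \<Phi> where "\<Phi> = (\<Union>k. S k ` {0..})"
  have "finite (S k ` {0..})" for k using Ss[of k] by (simp add: simple_function_def space_restrict_space)
  then have "countable \<Phi>" unfolding \<Phi>_def by (intro countable_UN) (auto intro: countable_finite)
  have \<Phi>W: "\<Phi> \<subseteq> Wsp0 s p \<Omega>" using SW by (auto simp: \<Phi>_def)
  define EQ where "EQ t \<phi> \<longleftrightarrow> (LINT x:\<Omega>|lborel. Jp p (w t x) * \<phi> x) +
           (LINT z|(lborel \<Otimes>\<^sub>M lborel).
              Jp p (v t (fst z) - v t (snd z)) * (\<phi> (fst z) - \<phi> (snd z)) /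
                norm (fst z - snd z) powr (real DIM('a) + s * p)) = 0" for t \<phi>
  define G where "G = {t. 0 < t \<and> (\<lambda>k. Wsp_norm_pow s p (\<lambda>x. v t x - S k t x)) \<longlonglongrightarrow> 0 \<and>
      v t \<in> Wsp0 s p \<Omega> \<and> Wsp_norm_pow s p (v t) \<le> ennreal M \<and>
      p_integrable p lborel (\<lambda>x. W (t, x)) \<and> (\<forall>\<phi>\<in>\<Phi>. EQ t \<phi>)}"
  have good_AE: "AE t in lborel. 0 \<le> t \<longrightarrow> t \<in> G"
  proof -
    have "AE t in lborel. \<forall>\<phi>\<in>\<Phi>. 0 < t \<longrightarrow> EQ t \<phi>"
      using \<open>countable \<Phi>\<close> weq \<Phi>W by (subst AE_ball_countable) (auto simp: EQ_def)
    moreover have "AE t in lborel. p_integrable p lborel (\<lambda>x. W (t, x))"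
    proof -
      have i: "integrable (lborel \<Otimes>\<^sub>M lborel) (\<lambda>z. \<bar>W z\<bar> powr p)"
        using p_integrable_powr[OF W_Lp] by (simp add: lborel_prod)
      show ?thesis
        using lborel_pair.AE_integrable_fst'[OF i] by eventually_elim (auto simp: p_integrable_def)
    qed
    moreover have "AE t in lborel. t \<noteq> (0 :: real)" by (rule AE_lborel_singleton)
    ultimately show ?thesis using Sl vM
      by eventually_elim (auto simp: G_def)
  qed
  have Wsp0D: "u \<in> borel_measurable borel" "Wsp_norm_pow s p u < \<infinity>" if "u \<in> Wsp0 s p \<Omega>" for u
    using that by (auto simp: Wsp0_def Wsp_def)
  have good: "p_integrable p (gagliardo s p) (\<lambda>z. V (t, fst z) - V (t, snd z))"
      "(\<integral>z. \<bar>V (t, fst z) - V (t, snd z)\<bar> powr p \<partial>gagliardo s p) \<le> max 0 M"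
      "(LBINT x. \<bar>V (t, x)\<bar> powr p) \<le> max 0 M" if t: "t \<in> G" for t
  proof -
    have t0: "0 \<le> t" and W0: "v t \<in> Wsp0 s p \<Omega>" and le: "Wsp_norm_pow s p (v t) \<le> ennreal M"
      using t by (auto simp: G_def)
    note D = Wsp0D[OF W0]
    show 1: "p_integrable p (gagliardo s p) (\<lambda>z. V (t, fst z) - V (t, snd z))"
      using Wsp_p_integrable(2)[OF D] t0 by (simp add: Vv)
    have "ennreal (\<integral>z. \<bar>V (t, fst z) - V (t, snd z)\<bar> powr p \<partial>gagliardo s p) \<le> Wsp_norm_pow s p (v t)"
      using p_integrable_nn[OF 1] t0 by (simp add: Vv Wsp_norm_pow_def Wsp_semi_pow_gagliardo[OF D(1)])
    also have "\<dots> \<le> ennreal (max 0 M)" by (rule order_trans[OF le]) (simp add: ennreal_leI)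
    finally show "(\<integral>z. \<bar>V (t, fst z) - V (t, snd z)\<bar> powr p \<partial>gagliardo s p) \<le> max 0 M" by simp
    have "ennreal (LBINT x. \<bar>V (t, x)\<bar> powr p) \<le> Wsp_norm_pow s p (v t)"
      using p_integrable_nn[OF V_Lp[OF t0]] t0 by (simp add: Vv Wsp_norm_pow_def Lp_pow_def)
    also have "\<dots> \<le> ennreal (max 0 M)" by (rule order_trans[OF le]) (simp add: ennreal_leI)
    finally show "(LBINT x. \<bar>V (t, x)\<bar> powr p) \<le> max 0 M" by simp
  qed
  have good_eq: "(LBINT x. Jp p (W (\<tau>, x)) * V (\<sigma>, x)) +
        (\<integral>z. Jp p (V (\<tau>, fst z) - V (\<tau>, snd z)) * (V (\<sigma>, fst z) - V (\<sigma>, snd z)) \<partial>gagliardo s p) = 0"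
    if \<tau>: "\<tau> \<in> G" and \<sigma>: "\<sigma> \<in> G" for \<tau> \<sigma>
  proof -
    have t0: "0 \<le> \<tau>" "0 \<le> \<sigma>" and Wt: "p_integrable p lborel (\<lambda>x. W (\<tau>, x))"
      and v\<sigma>: "v \<sigma> \<in> Wsp0 s p \<Omega>" and lim: "(\<lambda>k. Wsp_norm_pow s p (\<lambda>x. v \<sigma> x - S k \<sigma> x)) \<longlonglongrightarrow> 0"
      using \<tau> \<sigma> by (auto simp: G_def)
    have fin0: "S k \<sigma> \<in> Wsp0 s p \<Omega>" for k using SW t0 by simp
    note D = Wsp0D[OF fin0]
    have approx: "(LBINT x. Jp p (W (\<tau>, x)) * S k \<sigma> x) +
        (\<integral>z. Jp p (V (\<tau>, fst z) - V (\<tau>, snd z)) * (S k \<sigma> (fst z) - S k \<sigma> (snd z)) \<partial>gagliardo s p) = 0" for k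
    proof -
      note [measurable] = D(1)[of k]
      have "EQ \<tau> (S k \<sigma>)" using \<tau> t0 by (auto simp: G_def \<Phi>_def)
      moreover have "(LINT x:\<Omega>|lborel. Jp p (w \<tau> x) * S k \<sigma> x) = (LBINT x. Jp p (W (\<tau>, x)) * S k \<sigma> x)"
        unfolding set_lebesgue_integral_def using t0
        by (intro Bochner_Integration.integral_cong) (auto simp: W_def indicator_def)
      moreover have "(LINT z|(lborel \<Otimes>\<^sub>M lborel).
              Jp p (v \<tau> (fst z) - v \<tau> (snd z)) * (S k \<sigma> (fst z) - S k \<sigma> (snd z)) /
                norm (fst z - snd z) powr (real DIM('a) + s * p))
          = (\<integral>z. Jp p (V (\<tau>, fst z) - V (\<tau>, snd z)) * (S k \<sigma> (fst z) - S k \<sigma> (snd z)) \<partial>gagliardo s p)"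
        unfolding gagliardo_def lborel_prod
        by (subst integral_density) (auto simp: Vv t0)
      ultimately show ?thesis by (simp add: EQ_def)
    qed
    have pS: "p_integrable p lborel (S k \<sigma>)" "p_integrable p (gagliardo s p) (\<lambda>z. S k \<sigma> (fst z) - S k \<sigma> (snd z))" for k
      using Wsp_p_integrable[OF D] by blast+
    have l: "(\<lambda>k. LBINT x. \<bar>S k \<sigma> x - V (\<sigma>, x)\<bar> powr p) \<longlonglongrightarrow> 0"
      "(\<lambda>k. \<integral>z. \<bar>(S k \<sigma> (fst z) - S k \<sigma> (snd z)) - (V (\<sigma>, fst z) - V (\<sigma>, snd z))\<bar> powr p \<partial>gagliardo s p) \<longlonglongrightarrow> 0"
    proof -
      define u where "u k x = v \<sigma> x - S k \<sigma> x" for k x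
      have um: "u k \<in> borel_measurable borel" for k
        unfolding u_def using sec[OF t0(2)] D(1)[of k] by measurable
      have uL: "p_integrable p lborel (u k)" for k
        unfolding u_def using p_integrable_diff[OF p Wsp_p_integrable(1)[OF Wsp0D[OF v\<sigma>]] pS(1)] .
      have uG: "p_integrable p (gagliardo s p) (\<lambda>z. u k (fst z) - u k (snd z))" for k
        using p_integrable_diff[OF p Wsp_p_integrable(2)[OF Wsp0D[OF v\<sigma>]] pS(2)[of k]]
        by (simp add: u_def algebra_simps)
      have ufin: "Wsp_norm_pow s p (u k) < \<infinity>" for k
        using p_integrable_nn[OF uL[of k]] p_integrable_nn[OF uG[of k]]
        by (simp add: Wsp_norm_pow_def Wsp_semi_pow_gagliardo[OF um] Lp_pow_def)
      have ul: "(\<lambda>k. Wsp_norm_pow s p (u k)) \<longlonglongrightarrow> 0" using lim by (simp add: u_def[abs_def])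
      show "(\<lambda>k. LBINT x. \<bar>S k \<sigma> x - V (\<sigma>, x)\<bar> powr p) \<longlonglongrightarrow> 0"
        using Wsp_norm_tendsto_zero(1)[OF um ufin ul] t0 by (simp add: u_def Vv abs_minus_commute)
      have "\<bar>u k (fst z) - u k (snd z)\<bar> = \<bar>(S k \<sigma> (fst z) - S k \<sigma> (snd z)) - (V (\<sigma>, fst z) - V (\<sigma>, snd z))\<bar>" for k z
        using t0 by (simp add: u_def Vv)
      then show "(\<lambda>k. \<integral>z. \<bar>(S k \<sigma> (fst z) - S k \<sigma> (snd z)) - (V (\<sigma>, fst z) - V (\<sigma>, snd z))\<bar> powr p \<partial>gagliardo s p) \<longlonglongrightarrow> 0"
        using Wsp_norm_tendsto_zero(2)[OF um ufin ul] by simp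
    qed
    have "(\<lambda>k. (LBINT x. Jp p (W (\<tau>, x)) * S k \<sigma> x) +
        (\<integral>z. Jp p (V (\<tau>, fst z) - V (\<tau>, snd z)) * (S k \<sigma> (fst z) - S k \<sigma> (snd z)) \<partial>gagliardo s p))
      \<longlonglongrightarrow> (LBINT x. Jp p (W (\<tau>, x)) * V (\<sigma>, x)) +
        (\<integral>z. Jp p (V (\<tau>, fst z) - V (\<tau>, snd z)) * (V (\<sigma>, fst z) - V (\<sigma>, snd z)) \<partial>gagliardo s p)"
      by (intro tendsto_add integral_Jp_tendsto_norm[OF p Wt V_Lp[OF t0(2)] pS(1) l(1)]
          integral_Jp_tendsto_norm[OF p good(1)[OF \<tau>] good(1)[OF \<sigma>] pS(2) l(2)])
    then show ?thesis unfolding approx by (simp add: LIMSEQ_const_iff)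
  qed
  \<comment> \<open>M need not be nonnegative, as the bound in terms of \<open>ennreal M\<close> also makes sense for negative M.\<close>
  have "energy_flow p (max 0 M) V W (gagliardo s p) G"
  proof (rule energy_flow.intro)
    show "0 \<le> t" if "t \<in> G" for t using that by (simp add: G_def)
    show "p_integrable p lborel (\<lambda>x. W (t, x))" if "t \<in> G" for t using that by (simp add: G_def)
  qed (fact p Vm Wm sets_gagliardo sigma_finite_gagliardo AE_gagliardo V_Lp V_cont W_Lp W_int increment good_AE good good_eq)+
  then show ?thesis by (rule that)
qed

theorem proposition3p6:
  fixes \<Omega> :: "'a::euclidean_space set"
    and p s :: real
    and g :: "'a \<Rightarrow> real"
    and v :: "real \<Rightarrow> 'a \<Rightarrow> real"
  assumes "open \<Omega>" and "connected \<Omega>" and "\<Omega> \<noteq> {}" and "bounded \<Omega>"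
    and "1 < p" and "0 < s" and "s < 1"
    and "g \<in> Wsp0 s p \<Omega>"
    and "weak_solution s p \<Omega> g v"
    and "\<And>t. 0 \<le> t \<Longrightarrow> \<not> (AE x in lborel. x \<in> \<Omega> \<longrightarrow> v t x = 0)"
  shows "antimono_on {0..} (\<lambda>t. Wsp_semi_pow s p (v t) / Lp_pow p \<Omega> (v t))"
proof -
  define V where "V z = indicator ({0..} \<times> UNIV) z *\<^sub>R v (fst z) (snd z)" for z
  obtain M W G where ef: "energy_flow p M V W (gagliardo s p) G"
    using weak_solution_energy_flow[OF assms(1,4,5,9)] unfolding V_def[abs_def] .
  interpret energy_flow p M V W "gagliardo s p" G by (rule ef)
  have Vv: "V (t, x) = v t x" if "0 \<le> t" for t x using that by (simp add: V_def)
  have vm: "v t \<in> borel_measurable borel" if "0 \<le> t" for t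
    using p_integrable_measurable[OF V_Lp[OF that]] that by (simp add: Vv)
  have out: "AE x in lborel. x \<notin> \<Omega> \<longrightarrow> v t x = 0" if "0 \<le> t" for t
    using assms(9) that unfolding weak_solution_def by blast
  have E: "Wsp_semi_pow s p (v t) = ennreal (energy t)" if "0 \<le> t" for t
    using p_integrable_nn[OF dV_Lp[OF that]] that by (simp add: Wsp_semi_pow_gagliardo[OF vm] energy_def dV_def Vv)
  have N: "Lp_pow p \<Omega> (v t) = ennreal (mass t)" if "0 \<le> t" for t
  proof -
    have "Lp_pow p \<Omega> (v t) = (\<integral>\<^sup>+x. ennreal (\<bar>v t x\<bar> powr p) \<partial>lborel)"
      unfolding Lp_pow_def
      by (intro nn_integral_cong_AE, use out[OF that] in eventually_elim) (auto simp: indicator_def)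
    then show ?thesis using p_integrable_nn[OF V_Lp[OF that]] that by (simp add: mass_def Vv)
  qed
  have N_pos: "0 < mass t" if "0 \<le> t" for t
  proof (rule ccontr)
    assume "\<not> 0 < mass t"
    then have "Lp_pow p \<Omega> (v t) = 0" using N[OF that] mass_nonneg[of t] by simp
    then have "AE x in lborel. ennreal (\<bar>v t x\<bar> powr p) * indicator \<Omega> x = 0"
      unfolding Lp_pow_def using vm[OF that] assms(1) by (subst (asm) nn_integral_0_iff_AE) auto
    then have "AE x in lborel. x \<in> \<Omega> \<longrightarrow> v t x = 0" by eventually_elim (auto simp: indicator_def)
    then show False using assms(10)[OF that] by blast
  qed
  have Q: "Wsp_semi_pow s p (v t) / Lp_pow p \<Omega> (v t) = ennreal (energy t / mass t)" if "0 \<le> t" for t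
    using N_pos[OF that] by (simp add: E[OF that] N[OF that] divide_ennreal energy_nonneg)
  show ?thesis
  proof (rule monotone_onI)
    fix a b :: real assume ab: "a \<in> {0..}" "b \<in> {0..}" "a \<le> b"
    then have Na: "0 < mass a" by (intro N_pos) auto
    have "energy b \<le> energy a / mass a * mass b"
      by (rule sublevel_invariant[of a]) (use ab Na energy_nonneg[of a] in auto)
    then have "energy b / mass b \<le> energy a / mass a"
      using N_pos[of b] ab by (simp add: pos_divide_le_eq)
    then show "Wsp_semi_pow s p (v b) / Lp_pow p \<Omega> (v b) \<le> Wsp_semi_pow s p (v a) / Lp_pow p \<Omega> (v a)"
      using ab by (simp add: Q ennreal_leI)
  qed
qed

end
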